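(* Let $\Phi\subset T^*M_1\times(-T^*M_2)$ be a (formal) canonical relation with even generating function $S(x,q)$ and let $\Phi^*:\mathbf{C}^{\infty}(M_2)\to\mathbf{C}^{\infty}(M_1)$ be the corresponding generalized pullback, a formal mapping of functional manifolds. The derivative of $\Phi^*$ at a point $g\in\mathbf{C}^{\infty}(M_2)$ is given by $$(T\Phi^* )[g]=\varphi_g^* ,$$ where $\varphi_g^*:C^{\infty}(M_2)\to C^{\infty}(M_1)$ is the usual pullback with respect to the map $\varphi_g:M_1\to M_2$ defined by $g$, i.e. the map $x\mapsto y=\varphi_g(x)$ where $y$ is the solution of $$y^i=(-1)^{\tilde\imath}\frac{\partial S}{\partial q_i}\Bigl(x,\frac{\partial g}{\partial y}(y)\Bigr).$$
   Context: $M_1$ and $M_2$ are smooth manifolds or supermanifolds with local coordinates $x^a$ and $y^i$; $p_a$ and $q_i$ are the conjugate momenta on $T^*M_1$ and $T^*M_2$; $\tilde a,\tilde\imath$ are the parities of $x^a,y^i$ (and of $p_a,q_i$). Derivatives are left derivatives; repeated indices are summed. $T^*M_1\times(-T^*M_2)$ is $T^*M_1\times T^*M_2$ with the difference $dp_adx^a-dq_idy^i$ of the canonical symplectic forms. $C^{\infty}(M)$ is the $\mathbb Z_2$-graded vector space of functions; $\mathbf{C}^{\infty}(M)$ is the corresponding infinite-dimensional (super)manifold, whose points are even functions on $M$ (possibly depending on auxiliary odd parameters). Canonical relation with generating function: the Lagrangian submanifold $$\Phi=\Bigl\{(x^a,p_a,y^i,q_i)\ \Bigl|\ p_a=\frac{\partial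 S}{\partial x^a}(x,q),\ y^i=(-1)^{\tilde\imath}\frac{\partial S}{\partial q_i}(x,q)\Bigr\},$$ where the even function $S$ is part of the structure and is a formal power series in $q$: $S(x,q)=S_0(x)+\varphi^i(x)q_i+\frac12S^{ij}(x)q_jq_i+\dots$, with $y^i=\varphi^i(x)$ defining a smooth map $\varphi:M_1\to M_2$. Under coordinate changes, $S'(x',q')=S(x,q)-y^iq_i+y^{i'}q_{i'}$, where $x^a=x^a(x')$, $y^{i'}=y^{i'}(y)$, $q_i=\frac{\partial y^{i'}}{\partial y^i}(y)q_{i'}$, $y^i=(-1)^{\tilde\imath}\frac{\partial S}{\partial q_i}(x,q)$. Generalized pullback: for even $g$, $\Phi^*[g]=f$ with $f(x)=g(y)+S(x,q)-y^iq_i$, where $q_i=\frac{\partial g}{\partial y^i}(y)$ and $y^i=(-1)^{\tilde\imath}\frac{\partial S}{\partial q_i}\bigl(x,\frac{\partial g}{\partial y}(y)\bigr)$. The latter equation is solved by iterations as a formal power series in $g$, $\varphi_g=\varphi+\varphi_1[g]+\varphi_2[g]+\dots$, with $\varphi_N[g]$ homogeneous of order $N$ in $g$; so $\varphi_g$ and $\Phi^*$ are formal power series in $g$, and the identity is one of formal power series in $g$. The derivative $(T\Phi^* )[g]$ is the linear map defined by $\Phi^*[g+\varepsilon u]=\Phi^*[g]+\varepsilon\,(T\Phi^* )[g](u)$ for $\varepsilon^2=0$, $u\in C^\infty(M_2)$, $\tilde\varepsilon=\tilde u$. *)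

theory Defs
  imports "HOL-Analysis.Analysis" "HOL-Library.FSet" "HOL-Library.Groups_Big_Fun"
    "HOL-Library.Countable"
begin

section \<open>Supercommutative formal power series\<close>

text \<open>
  All local expressions take values in one supercommutative algebra of formal power series over the
  reals.  Its even generators are a formal parameter \<open>Scale\<close>, which records the order of homogeneity
  in \<open>g\<close>, and the even momenta \<open>EMom i\<close>; its odd generators are the odd coordinates \<open>OCoord j\<close>, the
  odd momenta \<open>OMom j\<close> and an infinite supply of auxiliary odd parameters \<open>Param k\<close>.  Even
  coordinates are not generators: local expressions depend on them as smooth functions.
\<close>

datatype evar = Scale | EMom nat
datatype ovar = OCoord nat | OMom nat | Param nat

instance evar :: countable by countable_datatype
instance ovar :: countable by countable_datatype

text \<open>The choice of order only fixes in which order the factors of a basis monomial are written.\<close>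

instantiation evar :: linorder
begin
definition less_eq_evar :: "evar \<Rightarrow> evar \<Rightarrow> bool" where "less_eq_evar v w \<longleftrightarrow> to_nat v \<le> to_nat w"
definition less_evar :: "evar \<Rightarrow> evar \<Rightarrow> bool" where "less_evar v w \<longleftrightarrow> to_nat v < to_nat w"
instance by standard (auto simp: less_eq_evar_def less_evar_def)
end

instantiation ovar :: linorder
begin
definition less_eq_ovar :: "ovar \<Rightarrow> ovar \<Rightarrow> bool" where "less_eq_ovar v w \<longleftrightarrow> to_nat v \<le> to_nat w"
definition less_ovar :: "ovar \<Rightarrow> ovar \<Rightarrow> bool" where "less_ovar v w \<longleftrightarrow> to_nat v < to_nat w"
instance by standard (auto simp: less_eq_ovar_def less_ovar_def)
end

type_synonym mono = "evar multiset \<times> ovar fset"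

typedef sfps = "UNIV :: (mono \<Rightarrow> real) set" morphisms coeff Sfps ..

lemma coeff_Sfps [simp]: "coeff (Sfps f) = f"
  by (simp add: Sfps_inverse)

lemma sfps_eqI: "(\<And>m. coeff f m = coeff g m) \<Longrightarrow> f = g"
  by (metis coeff_inject ext)

definition mono_join :: "mono \<Rightarrow> mono \<Rightarrow> mono" where
  "mono_join m n = (fst m + fst n, snd m |\<union>| snd n)"

definition inversions :: "ovar fset \<Rightarrow> ovar fset \<Rightarrow> (ovar \<times> ovar) set" where
  "inversions J K = {(j, k). j |\<in>| J \<and> k |\<in>| K \<and> k < j}"

text \<open>The product of the basis monomials \<open>m\<close> and \<open>n\<close> is \<open>koszul m n\<close> times \<open>mono_join m n\<close>.\<close>

definition koszul :: "mono \<Rightarrow> mono \<Rightarrow> real" where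
  "koszul m n =
     (if snd m |\<inter>| snd n = {||} then (- 1) ^ card (inversions (snd m) (snd n)) else 0)"

instantiation sfps :: "{zero, one, plus, minus, uminus, times, scaleR}"
begin
definition zero_sfps :: sfps where "0 = Sfps (\<lambda>m. 0)"
definition one_sfps :: sfps where "1 = Sfps (\<lambda>m. if m = ({#}, {||}) then 1 else 0)"
definition plus_sfps :: "sfps \<Rightarrow> sfps \<Rightarrow> sfps" where "f + g = Sfps (\<lambda>m. coeff f m + coeff g m)"
definition minus_sfps :: "sfps \<Rightarrow> sfps \<Rightarrow> sfps" where "f - g = Sfps (\<lambda>m. coeff f m - coeff g m)"
definition uminus_sfps :: "sfps \<Rightarrow> sfps" where "- f = Sfps (\<lambda>m. - coeff f m)"
definition times_sfps :: "sfps \<Rightarrow> sfps \<Rightarrow> sfps" where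
  "f * g = Sfps (\<lambda>m. \<Sum>(k, l) \<in> {(k, l). mono_join k l = m}. koszul k l * (coeff f k * coeff g l))"
definition scaleR_sfps :: "real \<Rightarrow> sfps \<Rightarrow> sfps" where "r *\<^sub>R f = Sfps (\<lambda>m. r * coeff f m)"
instance ..
end

lemma coeff_simps [simp]:
  "coeff 0 m = 0" "coeff 1 m = (if m = ({#}, {||}) then 1 else 0)"
  "coeff (f + g) m = coeff f m + coeff g m" "coeff (f - g) m = coeff f m - coeff g m"
  "coeff (- f) m = - coeff f m" "coeff (r *\<^sub>R f) m = r * coeff f m"
  by (simp_all add: zero_sfps_def one_sfps_def plus_sfps_def minus_sfps_def uminus_sfps_def
      scaleR_sfps_def)

lemma coeff_mult:
  "coeff (f * g) m =
     (\<Sum>(k, l) \<in> {(k, l). mono_join k l = m}. koszul k l * (coeff f k * coeff g l))"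
  by (simp add: times_sfps_def)

lemma finite_divisors: "finite {k. \<exists>l. mono_join k l = m}"
proof -
  have "{k. \<exists>l. mono_join k l = m} \<subseteq> {A. A \<subseteq># fst m} \<times> {J. J |\<subseteq>| snd m}"
    by (auto simp: mono_join_def)
  moreover have "finite {A. A \<subseteq># fst m}"
  proof (rule finite_subset)
    show "{A. A \<subseteq># fst m} \<subseteq> (\<Union>n\<le>size (fst m). {A. set_mset A \<subseteq> set_mset (fst m) \<and> size A = n})"
      using set_mset_mono size_mset_mono by fastforce
    have "finite {A. set_mset A \<subseteq> set_mset (fst m) \<and> size A = n}" for n
    proof (rule finite_subset)
      show "{A. set_mset A \<subseteq> set_mset (fst m) \<and> size A = n}
          \<subseteq> mset ` {xs. set xs \<subseteq> set_mset (fst m) \<and> length xs = n}"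
        by (smt (verit, best) ex_mset imageI mem_Collect_eq set_mset_mset size_mset subsetI)
    qed (simp add: finite_lists_length_eq)
    then show "finite (\<Union>n\<le>size (fst m). {A. set_mset A \<subseteq> set_mset (fst m) \<and> size A = n})"
      by blast
  qed
  moreover have "finite {J. J |\<subseteq>| snd m}"
  proof -
    have "{J. J |\<subseteq>| snd m} = fset (fPow (snd m))" by auto
    then show ?thesis by simp
  qed
  ultimately show ?thesis
    by (meson finite_SigmaI finite_subset)
qed

lemma mono_join_commute: "mono_join k l = mono_join l k"
  by (auto simp: mono_join_def add.commute)

lemma mono_join_assoc: "mono_join (mono_join k l) m = mono_join k (mono_join l m)"
  by (auto simp: mono_join_def add.assoc sup_assoc)

lemma finite_splits [simp]: "finite {(k, l). mono_join k l = m}"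
proof (rule finite_subset)
  show "{(k, l). mono_join k l = m} \<subseteq> {k. \<exists>l. mono_join k l = m} \<times> {k. \<exists>l. mono_join k l = m}"
    using mono_join_commute by (clarsimp simp del: split_paired_Ex) metis
qed (intro finite_cartesian_product finite_divisors)

lemma finite_inversions [simp]: "finite (inversions J K)"
  by (rule finite_subset[of _ "fset J \<times> fset K"]) (auto simp: inversions_def)

lemma koszul_cocycle:
  "koszul k l * koszul (mono_join k l) m = koszul l m * koszul k (mono_join l m)"
proof (cases "snd k |\<inter>| snd l = {||} \<and> snd k |\<inter>| snd m = {||} \<and> snd l |\<inter>| snd m = {||}")
  case True
  have 1: "inversions (snd k |\<union>| snd l) (snd m) = inversions (snd k) (snd m) \<union> inversions (snd l) (snd m)"
    by (auto simp: inversions_def)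
  have 2: "inversions (snd k) (snd l |\<union>| snd m) = inversions (snd k) (snd l) \<union> inversions (snd k) (snd m)"
    by (auto simp: inversions_def)
  have 3: "card (inversions (snd k |\<union>| snd l) (snd m))
      = card (inversions (snd k) (snd m)) + card (inversions (snd l) (snd m))"
    unfolding 1 by (rule card_Un_disjoint[OF finite_inversions finite_inversions])
      (use True in \<open>auto simp: inversions_def\<close>)
  have 4: "card (inversions (snd k) (snd l |\<union>| snd m))
      = card (inversions (snd k) (snd l)) + card (inversions (snd k) (snd m))"
    unfolding 2 by (rule card_Un_disjoint[OF finite_inversions finite_inversions])
      (use True in \<open>auto simp: inversions_def\<close>)
  have 5: "(snd k |\<union>| snd l) |\<inter>| snd m = {||}" "snd k |\<inter>| (snd l |\<union>| snd m) = {||}"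
    using True by auto
  show ?thesis using True by (simp add: koszul_def mono_join_def 3 4 5 power_add)
next
  case False
  then show ?thesis by (auto simp: koszul_def mono_join_def inf_sup_distrib1 inf_sup_distrib2)
qed

lemma sfps_mult_assoc: "(f * g) * h = f * (g * (h :: sfps))"
proof (rule sfps_eqI)
  fix m
  let ?S = "\<lambda>n. {(k, l). mono_join k l = n}"
  have "coeff ((f * g) * h) m =
    (\<Sum>(p, n) \<in> ?S m. \<Sum>(k, l) \<in> ?S p.
        koszul k l * koszul (mono_join k l) n * (coeff f k * coeff g l * coeff h n))"
    unfolding coeff_mult
    by (intro sum.cong refl) (auto simp: sum_distrib_left sum_distrib_right intro!: sum.cong)
  also have "\<dots> = (\<Sum>((p, n), (k, l)) \<in> (SIGMA x:?S m. ?S (fst x)).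
        koszul k l * koszul (mono_join k l) n * (coeff f k * coeff g l * coeff h n))"
    by (subst sum.Sigma[symmetric]) (auto intro!: sum.cong)
  also have "\<dots> = (\<Sum>((k, p), (l, n)) \<in> (SIGMA x:?S m. ?S (snd x)).
        koszul l n * koszul k (mono_join l n) * (coeff f k * coeff g l * coeff h n))"
    by (rule sum.reindex_bij_witness[of _
          "\<lambda>((k, p), (l, n)). ((mono_join k l, n), (k, l))"
          "\<lambda>((p, n), (k, l)). ((k, mono_join l n), (l, n))"])
      (auto simp: koszul_cocycle, (metis mono_join_assoc)+)
  also have "\<dots> = (\<Sum>(k, p) \<in> ?S m. \<Sum>(l, n) \<in> ?S p.
        koszul l n * koszul k (mono_join l n) * (coeff f k * coeff g l * coeff h n))"
    by (subst sum.Sigma[symmetric]) (auto intro!: sum.cong)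
  also have "\<dots> = coeff (f * (g * h)) m"
    unfolding coeff_mult
    by (intro sum.cong refl) (auto simp: sum_distrib_left sum_distrib_right intro!: sum.cong)
  finally show "coeff ((f * g) * h) m = coeff (f * (g * h)) m" .
qed

lemma sfps_mult_one: "1 * f = f" "f * 1 = (f :: sfps)"
proof -
  have "coeff (1 * f) m = coeff f m" for m
  proof -
    have "coeff (1 * f) m = (\<Sum>(k, l) \<in> {(({#}, {||}), m)}. koszul k l * (coeff 1 k * coeff f l))"
      unfolding coeff_mult by (rule sum.mono_neutral_right[OF finite_splits]) (auto simp: mono_join_def split: if_splits)
    then show ?thesis by (simp add: koszul_def inversions_def)
  qed
  then show "1 * f = f" by (rule sfps_eqI)
  have "coeff (f * 1) m = coeff f m" for m
  proof -
    have "coeff (f * 1) m = (\<Sum>(k, l) \<in> {(m, ({#}, {||}))}. koszul k l * (coeff f k * coeff 1 l))"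
      unfolding coeff_mult by (rule sum.mono_neutral_right[OF finite_splits]) (auto simp: mono_join_def split: if_splits)
    then show ?thesis by (simp add: koszul_def inversions_def)
  qed
  then show "f * 1 = f" by (rule sfps_eqI)
qed

instance sfps :: real_algebra_1
proof
  fix a b c :: sfps and r s :: real
  show "a * b * c = a * (b * c)" by (rule sfps_mult_assoc)
  show "1 * a = a" "a * 1 = a" by (rule sfps_mult_one)+
  show "(a + b) * c = a * c + b * c" "a * (b + c) = a * b + a * c"
    "(r *\<^sub>R a) * b = r *\<^sub>R (a * b)" "a * (r *\<^sub>R b) = r *\<^sub>R (a * b)"
    by (auto intro!: sfps_eqI sum.cong simp: coeff_mult case_prod_unfold algebra_simps
        sum.distrib[symmetric] sum_distrib_left)
  have "coeff (0 :: sfps) ({#}, {||}) \<noteq> coeff 1 ({#}, {||})" by simp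
  then show "(0 :: sfps) \<noteq> 1" by metis
qed (auto intro!: sfps_eqI simp: algebra_simps)

definition even_gen :: "evar \<Rightarrow> sfps" where
  "even_gen v = Sfps (\<lambda>m. if m = ({#v#}, {||}) then 1 else 0)"

definition odd_gen :: "ovar \<Rightarrow> sfps" where
  "odd_gen v = Sfps (\<lambda>m. if m = ({#}, {|v|}) then 1 else 0)"

definition even_deriv :: "evar \<Rightarrow> sfps \<Rightarrow> sfps" where
  "even_deriv v f = Sfps (\<lambda>(A, J). real (Suc (count A v)) * coeff f (add_mset v A, J))"

text \<open>The left derivative: the generator is moved to the front before it is removed.\<close>

definition odd_deriv :: "ovar \<Rightarrow> sfps \<Rightarrow> sfps" where
  "odd_deriv v f = Sfps (\<lambda>(A, J).
     if v |\<in>| J then 0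
     else (- 1) ^ card {w. w |\<in>| J \<and> w < v} * coeff f (A, finsert v J))"

text \<open>Parities are booleans, with \<open>True\<close> for odd.\<close>

definition has_parity :: "bool \<Rightarrow> sfps \<Rightarrow> bool" where
  "has_parity s f \<longleftrightarrow> (\<forall>A J. coeff f (A, J) \<noteq> 0 \<longrightarrow> odd (fcard J) = s)"

definition involves_only :: "evar set \<Rightarrow> ovar set \<Rightarrow> sfps \<Rightarrow> bool" where
  "involves_only V W f \<longleftrightarrow> (\<forall>A J. coeff f (A, J) \<noteq> 0 \<longrightarrow> set_mset A \<subseteq> V \<and> fset J \<subseteq> W)"

definition const_term :: "sfps \<Rightarrow> real" where
  "const_term f = coeff f ({#}, {||})"

text \<open>A sum of a family in which every monomial occurs only finitely often.\<close>

definition formal_sum :: "('i \<Rightarrow> sfps) \<Rightarrow> sfps" where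
  "formal_sum F = Sfps (\<lambda>m. Sum_any (\<lambda>i. coeff (F i) m))"


section \<open>Superfunctions of local coordinates\<close>

text \<open>
  A superdomain of dimension \<open>n|m\<close> has the coordinates \<open>Ev i\<close> with \<open>i < n\<close> and \<open>Od j\<close> with
  \<open>j < m\<close>.  Points of its body are sequences that vanish from index \<open>n\<close> on.
\<close>

datatype coord = Ev nat | Od nat

definition coord_parity :: "coord \<Rightarrow> bool" where
  "coord_parity k = (case k of Ev i \<Rightarrow> False | Od j \<Rightarrow> True)"

definition coord_sign :: "coord \<Rightarrow> sfps" where
  "coord_sign k = (if coord_parity k then - 1 else 1)"

definition coords :: "nat \<Rightarrow> nat \<Rightarrow> coord set" where
  "coords n m = Ev ` {..<n} \<union> Od ` {..<m}"

type_synonym point = "nat \<Rightarrow> real"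
type_synonym superfun = "point \<Rightarrow> sfps"

definition body_space :: "nat \<Rightarrow> point set" where
  "body_space n = {x. \<forall>i\<ge>n. x i = 0}"

definition partial :: "nat \<Rightarrow> (point \<Rightarrow> real) \<Rightarrow> point \<Rightarrow> real" where
  "partial i h x = deriv (\<lambda>s. h (x(i := s))) (x i)"

primrec partials :: "nat list \<Rightarrow> (point \<Rightarrow> real) \<Rightarrow> point \<Rightarrow> real" where
  "partials [] h = h"
| "partials (i # is) h = partial i (partials is h)"

definition smooth_on :: "nat \<Rightarrow> point set \<Rightarrow> (point \<Rightarrow> real) \<Rightarrow> bool" where
  "smooth_on n U h \<longleftrightarrow> (\<forall>is \<in> lists {..<n}.
     continuous_on U (partials is h) \<and>
     (\<forall>x\<in>U. \<forall>i<n. (\<lambda>s. partials is h (x(i := s))) differentiable at (x i)))"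

definition smooth_superfun_on :: "nat \<Rightarrow> point set \<Rightarrow> superfun \<Rightarrow> bool" where
  "smooth_superfun_on n U f \<longleftrightarrow> (\<forall>m. smooth_on n U (\<lambda>x. coeff (f x) m))"

definition coord_fun :: "coord \<Rightarrow> superfun" where
  "coord_fun k x = (case k of Ev i \<Rightarrow> of_real (x i) | Od j \<Rightarrow> odd_gen (OCoord j))"

definition momentum :: "coord \<Rightarrow> sfps" where
  "momentum k = (case k of Ev i \<Rightarrow> even_gen (EMom i) | Od j \<Rightarrow> odd_gen (OMom j))"

definition coord_deriv :: "coord \<Rightarrow> superfun \<Rightarrow> superfun" where
  "coord_deriv k f x = (case k of
       Ev i \<Rightarrow> Sfps (\<lambda>m. partial i (\<lambda>z. coeff (f z) m) x)
     | Od j \<Rightarrow> odd_deriv (OCoord j) (f x))"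

definition momentum_deriv :: "coord \<Rightarrow> superfun \<Rightarrow> superfun" where
  "momentum_deriv k f x = (case k of
       Ev i \<Rightarrow> even_deriv (EMom i) (f x)
     | Od j \<Rightarrow> odd_deriv (OMom j) (f x))"

text \<open>
  The result of substituting \<open>y\<close> for the coordinates and \<open>q\<close> for the momenta in \<open>f\<close>, on a domain
  with \<open>n\<close> even coordinates.  The dependence on the even coordinates is expanded in a Taylor series
  at the point given by the constant terms of \<open>y\<close>; its terms of order \<open>r\<close> are indexed by the
  sequences of \<open>r\<close> indices.  The substitution is meaningful when the components of \<open>y\<close> and \<open>q\<close>
  have the parity of the corresponding coordinate and \<open>q\<close> has no constant terms.
\<close>

definition even_subst :: "(coord \<Rightarrow> sfps) \<Rightarrow> evar \<Rightarrow> sfps" where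
  "even_subst q v = (case v of Scale \<Rightarrow> even_gen Scale | EMom i \<Rightarrow> q (Ev i))"

definition odd_subst :: "(coord \<Rightarrow> sfps) \<Rightarrow> (coord \<Rightarrow> sfps) \<Rightarrow> ovar \<Rightarrow> sfps" where
  "odd_subst y q w = (case w of
     OCoord j \<Rightarrow> y (Od j) | OMom j \<Rightarrow> q (Od j) | Param k \<Rightarrow> odd_gen (Param k))"

definition mono_subst :: "(coord \<Rightarrow> sfps) \<Rightarrow> (coord \<Rightarrow> sfps) \<Rightarrow> mono \<Rightarrow> sfps" where
  "mono_subst y q m =
     prod_list (map (even_subst q) (sorted_list_of_multiset (fst m))) *
     prod_list (map (odd_subst y q) (sorted_list_of_fset (snd m)))"

definition body :: "nat \<Rightarrow> (coord \<Rightarrow> sfps) \<Rightarrow> point" where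
  "body n y i = (if i < n then const_term (y (Ev i)) else 0)"

definition substitute :: "nat \<Rightarrow> superfun \<Rightarrow> (coord \<Rightarrow> sfps) \<Rightarrow> (coord \<Rightarrow> sfps) \<Rightarrow> sfps" where
  "substitute n f y q = formal_sum (\<lambda>(is, m).
     if is \<in> lists {..<n}
     then (partials is (\<lambda>z. coeff (f z) m) (body n y) / fact (length is)) *\<^sub>R
          (prod_list (map (\<lambda>i. y (Ev i) - of_real (body n y i)) is) * mono_subst y q m)
     else 0)"

abbreviation substitute_coords :: "nat \<Rightarrow> superfun \<Rightarrow> (coord \<Rightarrow> sfps) \<Rightarrow> sfps" where
  "substitute_coords n f y \<equiv> substitute n f y (\<lambda>k. 0)"


section \<open>Supermanifolds\<close>

text \<open>
  A supermanifold is glued from superdomains.  \<open>transition M c d k\<close> is the \<open>k\<close>-th coordinate of the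
  chart \<open>d\<close> as a function of the coordinates of the chart \<open>c\<close>.
\<close>

record ('p, 'c) supermanifold_data =
  even_dim :: nat
  odd_dim :: nat
  charts :: "'c set"
  chart_dom :: "'c \<Rightarrow> 'p set"
  chart_map :: "'c \<Rightarrow> 'p \<Rightarrow> point"
  transition :: "'c \<Rightarrow> 'c \<Rightarrow> coord \<Rightarrow> superfun"

definition carrier :: "('p, 'c) supermanifold_data \<Rightarrow> 'p set" where
  "carrier M = (\<Union>c\<in>charts M. chart_dom M c)"

definition manifold_coords :: "('p, 'c) supermanifold_data \<Rightarrow> coord set" where
  "manifold_coords M = coords (even_dim M) (odd_dim M)"

text \<open>The body is a Hausdorff second countable manifold because of the sort of \<open>'p\<close>.\<close>

definition supermanifold ::
    "('p::{t2_space, second_countable_topology}, 'c) supermanifold_data \<Rightarrow> bool" where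
  "supermanifold M \<longleftrightarrow>
    (\<forall>c\<in>charts M.
       open (chart_dom M c) \<and>
       openin (top_of_set (body_space (even_dim M))) (chart_map M c ` chart_dom M c) \<and>
       (\<exists>\<psi>. homeomorphism (chart_dom M c) (chart_map M c ` chart_dom M c) (chart_map M c) \<psi>)) \<and>
    (\<forall>c\<in>charts M. \<forall>d\<in>charts M. \<forall>k\<in>manifold_coords M.
       smooth_superfun_on (even_dim M) (chart_map M c ` (chart_dom M c \<inter> chart_dom M d))
         (transition M c d k) \<and>
       (\<forall>p \<in> chart_dom M c \<inter> chart_dom M d.
          has_parity (coord_parity k) (transition M c d k (chart_map M c p)) \<and>
          involves_only {} (OCoord ` {..<odd_dim M}) (transition M c d k (chart_map M c p)) \<and>
          body (even_dim M) (\<lambda>k. transition M c d k (chart_map M c p)) = chart_map M d p)) \<and>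
    (\<forall>c\<in>charts M. \<forall>p\<in>chart_dom M c. \<forall>k\<in>manifold_coords M.
       transition M c c k (chart_map M c p) = coord_fun k (chart_map M c p)) \<and>
    (\<forall>c\<in>charts M. \<forall>d\<in>charts M. \<forall>e\<in>charts M. \<forall>k\<in>manifold_coords M.
       \<forall>p \<in> chart_dom M c \<inter> chart_dom M d \<inter> chart_dom M e.
         transition M c e k (chart_map M c p) =
           substitute_coords (even_dim M) (transition M d e k)
             (\<lambda>k. transition M c d k (chart_map M c p)))"

text \<open>
  Functions on \<open>M\<close>, possibly depending on the auxiliary odd parameters, as compatible families of
  local expressions.
\<close>

definition smooth_functions ::
    "('p::{t2_space, second_countable_topology}, 'c) supermanifold_data \<Rightarrow> ('c \<Rightarrow> superfun) set" where
  "smooth_functions M = {f.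
    (\<forall>c\<in>charts M.
       smooth_superfun_on (even_dim M) (chart_map M c ` chart_dom M c) (f c) \<and>
       (\<forall>p\<in>chart_dom M c.
          involves_only {} (OCoord ` {..<odd_dim M} \<union> range Param) (f c (chart_map M c p)))) \<and>
    (\<forall>c\<in>charts M. \<forall>d\<in>charts M. \<forall>p \<in> chart_dom M c \<inter> chart_dom M d.
       f c (chart_map M c p) =
         substitute_coords (even_dim M) (f d) (\<lambda>k. transition M c d k (chart_map M c p)))}"

definition smooth_functions_of_parity ::
    "bool \<Rightarrow> ('p::{t2_space, second_countable_topology}, 'c) supermanifold_data \<Rightarrow> ('c \<Rightarrow> superfun) set" where
  "smooth_functions_of_parity s M = {f \<in> smooth_functions M.
     \<forall>c\<in>charts M. \<forall>p\<in>chart_dom M c. has_parity s (f c (chart_map M c p))}"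


section \<open>Canonical relations with generating functions\<close>

text \<open>
  The formal Lagrangian submanifold with the equations \<open>p\<^sub>a = \<partial>S/\<partial>x\<^sup>a\<close> and
  \<open>y\<^sup>i = \<plusminus> \<partial>S/\<partial>q\<^sub>i\<close> carries no data beyond its generating function.  Since \<open>S\<close> is a formal power
  series in \<open>q\<close>, its local expression \<open>genfun \<Phi> a b\<close> lives where the chart \<open>a\<close> is mapped into
  the chart \<open>b\<close> by the body \<open>base_map \<Phi>\<close> of \<open>\<phi>\<close>.
\<close>

record ('p, 'c, 'q, 'd) relation_data =
  base_map :: "'p \<Rightarrow> 'q"
  genfun :: "'c \<Rightarrow> 'd \<Rightarrow> superfun"

definition overlap ::
    "('p, 'c) supermanifold_data \<Rightarrow> ('q, 'd) supermanifold_data \<Rightarrow> ('p, 'c, 'q, 'd) relation_data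
      \<Rightarrow> 'c \<Rightarrow> 'd \<Rightarrow> 'p set" where
  "overlap M1 M2 \<Phi> a b = {p \<in> chart_dom M1 a. base_map \<Phi> p \<in> chart_dom M2 b}"

text \<open>The expression \<open>\<plusminus> \<partial>S/\<partial>q\<^sub>k (x, q)\<close>.\<close>

definition y_equation ::
    "('p, 'c) supermanifold_data \<Rightarrow> superfun \<Rightarrow> (coord \<Rightarrow> sfps) \<Rightarrow> (coord \<Rightarrow> sfps) \<Rightarrow> coord \<Rightarrow> sfps" where
  "y_equation M1 S x q k = coord_sign k * substitute (even_dim M1) (momentum_deriv k S) x q"

text \<open>The map \<open>\<phi>\<close>: the coefficient of \<open>q\<^sub>k\<close> in \<open>S\<close>.\<close>

definition underlying_map ::
    "('p, 'c) supermanifold_data \<Rightarrow> ('p, 'c, 'q, 'd) relation_data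
      \<Rightarrow> 'c \<Rightarrow> 'd \<Rightarrow> coord \<Rightarrow> superfun" where
  "underlying_map M1 \<Phi> a b k x =
     y_equation M1 (genfun \<Phi> a b) (\<lambda>l. coord_fun l x) (\<lambda>l. 0) k"

definition smooth_map ::
    "('p::{t2_space, second_countable_topology}, 'c) supermanifold_data
      \<Rightarrow> ('q::{t2_space, second_countable_topology}, 'd) supermanifold_data
      \<Rightarrow> ('p \<Rightarrow> 'q) \<Rightarrow> ('c \<Rightarrow> 'd \<Rightarrow> coord \<Rightarrow> superfun) \<Rightarrow> bool" where
  "smooth_map M1 M2 \<beta> \<phi> \<longleftrightarrow>
    continuous_on (carrier M1) \<beta> \<and> \<beta> ` carrier M1 \<subseteq> carrier M2 \<and>
    (\<forall>a\<in>charts M1. \<forall>b\<in>charts M2.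
       (\<forall>k\<in>manifold_coords M2.
          smooth_superfun_on (even_dim M1)
            (chart_map M1 a ` {p \<in> chart_dom M1 a. \<beta> p \<in> chart_dom M2 b}) (\<phi> a b k)) \<and>
       (\<forall>p\<in>chart_dom M1 a. \<beta> p \<in> chart_dom M2 b \<longrightarrow>
          body (even_dim M2) (\<lambda>k. \<phi> a b k (chart_map M1 a p)) = chart_map M2 b (\<beta> p) \<and>
          (\<forall>k\<in>manifold_coords M2.
             has_parity (coord_parity k) (\<phi> a b k (chart_map M1 a p)) \<and>
             involves_only {} (OCoord ` {..<odd_dim M1}) (\<phi> a b k (chart_map M1 a p))))) \<and>
    (\<forall>a\<in>charts M1. \<forall>a'\<in>charts M1. \<forall>b\<in>charts M2. \<forall>b'\<in>charts M2.
       \<forall>p \<in> chart_dom M1 a \<inter> chart_dom M1 a'. \<beta> p \<in> chart_dom M2 b \<inter> chart_dom M2 b' \<longrightarrow>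
         (\<forall>k\<in>manifold_coords M2.
            substitute_coords (even_dim M1) (\<phi> a b' k) (\<lambda>l. transition M1 a' a l (chart_map M1 a' p)) =
              \<phi> a' b' k (chart_map M1 a' p) \<and>
            substitute_coords (even_dim M2) (transition M2 b b' k) (\<lambda>l. \<phi> a b l (chart_map M1 a p)) =
              \<phi> a b' k (chart_map M1 a p)))"

text \<open>
  In the transformation law, the coordinates \<open>x'\<close> and the momenta \<open>q'\<close> are the independent
  variables, \<open>x\<close> is expressed through \<open>x'\<close>, and \<open>y\<close>, \<open>q\<close> are determined by a system that has
  exactly one solution in formal power series in \<open>q'\<close>.
\<close>

definition transformation_law ::
    "('p::{t2_space, second_countable_topology}, 'c) supermanifold_data
      \<Rightarrow> ('q::{t2_space, second_countable_topology}, 'd) supermanifold_data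
      \<Rightarrow> ('p, 'c, 'q, 'd) relation_data \<Rightarrow> bool" where
  "transformation_law M1 M2 \<Phi> \<longleftrightarrow>
    (\<forall>a\<in>charts M1. \<forall>a'\<in>charts M1. \<forall>b\<in>charts M2. \<forall>b'\<in>charts M2.
       \<forall>p \<in> overlap M1 M2 \<Phi> a b \<inter> overlap M1 M2 \<Phi> a' b'.
         let x = (\<lambda>l. transition M1 a' a l (chart_map M1 a' p)); K = manifold_coords M2 in
         \<exists>y q.
           (\<forall>k\<in>K. q k = (\<Sum>l\<in>K.
              substitute_coords (even_dim M2) (coord_deriv k (transition M2 b b' l)) y * momentum l)) \<and>
           (\<forall>k\<in>K. y k = y_equation M1 (genfun \<Phi> a b) x q k) \<and>
           genfun \<Phi> a' b' (chart_map M1 a' p) =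
             substitute (even_dim M1) (genfun \<Phi> a b) x q
             - (\<Sum>k\<in>K. y k * q k)
             + (\<Sum>k\<in>K. substitute_coords (even_dim M2) (transition M2 b b' k) y * momentum k))"

definition canonical_relation ::
    "('p::{t2_space, second_countable_topology}, 'c) supermanifold_data
      \<Rightarrow> ('q::{t2_space, second_countable_topology}, 'd) supermanifold_data
      \<Rightarrow> ('p, 'c, 'q, 'd) relation_data \<Rightarrow> bool" where
  "canonical_relation M1 M2 \<Phi> \<longleftrightarrow>
    (\<forall>a\<in>charts M1. \<forall>b\<in>charts M2.
       smooth_superfun_on (even_dim M1) (chart_map M1 a ` overlap M1 M2 \<Phi> a b) (genfun \<Phi> a b) \<and>
       (\<forall>p \<in> overlap M1 M2 \<Phi> a b.
          has_parity False (genfun \<Phi> a b (chart_map M1 a p)) \<and>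
          involves_only (EMom ` {..<even_dim M2})
            (OCoord ` {..<odd_dim M1} \<union> OMom ` {..<odd_dim M2})
            (genfun \<Phi> a b (chart_map M1 a p)))) \<and>
    smooth_map M1 M2 (base_map \<Phi>) (underlying_map M1 \<Phi>) \<and>
    transformation_law M1 M2 \<Phi>"


section \<open>Generalized pullbacks\<close>

text \<open>
  A formal power series in \<open>g\<close> is represented by its value at the formal point \<open>formal_point g\<close>,
  that is, \<open>g\<close> multiplied by \<open>Scale\<close>: the coefficient of \<open>Scale ^ N\<close> is the term that is
  homogeneous of order \<open>N\<close> in \<open>g\<close>.  Below, \<open>G\<close> is such a formal point, or such a point plus
  \<open>\<epsilon> * u\<close> with nilpotent \<open>\<epsilon>\<close>.
\<close>

definition formal_point :: "('d \<Rightarrow> superfun) \<Rightarrow> 'd \<Rightarrow> superfun" where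
  "formal_point g b y = even_gen Scale * g b y"

definition momenta_at ::
    "('q, 'd) supermanifold_data \<Rightarrow> ('d \<Rightarrow> superfun) \<Rightarrow> 'd \<Rightarrow> (coord \<Rightarrow> sfps) \<Rightarrow> coord \<Rightarrow> sfps" where
  "momenta_at M2 G b y k = substitute_coords (even_dim M2) (coord_deriv k (G b)) y"

text \<open>
  Local expressions on \<open>M1\<close> are taken in the atlas consisting of the charts \<open>a\<close> restricted to
  \<open>overlap M1 M2 \<Phi> a b\<close>; they have the pair \<open>a\<close>, \<open>b\<close> as arguments.  The components of the solution
  outside the coordinates of \<open>M2\<close> are set to zero only in order to make the solution unique.
\<close>

definition phi ::
    "('p, 'c) supermanifold_data \<Rightarrow> ('q, 'd) supermanifold_data \<Rightarrow> ('p, 'c, 'q, 'd) relation_data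
      \<Rightarrow> ('d \<Rightarrow> superfun) \<Rightarrow> 'c \<Rightarrow> 'd \<Rightarrow> point \<Rightarrow> coord \<Rightarrow> sfps" where
  "phi M1 M2 \<Phi> G a b x = (THE y.
     (\<forall>k\<in>manifold_coords M2.
        y k = y_equation M1 (genfun \<Phi> a b) (\<lambda>l. coord_fun l x) (momenta_at M2 G b y) k) \<and>
     (\<forall>k. k \<notin> manifold_coords M2 \<longrightarrow> y k = 0))"

definition generalized_pullback ::
    "('p, 'c) supermanifold_data \<Rightarrow> ('q, 'd) supermanifold_data \<Rightarrow> ('p, 'c, 'q, 'd) relation_data
      \<Rightarrow> ('d \<Rightarrow> superfun) \<Rightarrow> 'c \<Rightarrow> 'd \<Rightarrow> superfun" where
  "generalized_pullback M1 M2 \<Phi> G a b x =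
     (let y = phi M1 M2 \<Phi> G a b x; q = momenta_at M2 G b y in
       substitute_coords (even_dim M2) (G b) y
       + substitute (even_dim M1) (genfun \<Phi> a b) (\<lambda>l. coord_fun l x) q
       - (\<Sum>k\<in>manifold_coords M2. y k * q k))"

definition usual_pullback ::
    "('q, 'd) supermanifold_data \<Rightarrow> ('c \<Rightarrow> 'd \<Rightarrow> point \<Rightarrow> coord \<Rightarrow> sfps)
      \<Rightarrow> ('d \<Rightarrow> superfun) \<Rightarrow> 'c \<Rightarrow> 'd \<Rightarrow> superfun" where
  "usual_pullback M2 \<psi> u a b x = substitute_coords (even_dim M2) (u b) (\<psi> a b x)"

text \<open>
  \<open>D\<close> is the derivative at \<open>G\<close> of the generalized pullback.  As \<open>\<epsilon>\<close> ranges over all elements of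
  square zero of the algebra of auxiliary parameters, including those built from parameters on which
  neither \<open>G\<close> nor \<open>u\<close> depends, the condition determines \<open>D\<close>.
\<close>

definition has_tangent_map ::
    "('p::{t2_space, second_countable_topology}, 'c) supermanifold_data
      \<Rightarrow> ('q::{t2_space, second_countable_topology}, 'd) supermanifold_data
      \<Rightarrow> ('p, 'c, 'q, 'd) relation_data \<Rightarrow> ('d \<Rightarrow> superfun)
      \<Rightarrow> (('d \<Rightarrow> superfun) \<Rightarrow> 'c \<Rightarrow> 'd \<Rightarrow> superfun) \<Rightarrow> bool" where
  "has_tangent_map M1 M2 \<Phi> G D \<longleftrightarrow>
    (\<forall>a\<in>charts M1. \<forall>b\<in>charts M2. \<forall>x \<in> chart_map M1 a ` overlap M1 M2 \<Phi> a b.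
      (\<forall>u\<in>smooth_functions M2. \<forall>v\<in>smooth_functions M2. \<forall>r s.
         D (\<lambda>c z. r *\<^sub>R u c z + s *\<^sub>R v c z) a b x = r *\<^sub>R D u a b x + s *\<^sub>R D v a b x) \<and>
      (\<forall>s. \<forall>u \<in> smooth_functions_of_parity s M2. \<forall>\<epsilon>.
         involves_only {} (range Param) \<epsilon> \<and> has_parity s \<epsilon> \<and> \<epsilon> * \<epsilon> = 0 \<longrightarrow>
         generalized_pullback M1 M2 \<Phi> (\<lambda>c z. G c z + \<epsilon> * u c z) a b x =
           generalized_pullback M1 M2 \<Phi> G a b x + \<epsilon> * D u a b x))"

end

theory Submission
  imports Defs
begin

text \<open>
  Let \<open>y\<close>, \<open>q\<close> solve the equations for \<open>g\<close>, and let \<open>y + \<delta>\<close>, \<open>q + \<eta>\<close> solve them for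
  \<open>g + \<epsilon>u\<close>.  The expression \<open>g(y) + S(x, q) - yq\<close> is stationary in \<open>y\<close> and \<open>q\<close> at a solution:
  expanding it to first order, \<open>\<partial>g/\<partial>y = q\<close> cancels \<open>\<delta>q\<close> and \<open>\<partial>S/\<partial>q = \<plusminus>y\<close> cancels \<open>y\<eta>\<close>.
  Higher orders vanish because all \<open>\<delta>\<close> and \<open>\<eta>\<close> lie in a closed ideal of square zero generated
  by \<open>\<epsilon>\<close>, and only \<open>\<epsilon>u(y)\<close> remains.  The equation for \<open>y\<close> is solved by contraction in the
  filtration by the degree in \<open>Scale\<close> and the auxiliary parameters: substituting into a
  derivative of \<open>g\<close>, which has a factor of positive degree, gains one degree.
\<close>

text \<open>Everything happens at one point \<open>x\<close> of one pair of charts. There the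
  coordinates of \<open>x\<close> are substituted for themselves, all increments vanish, and
  \<open>S\<close> becomes a single series; only \<open>g\<close> and \<open>u\<close> need Taylor
  expansion. Two degrees are in play. The total degree makes Taylor series and substitutions
  converge coefficientwise: increments of \<open>y\<close> may consist of odd coordinates alone and
  then have formal degree 0. The formal degree drives the contraction: \<open>S\<close> contains
  neither \<open>Scale\<close> nor parameters and passes differences on, while \<open>g\<close>
  improves them. Nilpotency puts \<open>g + \<epsilon>u\<close> into the same class, since a real
  constant term with square zero is zero. The increments \<delta> arise as limits, and it is not
  evident that a limit of multiples of \<epsilon> is a multiple of \<epsilon>. They are therefore
  tested against homogeneous \<open>b\<close> with \<open>\<epsilon> * b = 0\<close>: an increment
  has to annihilate every such \<open>b\<close>. As \<epsilon> is itself such a \<open>b\<close>,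
  the increments annihilate \<epsilon>, so they are test elements too and annihilate each
  other.\<close>

declare split_paired_All [simp del] split_paired_Ex [simp del]

section \<open>Locally finite sums\<close>

text \<open>\<open>Sum_any\<close> returns 0 on an infinite support, so \<open>formal_sum\<close> is
  a genuine sum only for such families.\<close>

definition locally_finite :: "('i \<Rightarrow> sfps) \<Rightarrow> bool" where
  "locally_finite F \<longleftrightarrow> (\<forall>m. finite {i. coeff (F i) m \<noteq> 0})"

lemma coeff_formal_sum: "coeff (formal_sum F) m = Sum_any (\<lambda>i. coeff (F i) m)"
  by (simp add: formal_sum_def)

lemma coeff_formal_sum_superset:
  assumes "finite B" and "{i. coeff (F i) m \<noteq> 0} \<subseteq> B"
  shows "coeff (formal_sum F) m = (\<Sum>i\<in>B. coeff (F i) m)"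
  unfolding coeff_formal_sum using assms by (rule Sum_any.expand_superset)

lemma coeff_sum: "coeff (\<Sum>i\<in>B. F i) m = (\<Sum>i\<in>B. coeff (F i) m)"
  by (induction B rule: infinite_finite_induct) auto

lemma locally_finiteD: "locally_finite F \<Longrightarrow> finite {i. coeff (F i) m \<noteq> 0}"
  by (simp add: locally_finite_def)

lemma locally_finite_zero [simp]: "locally_finite (\<lambda>i. 0)"
  by (simp add: locally_finite_def)

lemma locally_finite_finite [simp]: "locally_finite (F :: 'i::finite \<Rightarrow> sfps)"
  by (simp add: locally_finite_def)

lemma formal_sum_finite:
  assumes "finite B" and "\<And>i. i \<notin> B \<Longrightarrow> F i = 0"
  shows "formal_sum F = sum F B"
proof (rule sfps_eqI)
  fix m
  have "{i. coeff (F i) m \<noteq> 0} \<subseteq> B" using assms(2) by force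
  then show "coeff (formal_sum F) m = coeff (sum F B) m"
    by (simp add: coeff_formal_sum_superset[OF assms(1)] coeff_sum)
qed

lemma formal_sum_zero [simp]: "formal_sum (\<lambda>i. 0) = 0"
  by (intro sfps_eqI) (simp add: coeff_formal_sum)

lemma
  assumes "locally_finite F" and "locally_finite G"
  shows locally_finite_add: "locally_finite (\<lambda>i. F i + G i)"
    and formal_sum_add: "formal_sum (\<lambda>i. F i + G i) = formal_sum F + formal_sum G"
proof -
  have sup: "{i. coeff (F i + G i) m \<noteq> 0} \<subseteq> {i. coeff (F i) m \<noteq> 0} \<union> {i. coeff (G i) m \<noteq> 0}" for m
    by auto
  have fin: "finite ({i. coeff (F i) m \<noteq> 0} \<union> {i. coeff (G i) m \<noteq> 0})" for m
    using assms by (simp add: locally_finite_def)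
  show "locally_finite (\<lambda>i. F i + G i)"
    unfolding locally_finite_def using finite_subset[OF sup fin] by blast
  show "formal_sum (\<lambda>i. F i + G i) = formal_sum F + formal_sum G"
  proof (rule sfps_eqI)
    fix m
    let ?B = "{i. coeff (F i) m \<noteq> 0} \<union> {i. coeff (G i) m \<noteq> 0}"
    show "coeff (formal_sum (\<lambda>i. F i + G i)) m = coeff (formal_sum F + formal_sum G) m"
      by (simp add: coeff_formal_sum_superset[OF fin sup] coeff_formal_sum_superset[of ?B F, OF fin]
          coeff_formal_sum_superset[of ?B G, OF fin] sum.distrib del: Collect_disj_eq)
  qed
qed

lemma
  assumes "locally_finite F"
  shows locally_finite_scaleR: "locally_finite (\<lambda>i. r *\<^sub>R F i)"
    and formal_sum_scaleR: "formal_sum (\<lambda>i. r *\<^sub>R F i) = r *\<^sub>R formal_sum F"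
proof -
  have sup: "{i. coeff (r *\<^sub>R F i) m \<noteq> 0} \<subseteq> {i. coeff (F i) m \<noteq> 0}" for m by auto
  show "locally_finite (\<lambda>i. r *\<^sub>R F i)"
    using assms unfolding locally_finite_def by (metis finite_subset sup)
  show "formal_sum (\<lambda>i. r *\<^sub>R F i) = r *\<^sub>R formal_sum F"
    by (rule sfps_eqI)
      (simp add: coeff_formal_sum_superset[OF locally_finiteD[OF assms] sup]
        coeff_formal_sum_superset[OF locally_finiteD[OF assms] order_refl] sum_distrib_left)
qed

lemma formal_sum_diff:
  assumes "locally_finite F" and "locally_finite G"
  shows "formal_sum (\<lambda>i. F i - G i) = formal_sum F - formal_sum G"
proof -
  have "formal_sum (\<lambda>i. F i + (- 1) *\<^sub>R G i) = formal_sum F + (- 1) *\<^sub>R formal_sum G"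
    using assms by (simp add: formal_sum_add locally_finite_scaleR formal_sum_scaleR
        del: scaleR_minus_left scaleR_minus1_left)
  then show ?thesis by simp
qed

lemma
  assumes "finite B" and "\<And>j. j \<in> B \<Longrightarrow> locally_finite (F j)"
  shows locally_finite_sum: "locally_finite (\<lambda>i. \<Sum>j\<in>B. F j i)"
    and formal_sum_sum: "formal_sum (\<lambda>i. \<Sum>j\<in>B. F j i) = (\<Sum>j\<in>B. formal_sum (F j))"
proof -
  have "locally_finite (\<lambda>i. \<Sum>j\<in>B. F j i) \<and>
      formal_sum (\<lambda>i. \<Sum>j\<in>B. F j i) = (\<Sum>j\<in>B. formal_sum (F j))"
    using assms by (induction B rule: finite_induct) (simp_all add: locally_finite_add formal_sum_add)
  then show "locally_finite (\<lambda>i. \<Sum>j\<in>B. F j i)"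
    "formal_sum (\<lambda>i. \<Sum>j\<in>B. F j i) = (\<Sum>j\<in>B. formal_sum (F j))" by blast+
qed

lemma coeff_mult_nonzeroE:
  assumes "coeff (a * b) m \<noteq> 0"
  obtains k l where "mono_join k l = m" "snd k |\<inter>| snd l = {||}" "coeff a k \<noteq> 0" "coeff b l \<noteq> 0"
proof -
  obtain p where "p \<in> {(k, l). mono_join k l = m}"
      and "(case p of (k, l) \<Rightarrow> koszul k l * (coeff a k * coeff b l)) \<noteq> 0"
    using assms unfolding coeff_mult by (meson sum.not_neutral_contains_not_neutral)
  then show thesis using that by (auto simp: koszul_def split: if_splits)
qed

text \<open>Each coefficient of a product involves only finitely many coefficients of the factors.\<close>

lemma
  assumes "locally_finite F" and "locally_finite G"
  shows locally_finite_mult: "locally_finite (\<lambda>(i, j). F i * G j)"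
    and formal_sum_mult: "formal_sum (\<lambda>(i, j). F i * G j) = formal_sum F * formal_sum G"
proof -
  define S where "S m = {(k, l). mono_join k l = m}" for m
  define B where "B m = (\<Union>(k, l)\<in>S m. {i. coeff (F i) k \<noteq> 0})" for m
  define C where "C m = (\<Union>(k, l)\<in>S m. {i. coeff (G i) l \<noteq> 0})" for m
  have fB: "finite (B m)" and fC: "finite (C m)" for m
    using assms by (auto simp: B_def C_def S_def locally_finite_def)
  have sup: "{p. coeff (case p of (i, j) \<Rightarrow> F i * G j) m \<noteq> 0} \<subseteq> B m \<times> C m" for m
    by (force simp: B_def C_def S_def elim!: coeff_mult_nonzeroE)
  show "locally_finite (\<lambda>(i, j). F i * G j)"
    unfolding locally_finite_def using finite_subset[OF sup finite_cartesian_product[OF fB fC]] by blast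
  show "formal_sum (\<lambda>(i, j). F i * G j) = formal_sum F * formal_sum G"
  proof (rule sfps_eqI)
    fix m
    have F: "coeff (formal_sum F) k = (\<Sum>i\<in>B m. coeff (F i) k)"
      and G: "coeff (formal_sum G) l = (\<Sum>j\<in>C m. coeff (G j) l)" if "(k, l) \<in> S m" for k l
      by (rule coeff_formal_sum_superset, use fB fC that in \<open>auto simp: B_def C_def\<close>)+
    have "coeff (formal_sum F * formal_sum G) m =
        (\<Sum>(k, l)\<in>S m. koszul k l * ((\<Sum>i\<in>B m. coeff (F i) k) * (\<Sum>j\<in>C m. coeff (G j) l)))"
      unfolding coeff_mult S_def[symmetric] by (intro sum.cong refl) (auto simp: F G)
    also have "\<dots> = (\<Sum>(k, l)\<in>S m. \<Sum>(i, j)\<in>B m \<times> C m. koszul k l * (coeff (F i) k * coeff (G j) l))"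
      unfolding sum_product unfolding sum.cartesian_product
      by (simp add: sum_distrib_left case_prod_unfold)
    also have "\<dots> = (\<Sum>p\<in>B m \<times> C m. \<Sum>q\<in>S m. koszul (fst q) (snd q) * (coeff (F (fst p)) (fst q) * coeff (G (snd p)) (snd q)))"
      by (subst sum.swap) (simp add: case_prod_unfold)
    also have "\<dots> = (\<Sum>p\<in>B m \<times> C m. coeff (case p of (i, j) \<Rightarrow> F i * G j) m)"
      by (simp add: coeff_mult case_prod_unfold S_def)
    also have "\<dots> = coeff (formal_sum (\<lambda>(i, j). F i * G j)) m"
      by (rule coeff_formal_sum_superset[symmetric]) (use fB fC sup in auto)
    finally show "coeff (formal_sum (\<lambda>(i, j). F i * G j)) m = coeff (formal_sum F * formal_sum G) m" ..
  qed
qed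

lemma locally_finite_reindex: "bij h \<Longrightarrow> locally_finite (\<lambda>i. F (h i)) \<longleftrightarrow> locally_finite F"
  unfolding locally_finite_def
  using finite_vimage_iff[of h "{i. coeff (F i) m \<noteq> 0}" for m] by (simp add: vimage_def)

lemma formal_sum_reindex: "bij h \<Longrightarrow> formal_sum (\<lambda>i. F (h i)) = formal_sum F"
  by (rule sfps_eqI, unfold coeff_formal_sum, rule Sum_any.reindex_cong[symmetric, of h])
    (auto simp: fun_eq_iff)

lemma
  assumes "locally_finite F"
  shows locally_finite_mult_left: "locally_finite (\<lambda>i. a * F i)"
    and formal_sum_mult_left: "formal_sum (\<lambda>i. a * F i) = a * formal_sum F"
    and formal_sum_mult_right: "formal_sum (\<lambda>i. F i * a) = formal_sum F * a"
proof -
  \<comment> \<open>A fixed factor is a family indexed by \<open>unit\<close>, so the product rule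
    applies; the bijections \<open>b\<close> remove the dummy index.\<close>
  have u: "locally_finite (\<lambda>_ :: unit. a)" "formal_sum (\<lambda>_ :: unit. a) = a"
    using formal_sum_finite[of UNIV "\<lambda>_ :: unit. a"] by simp_all
  have "bij (\<lambda>i :: 'a. ((), i))" "bij (\<lambda>i :: 'a. (i, ()))"
    by (auto simp: bij_def inj_def surj_def)
  note b = this[THEN locally_finite_reindex] this[THEN formal_sum_reindex]
  show "locally_finite (\<lambda>i. a * F i)"
    using locally_finite_mult[OF u(1) assms] b(1)[of "\<lambda>(i, j). a * F j"] by simp
  show "formal_sum (\<lambda>i. a * F i) = a * formal_sum F"
    using formal_sum_mult[OF u(1) assms] b(3)[of "\<lambda>(i, j). a * F j"] u by simp
  show "formal_sum (\<lambda>i. F i * a) = formal_sum F * a"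
    using formal_sum_mult[OF assms u(1)] b(4)[of "\<lambda>(i, j). F i * a"] u by simp
qed

text \<open>In each coefficient this is a finite sum arranged by the fibres of \<open>h\<close>.
  \<open>S j\<close> may be smaller than the fibre as long as it contains the nonzero terms; this
  serves multi-indices of a given length, where the fibre is infinite but only indices below
  \<open>n\<close> count.\<close>

lemma formal_sum_group:
  assumes "locally_finite F" and "\<And>j. finite (S j)" and "\<And>i j. i \<in> S j \<Longrightarrow> h i = j"
    and "\<And>i. F i \<noteq> 0 \<Longrightarrow> i \<in> S (h i)"
  shows "formal_sum (\<lambda>j. \<Sum>i\<in>S j. F i) = formal_sum F"
proof -
  have sup: "{j. coeff (\<Sum>i\<in>S j. F i) m \<noteq> 0} \<subseteq> h ` {i. coeff (F i) m \<noteq> 0}" for m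
  proof
    fix j assume "j \<in> {j. coeff (\<Sum>i\<in>S j. F i) m \<noteq> 0}"
    then have "\<not> (\<forall>i\<in>S j. coeff (F i) m = 0)"
      by (metis (mono_tags, lifting) coeff_sum mem_Collect_eq sum.neutral)
    then show "j \<in> h ` {i. coeff (F i) m \<noteq> 0}" using assms(3) by (auto simp: image_iff)
  qed
  show "formal_sum (\<lambda>j. \<Sum>i\<in>S j. F i) = formal_sum F"
  proof (rule sfps_eqI)
    fix m
    let ?A = "{i. coeff (F i) m \<noteq> 0}"
    have fin: "finite ?A" by (rule locally_finiteD[OF assms(1)])
    have mem: "i \<in> S (h i)" if "coeff (F i) m \<noteq> 0" for i
      by (rule assms(4)) (use that in auto)
    have "coeff (formal_sum (\<lambda>j. \<Sum>i\<in>S j. F i)) m = (\<Sum>j\<in>h ` ?A. \<Sum>i\<in>S j. coeff (F i) m)"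
      by (subst coeff_formal_sum_superset[of "h ` ?A"]) (use fin sup in \<open>auto simp: coeff_sum\<close>)
    also have "\<dots> = (\<Sum>j\<in>h ` ?A. \<Sum>i \<in> {i \<in> ?A. h i = j}. coeff (F i) m)"
    proof (rule sum.cong[OF refl])
      fix j
      have "{i \<in> ?A. h i = j} \<subseteq> S j" using mem by auto
      moreover have "\<forall>i\<in>S j - {i \<in> ?A. h i = j}. coeff (F i) m = 0" using assms(3) by auto
      ultimately show "(\<Sum>i\<in>S j. coeff (F i) m) = (\<Sum>i \<in> {i \<in> ?A. h i = j}. coeff (F i) m)"
        by (rule sum.mono_neutral_right[OF assms(2)])
    qed
    also have "\<dots> = (\<Sum>i\<in>?A. coeff (F i) m)"
      by (rule sum.image_gen[OF fin, symmetric])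
    also have "\<dots> = coeff (formal_sum F) m"
      by (rule coeff_formal_sum_superset[symmetric]) (use fin in auto)
    finally show "coeff (formal_sum (\<lambda>j. \<Sum>i\<in>S j. F i)) m = coeff (formal_sum F) m" .
  qed
qed

lemma formal_sum_Fubini:
  assumes "locally_finite F"
  shows "formal_sum F = formal_sum (\<lambda>i. formal_sum (\<lambda>j. F (i, j)))"
proof (rule sfps_eqI)
  fix m
  let ?A = "{p. coeff (F p) m \<noteq> 0}"
  have fin: "finite (fst ` ?A)" "finite (snd ` ?A)"
    using locally_finiteD[OF assms] by blast+
  have sup: "?A \<subseteq> fst ` ?A \<times> snd ` ?A" by force
  have inner: "coeff (formal_sum (\<lambda>j. F (i, j))) m = (\<Sum>j\<in>snd ` ?A. coeff (F (i, j)) m)" for i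
    by (rule coeff_formal_sum_superset[OF fin(2)]) force
  have "coeff (formal_sum F) m = (\<Sum>p\<in>fst ` ?A \<times> snd ` ?A. coeff (F p) m)"
    by (rule coeff_formal_sum_superset[OF _ sup]) (use fin in simp)
  also have "\<dots> = (\<Sum>i\<in>fst ` ?A. \<Sum>j\<in>snd ` ?A. coeff (F (i, j)) m)"
    by (subst sum.cartesian_product) (simp add: case_prod_unfold)
  also have "\<dots> = coeff (formal_sum (\<lambda>i. formal_sum (\<lambda>j. F (i, j)))) m"
  proof (subst coeff_formal_sum_superset[OF fin(1)])
    show "{i. coeff (formal_sum (\<lambda>j. F (i, j))) m \<noteq> 0} \<subseteq> fst ` ?A"
    proof
      fix i assume "i \<in> {i. coeff (formal_sum (\<lambda>j. F (i, j))) m \<noteq> 0}"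
      then have "\<not> (\<forall>j\<in>snd ` ?A. coeff (F (i, j)) m = 0)"
        unfolding mem_Collect_eq inner by (metis (mono_tags, lifting) sum.neutral)
      then show "i \<in> fst ` ?A" by (force simp: image_iff)
    qed
  qed (simp only: inner)
  finally show "coeff (formal_sum F) m = coeff (formal_sum (\<lambda>i. formal_sum (\<lambda>j. F (i, j)))) m" .
qed

section \<open>Filtrations and parity\<close>

text \<open>The degree is a parameter because three are used: one for convergence, one for the
  contraction, and one that traces a single auxiliary parameter.\<close>

definition filt :: "(mono \<Rightarrow> nat) \<Rightarrow> nat \<Rightarrow> sfps set" where
  "filt w N = {a. \<forall>m. w m < N \<longrightarrow> coeff a m = 0}"

text \<open>Additivity is asked only for disjoint odd parts: otherwise the product of the monomials
  is zero, and their join loses the repeated odd generators.\<close>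

definition weight :: "(mono \<Rightarrow> nat) \<Rightarrow> bool" where
  "weight w \<longleftrightarrow> (\<forall>k l. snd k |\<inter>| snd l = {||} \<longrightarrow> w (mono_join k l) = w k + w l)"

lemma filt_0 [simp]: "a \<in> filt w 0" "0 \<in> filt w N"
  by (simp_all add: filt_def)

lemma filt_mono: "a \<in> filt w N \<Longrightarrow> M \<le> N \<Longrightarrow> a \<in> filt w M"
  by (auto simp: filt_def)

lemma filt_add: "a \<in> filt w N \<Longrightarrow> b \<in> filt w N \<Longrightarrow> a + b \<in> filt w N"
  and filt_diff: "a \<in> filt w N \<Longrightarrow> b \<in> filt w N \<Longrightarrow> a - b \<in> filt w N"
  and filt_uminus: "a \<in> filt w N \<Longrightarrow> - a \<in> filt w N"
  and filt_scaleR: "a \<in> filt w N \<Longrightarrow> r *\<^sub>R a \<in> filt w N"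
  by (auto simp: filt_def)

lemma filt_sum: "(\<And>i. i \<in> B \<Longrightarrow> F i \<in> filt w N) \<Longrightarrow> sum F B \<in> filt w N"
  by (auto simp: filt_def coeff_sum)

lemma filt_formal_sum: "(\<And>i. F i \<in> filt w N) \<Longrightarrow> formal_sum F \<in> filt w N"
  by (auto simp: filt_def coeff_formal_sum)

lemma filt_mult:
  assumes "weight w" and "a \<in> filt w M" and "b \<in> filt w N"
  shows "a * b \<in> filt w (M + N)"
  unfolding filt_def mem_Collect_eq
proof (intro allI impI)
  fix m assume *: "w m < M + N"
  show "coeff (a * b) m = 0"
  proof (rule ccontr)
    assume "coeff (a * b) m \<noteq> 0"
    then obtain k l where kl: "mono_join k l = m" "snd k |\<inter>| snd l = {||}" "coeff a k \<noteq> 0" "coeff b l \<noteq> 0"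
      by (rule coeff_mult_nonzeroE)
    then have "w m = w k + w l" "M \<le> w k" "N \<le> w l"
      using assms unfolding weight_def filt_def by (blast, force, force)
    with * show False by simp
  qed
qed

lemma filt_mult_left: "weight w \<Longrightarrow> b \<in> filt w N \<Longrightarrow> a * b \<in> filt w N"
  and filt_mult_right: "weight w \<Longrightarrow> b \<in> filt w N \<Longrightarrow> b * a \<in> filt w N"
  using filt_mult[of w a 0 b N] filt_mult[of w b N a 0] by simp_all

text \<open>The coefficient of \<open>m\<close> sees only the terms with index at most
  \<open>w m\<close>.\<close>

lemma locally_finite_filt:
  assumes "\<And>r :: nat. F r \<in> filt w r"
  shows "locally_finite F"
  unfolding locally_finite_def
proof
  fix m
  have "{r. coeff (F r) m \<noteq> 0} \<subseteq> {..w m}"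
    using assms by (force simp: filt_def not_less[symmetric])
  then show "finite {r. coeff (F r) m \<noteq> 0}" by (rule finite_subset) simp
qed

definition total_degree :: "mono \<Rightarrow> nat" where
  "total_degree m = size (fst m) + fcard (snd m)"

text \<open>Coordinate and momentum generators have degree 0: what counts as small is the order in
  \<open>g\<close> together with the order in the auxiliary parameters.\<close>

definition formal_degree :: "mono \<Rightarrow> nat" where
  "formal_degree m = count (fst m) Scale + card (fset (snd m) \<inter> range Param)"

text \<open>An indicator with values 0 and 1; as a weight it shows that a substitution fixing
  \<open>Param k\<close> cannot remove it from a monomial.\<close>

definition param_degree :: "nat \<Rightarrow> mono \<Rightarrow> nat" where
  "param_degree k m = of_bool (Param k |\<in>| snd m)"

lemma formal_degree_nonzero:
  assumes "formal_degree m \<noteq> 0"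
  shows "Scale \<in># fst m \<or> (\<exists>k. Param k |\<in>| snd m)"
proof (rule ccontr)
  assume *: "\<not> (Scale \<in># fst m \<or> (\<exists>k. Param k |\<in>| snd m))"
  then have "fset (snd m) \<inter> range Param = {}" by auto
  then show False using * assms by (simp add: formal_degree_def not_in_iff)
qed

lemma weight_total_degree [simp]: "weight total_degree"
  by (auto simp: weight_def total_degree_def mono_join_def fcard_funion_disjoint)

lemma weight_formal_degree [simp]: "weight formal_degree"
proof -
  have "card (fset (J |\<union>| K) \<inter> range Param) = card (fset J \<inter> range Param) + card (fset K \<inter> range Param)"
    if "J |\<inter>| K = {||}" for J K
  proof -
    have "fset (J |\<union>| K) \<inter> range Param = (fset J \<inter> range Param) \<union> (fset K \<inter> range Param)" by auto
    moreover have "(fset J \<inter> range Param) \<inter> (fset K \<inter> range Param) = {}" using that by auto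
    ultimately show ?thesis by (simp add: card_Un_disjoint)
  qed
  then show ?thesis by (auto simp: weight_def formal_degree_def mono_join_def)
qed

lemma weight_param_degree [simp]: "weight (param_degree k)"
  by (auto simp: weight_def param_degree_def mono_join_def)

lemma formal_degree_le_total_degree: "formal_degree m \<le> total_degree m"
  unfolding formal_degree_def total_degree_def fcard.rep_eq
  by (intro add_mono card_mono count_le_size) auto

lemma filt_formal_degree_total_degree: "a \<in> filt formal_degree N \<Longrightarrow> a \<in> filt total_degree N"
  using le_less_trans[OF formal_degree_le_total_degree] by (simp add: filt_def)

lemma filt_formal_degree_Inter: "(\<And>N. a \<in> filt formal_degree N) \<Longrightarrow> a = 0"
  by (rule sfps_eqI) (auto simp: filt_def)

lemma const_term_eq_0_iff: "const_term a = 0 \<longleftrightarrow> a \<in> filt total_degree 1"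
proof -
  have "total_degree m = 0 \<longleftrightarrow> m = ({#}, {||})" for m
    by (cases m) (auto simp: total_degree_def fcard.rep_eq)
  then show ?thesis by (auto simp: filt_def const_term_def)
qed

section \<open>Parity and supercommutativity\<close>

lemma has_parity_iff: "has_parity s a \<longleftrightarrow> (\<forall>m. odd (fcard (snd m)) \<noteq> s \<longrightarrow> coeff a m = 0)"
  unfolding has_parity_def by (metis prod.collapse snd_conv)

lemma has_parity_0 [simp]: "has_parity s 0"
  and has_parity_add: "has_parity s a \<Longrightarrow> has_parity s b \<Longrightarrow> has_parity s (a + b)"
  and has_parity_diff: "has_parity s a \<Longrightarrow> has_parity s b \<Longrightarrow> has_parity s (a - b)"
  and has_parity_uminus: "has_parity s a \<Longrightarrow> has_parity s (- a)"
  and has_parity_scaleR: "has_parity s a \<Longrightarrow> has_parity s (r *\<^sub>R a)"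
  and has_parity_1 [simp]: "has_parity False 1"
  by (auto simp: has_parity_iff fcard.rep_eq)

lemma has_parity_sum: "(\<And>i. i \<in> B \<Longrightarrow> has_parity s (F i)) \<Longrightarrow> has_parity s (sum F B)"
  by (induction B rule: infinite_finite_induct) (auto intro: has_parity_add)

lemma has_parity_formal_sum: "(\<And>i. has_parity s (F i)) \<Longrightarrow> has_parity s (formal_sum F)"
  unfolding has_parity_def coeff_formal_sum by (metis (no_types, lifting) Sum_any.not_neutral_obtains_not_neutral)

lemma has_parity_mult:
  assumes "has_parity s a" and "has_parity t b"
  shows "has_parity (s \<noteq> t) (a * b)"
  unfolding has_parity_def
proof (intro allI impI)
  fix A J assume "coeff (a * b) (A, J) \<noteq> 0"
  then obtain k l where kl: "mono_join k l = (A, J)" "snd k |\<inter>| snd l = {||}" "coeff a k \<noteq> 0" "coeff b l \<noteq> 0"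
    by (rule coeff_mult_nonzeroE)
  then have "J = snd k |\<union>| snd l" by (simp add: mono_join_def)
  then have "fcard J = fcard (snd k) + fcard (snd l)"
    using kl(2) by (simp add: fcard_funion_disjoint)
  moreover have "odd (fcard (snd k)) = s" "odd (fcard (snd l)) = t"
    using assms kl by (metis has_parity_def prod.collapse)+
  ultimately show "odd (fcard J) = (s \<noteq> t)" by auto
qed

text \<open>For disjoint odd parts every pair of odd generators, one from each factor, is an
  inversion in exactly one of the two orders, so the two inversion numbers add up to the product of
  the cardinalities.\<close>

lemma koszul_commute:
  "koszul m n = (- 1) ^ (fcard (snd m) * fcard (snd n)) * koszul n m"
proof (cases "snd m |\<inter>| snd n = {||}")
  case True
  let ?J = "snd m" and ?K = "snd n"
  have "inversions ?K ?J = prod.swap ` {(j, k). j |\<in>| ?J \<and> k |\<in>| ?K \<and> j < k}"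
    by (force simp: inversions_def)
  then have "card (inversions ?K ?J) = card {(j, k). j |\<in>| ?J \<and> k |\<in>| ?K \<and> j < k}"
    by (simp add: card_image)
  moreover have "card (inversions ?J ?K) + card {(j, k). j |\<in>| ?J \<and> k |\<in>| ?K \<and> j < k} = card (fset ?J \<times> fset ?K)"
  proof (subst card_Un_disjoint[symmetric])
    show "finite {(j, k). j |\<in>| ?J \<and> k |\<in>| ?K \<and> j < k}"
      by (rule finite_subset[of _ "fset ?J \<times> fset ?K"]) auto
    have "inversions ?J ?K \<union> {(j, k). j |\<in>| ?J \<and> k |\<in>| ?K \<and> j < k} = fset ?J \<times> fset ?K"
    proof -
      have "j \<noteq> k" if "j |\<in>| ?J" "k |\<in>| ?K" for j k using True that by auto
      then show ?thesis by (auto simp: inversions_def neq_iff)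
    qed
    then show "card (inversions ?J ?K \<union> {(j, k). j |\<in>| ?J \<and> k |\<in>| ?K \<and> j < k}) = card (fset ?J \<times> fset ?K)"
      by simp
  qed (simp, auto simp: inversions_def)
  ultimately have e: "card (inversions ?J ?K) + card (inversions ?K ?J) = fcard ?J * fcard ?K"
    by (simp add: card_cartesian_product fcard.rep_eq)
  have "(- 1 :: real) ^ card (inversions ?J ?K) = (- 1) ^ (fcard ?J * fcard ?K) * (- 1) ^ card (inversions ?K ?J)"
    unfolding e[symmetric] by (simp add: power_add)
  then show ?thesis using True by (simp add: koszul_def inf_commute)
qed (simp add: koszul_def inf_commute)

lemma supercommute:
  assumes "has_parity s a" and "has_parity t b"
  shows "a * b = (if s \<and> t then - (b * a) else b * a)"
proof (rule sfps_eqI)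
  fix m
  have "coeff (a * b) m = (\<Sum>(l, k) \<in> {(l, k). mono_join l k = m}. koszul k l * (coeff a k * coeff b l))"
    unfolding coeff_mult
    by (rule sum.reindex_bij_witness[of _ prod.swap prod.swap]) (auto simp: mono_join_commute)
  also have "\<dots> = (\<Sum>(l, k) \<in> {(l, k). mono_join l k = m}.
      (if s \<and> t then - 1 else 1) * (koszul l k * (coeff b l * coeff a k)))"
  proof (intro sum.cong refl, clarify)
    fix l1 l2 k1 k2
    show "koszul (k1, k2) (l1, l2) * (coeff a (k1, k2) * coeff b (l1, l2)) =
        (if s \<and> t then - 1 else 1) * (koszul (l1, l2) (k1, k2) * (coeff b (l1, l2) * coeff a (k1, k2)))"
    proof (cases "coeff a (k1, k2) = 0 \<or> coeff b (l1, l2) = 0")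
      case False
      then have "odd (fcard k2) = s" "odd (fcard l2) = t"
        using assms by (auto simp: has_parity_def)
      then show ?thesis by (subst koszul_commute) auto
    qed auto
  qed
  also have "\<dots> = coeff (if s \<and> t then - (b * a) else b * a) m"
    by (simp add: coeff_mult sum_distrib_left[symmetric] case_prod_unfold)
  finally show "coeff (a * b) m = coeff (if s \<and> t then - (b * a) else b * a) m" .
qed

lemma even_commute: "has_parity False a \<Longrightarrow> has_parity t b \<Longrightarrow> a * b = b * a"
  using supercommute[of False a t b] by simp

lemma odd_anticommute: "has_parity True a \<Longrightarrow> has_parity True b \<Longrightarrow> a * b = - (b * a)"
  using supercommute[of True a True b] by simp

lemma odd_square:
  assumes "has_parity True a"
  shows "a * a = 0"
proof (rule sfps_eqI)
  fix m
  have "coeff (a * a) m = coeff (- (a * a)) m"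
    using odd_anticommute[OF assms assms] by metis
  then show "coeff (a * a) m = coeff 0 m" by simp
qed

text \<open>Sign rules apply to homogeneous elements only; splitting by parity extends their
  consequences to arbitrary factors.\<close>

definition parity_part :: "bool \<Rightarrow> sfps \<Rightarrow> sfps" where
  "parity_part s a = Sfps (\<lambda>m. if odd (fcard (snd m)) = s then coeff a m else 0)"

lemma has_parity_parity_part [simp]: "has_parity s (parity_part s a)"
  by (simp add: has_parity_def parity_part_def)

lemma parity_parts: "parity_part False a + parity_part True a = a"
  by (rule sfps_eqI) (simp add: parity_part_def)

lemma filt_parity_part: "a \<in> filt w N \<Longrightarrow> parity_part s a \<in> filt w N"
  by (simp add: filt_def parity_part_def)

lemma even_central:
  assumes "has_parity False a"
  shows "a * b = b * a"
proof -
  have "a * (parity_part False b + parity_part True b) = (parity_part False b + parity_part True b) * a"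
    by (simp add: algebra_simps even_commute[OF assms has_parity_parity_part])
  then show ?thesis by (simp add: parity_parts)
qed

section \<open>Substitution of generators\<close>

definition even_prod :: "(evar \<Rightarrow> sfps) \<Rightarrow> evar multiset \<Rightarrow> sfps" where
  "even_prod e A = prod_list (map e (sorted_list_of_multiset A))"

definition odd_prod :: "(ovar \<Rightarrow> sfps) \<Rightarrow> ovar fset \<Rightarrow> sfps" where
  "odd_prod d J = prod_list (map d (sorted_list_of_fset J))"

text \<open>This is \<open>mono_subst\<close> with the values of the generators left abstract, so
  that the algebra of substitutions needs no case distinction between coordinates, momenta and
  parameters.\<close>

definition gen_subst :: "(evar \<Rightarrow> sfps) \<Rightarrow> (ovar \<Rightarrow> sfps) \<Rightarrow> mono \<Rightarrow> sfps" where
  "gen_subst e d m = even_prod e (fst m) * odd_prod d (snd m)"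

lemma mono_subst_eq: "mono_subst y q = gen_subst (even_subst q) (odd_subst y q)"
  by (rule ext) (simp add: mono_subst_def gen_subst_def even_prod_def odd_prod_def)

lemma set_sorted_list_of_fset [simp]: "set (sorted_list_of_fset J) = fset J"
  by (simp add: sorted_list_of_fset.rep_eq)

lemma length_sorted_list_of_fset [simp]: "length (sorted_list_of_fset J) = fcard J"
  by (simp add: sorted_list_of_fset.rep_eq fcard.rep_eq)

lemma length_sorted_list_of_multiset [simp]: "length (sorted_list_of_multiset A) = size A"
  by (metis mset_sorted_list_of_multiset size_mset)

text \<open>Inserting a new minimum matches the order in which \<open>odd_prod\<close> multiplies:
  the new factor appears on the left, without a sign.\<close>

lemma fset_min_induct [case_names empty insert]:
  fixes J :: "'a::linorder fset"
  assumes "P {||}" and "\<And>v J. (\<And>w. w |\<in>| J \<Longrightarrow> v < w) \<Longrightarrow> P J \<Longrightarrow> P (finsert v J)"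
  shows "P J"
proof -
  have "\<forall>J. fset J = A \<longrightarrow> P J" if "finite A" for A :: "'a set"
    using that
  proof (induction A rule: finite_linorder_min_induct)
    case empty
    then show ?case using assms(1) by (metis bot_fset.rep_eq fset_inject)
  next
    case (insert b A)
    show ?case
    proof (intro allI impI)
      fix J assume J: "fset J = insert b A"
      have "b \<notin> A" using insert.hyps(2) by auto
      then have "fset (J |-| {|b|}) = A" using J by simp
      then have "P (J |-| {|b|})" and "w |\<in>| J |-| {|b|} \<Longrightarrow> b < w" for w
        using insert.IH insert.hyps(2) by (blast, metis)
      then have "P (finsert b (J |-| {|b|}))" by (intro assms(2))
      moreover have "finsert b (J |-| {|b|}) = J" using J by (auto simp: fset_eq_iff)
      ultimately show "P J" by simp
    qed
  qed
  from this[of "fset J"] show ?thesis by simp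
qed

lemma odd_prod_empty [simp]: "odd_prod d {||} = 1"
  by (simp add: odd_prod_def sorted_list_of_fset.rep_eq)

lemma sorted_list_of_fset_finsert_min:
  assumes "\<And>w. w |\<in>| J \<Longrightarrow> v < w"
  shows "sorted_list_of_fset (finsert v J) = v # sorted_list_of_fset J"
proof -
  have "v |\<notin>| J" using assms by blast
  then show ?thesis
    using assms by (simp add: sorted_list_of_fset.rep_eq insort_is_Cons order.strict_implies_order)
qed

lemma odd_prod_finsert_min:
  "(\<And>w. w |\<in>| J \<Longrightarrow> v < w) \<Longrightarrow> odd_prod d (finsert v J) = d v * odd_prod d J"
  by (simp add: odd_prod_def sorted_list_of_fset_finsert_min)

lemma even_prod_empty [simp]: "even_prod e {#} = 1"
  by (simp add: even_prod_def)

lemma prod_list_filt: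
  assumes "weight w" and "\<And>x. x \<in> set xs \<Longrightarrow> f x \<in> filt w 1"
  shows "prod_list (map f xs) \<in> filt w (length xs)"
  using assms(2)
proof (induction xs)
  case (Cons x xs)
  have "f x * prod_list (map f xs) \<in> filt w (1 + length xs)"
    using Cons by (intro filt_mult[OF assms(1)]) auto
  then show ?case by simp
qed simp

lemma prod_list_filt_1:
  assumes "weight w" and "x \<in> set xs" and "f x \<in> filt w 1"
  shows "prod_list (map f xs) \<in> filt w 1"
  using assms(2)
proof (induction xs)
  case (Cons y xs)
  then show ?case
    using filt_mult_left[OF assms(1)] filt_mult_right[OF assms(1)] assms(3) by auto
qed simp

lemma gen_subst_filt_even:
  "weight w \<Longrightarrow> v \<in># fst m \<Longrightarrow> e v \<in> filt w 1 \<Longrightarrow> gen_subst e d m \<in> filt w 1"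
  unfolding gen_subst_def even_prod_def by (intro filt_mult_right prod_list_filt_1[of _ v]) auto

lemma gen_subst_filt_odd:
  "weight w \<Longrightarrow> v |\<in>| snd m \<Longrightarrow> d v \<in> filt w 1 \<Longrightarrow> gen_subst e d m \<in> filt w 1"
  unfolding gen_subst_def odd_prod_def by (intro filt_mult_left prod_list_filt_1[of _ v]) auto

lemma gen_subst_cong:
  assumes "\<And>v. v \<in># fst m \<Longrightarrow> e v = e' v" and "\<And>w. w |\<in>| snd m \<Longrightarrow> d w = d' w"
  shows "gen_subst e d m = gen_subst e' d' m"
  unfolding gen_subst_def even_prod_def odd_prod_def using assms
  by (intro arg_cong2[where f = "(*)"] arg_cong[where f = prod_list] map_cong) auto

text \<open>
  Without assumptions on the parity, a substitution still acts on monomials; admissibility is what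
  makes its extension to series with finitely many generators and parameters locally finite.
\<close>

definition admissible :: "(evar \<Rightarrow> sfps) \<Rightarrow> (ovar \<Rightarrow> sfps) \<Rightarrow> bool" where
  "admissible e d \<longleftrightarrow> (\<forall>v. e v \<in> filt total_degree 1) \<and> (\<forall>w. d w \<in> filt total_degree 1) \<and>
     (\<forall>k. d (Param k) = odd_gen (Param k))"

text \<open>Parameters may be infinite in number because substitutions fix them; with infinitely
  many other generators, infinitely many monomials could contribute to one coefficient of the
  result.\<close>

definition tame :: "sfps \<Rightarrow> bool" where
  "tame a \<longleftrightarrow> (\<exists>V W. finite V \<and> finite W \<and> involves_only V (W \<union> range Param) a)"

definition gen_hom :: "(evar \<Rightarrow> sfps) \<Rightarrow> (ovar \<Rightarrow> sfps) \<Rightarrow> sfps \<Rightarrow> sfps" where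
  "gen_hom e d a = formal_sum (\<lambda>m. coeff a m *\<^sub>R gen_subst e d m)"

lemma odd_gen_param_filt: "odd_gen (Param k) \<in> filt (param_degree k) 1"
  by (auto simp: filt_def odd_gen_def param_degree_def split: if_splits)

text \<open>Every factor substituted has positive total degree, and a parameter is replaced by
  itself, so it remains visible in the result.\<close>

lemma gen_subst_support:
  assumes "admissible e d" and "coeff (gen_subst e d m) n \<noteq> 0"
  shows "total_degree m \<le> total_degree n" and "Param k |\<in>| snd m \<Longrightarrow> Param k |\<in>| snd n"
proof -
  have "gen_subst e d m \<in> filt total_degree (total_degree m)"
    using filt_mult[OF weight_total_degree prod_list_filt[OF weight_total_degree] prod_list_filt[OF weight_total_degree],
        of "sorted_list_of_multiset (fst m)" e "sorted_list_of_fset (snd m)" d] assms(1)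
    by (simp add: admissible_def gen_subst_def even_prod_def odd_prod_def total_degree_def)
  then show "total_degree m \<le> total_degree n" using assms(2) by (auto simp: filt_def not_less[symmetric])
  assume "Param k |\<in>| snd m"
  then have "gen_subst e d m \<in> filt (param_degree k) 1"
    by (intro gen_subst_filt_odd) (use assms(1) odd_gen_param_filt in \<open>auto simp: admissible_def\<close>)
  then show "Param k |\<in>| snd n"
    using assms(2) by (auto simp: filt_def param_degree_def)
qed

lemma finite_multisets_bounded:
  assumes "finite V"
  shows "finite {A. set_mset A \<subseteq> V \<and> size A \<le> n}"
proof (rule finite_subset)
  show "{A. set_mset A \<subseteq> V \<and> size A \<le> n} \<subseteq> mset ` {xs. set xs \<subseteq> V \<and> length xs \<le> n}"
    by (smt (verit, best) ex_mset imageI mem_Collect_eq set_mset_mset size_mset subsetI)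
qed (simp add: finite_lists_length_le assms)

lemma finite_fsubsets:
  assumes "finite X"
  shows "finite {J. fset J \<subseteq> X}"
proof -
  have "finite (fset -` Pow X)"
    using assms by (intro finite_vimageI) (auto simp: inj_on_def fset_inject)
  then show ?thesis by (simp add: vimage_def Pow_def)
qed

text \<open>The total degree of \<open>n\<close> bounds the even part of \<open>m\<close>, whose
  generators come from a finite set; the odd part consists of finitely many possible generators and
  of parameters that already occur in \<open>n\<close>.\<close>

lemma finite_gen_subst_support:
  assumes "admissible e d" and "tame a"
  shows "finite {m. coeff a m \<noteq> 0 \<and> coeff (gen_subst e d m) n \<noteq> 0}"
proof -
  obtain V W where fin: "finite V" "finite W" and inv: "involves_only V (W \<union> range Param) a"
    using assms(2) by (auto simp: tame_def)
  let ?S = "{A. set_mset A \<subseteq> V \<and> size A \<le> total_degree n} \<times> {J. fset J \<subseteq> W \<union> fset (snd n)}"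
  have "{m. coeff a m \<noteq> 0 \<and> coeff (gen_subst e d m) n \<noteq> 0} \<subseteq> ?S"
  proof
    fix m assume m: "m \<in> {m. coeff a m \<noteq> 0 \<and> coeff (gen_subst e d m) n \<noteq> 0}"
    obtain A J where m_eq: "m = (A, J)" by (rule prod.exhaust)
    from m have *: "coeff a (A, J) \<noteq> 0" "coeff (gen_subst e d (A, J)) n \<noteq> 0"
      by (simp_all add: m_eq)
    have "set_mset A \<subseteq> V" "fset J \<subseteq> W \<union> range Param"
      using inv *(1) by (auto simp: involves_only_def)
    moreover have "size A \<le> total_degree n"
      using gen_subst_support(1)[OF assms(1) *(2)] by (simp add: total_degree_def)
    moreover have "Param k |\<in>| snd n" if "Param k |\<in>| J" for k
      using gen_subst_support(2)[OF assms(1) *(2)] that by simp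
    ultimately show "m \<in> ?S"
      unfolding m_eq by blast
  qed
  then show ?thesis
    by (rule finite_subset) (use fin in \<open>simp add: finite_multisets_bounded finite_fsubsets\<close>)
qed

lemma locally_finite_gen_hom:
  "admissible e d \<Longrightarrow> tame a \<Longrightarrow> locally_finite (\<lambda>m. coeff a m *\<^sub>R gen_subst e d m)"
  using finite_gen_subst_support by (simp add: locally_finite_def)

lemma involves_only_mono:
  "involves_only V W a \<Longrightarrow> V \<subseteq> V' \<Longrightarrow> W \<subseteq> W' \<Longrightarrow> involves_only V' W' a"
  unfolding involves_only_def by blast

lemma involves_only_add: "involves_only V W a \<Longrightarrow> involves_only V W b \<Longrightarrow> involves_only V W (a + b)"
  and involves_only_scaleR: "involves_only V W a \<Longrightarrow> involves_only V W (r *\<^sub>R a)"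
  unfolding involves_only_def by (auto, metis add_0 subsetD, metis add_0 subsetD)

lemma involves_only_mult:
  assumes "involves_only V W a" and "involves_only V W b"
  shows "involves_only V W (a * b)"
  unfolding involves_only_def
proof (intro allI impI)
  fix A J assume "coeff (a * b) (A, J) \<noteq> 0"
  then obtain k l where "mono_join k l = (A, J)" "coeff a k \<noteq> 0" "coeff b l \<noteq> 0"
    by (rule coeff_mult_nonzeroE)
  moreover then have "set_mset (fst k) \<subseteq> V" "fset (snd k) \<subseteq> W" "set_mset (fst l) \<subseteq> V" "fset (snd l) \<subseteq> W"
    using assms by (metis involves_only_def prod.collapse)+
  ultimately show "set_mset A \<subseteq> V \<and> fset J \<subseteq> W" by (auto simp: mono_join_def)
qed

lemma tame_mult:
  assumes "tame a" and "tame b"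
  shows "tame (a * b)"
proof -
  obtain V W V' W' where fin: "finite V" "finite W" "finite V'" "finite W'"
    and inv: "involves_only V (W \<union> range Param) a" "involves_only V' (W' \<union> range Param) b"
    using assms by (auto simp: tame_def)
  have "involves_only (V \<union> V') ((W \<union> W') \<union> range Param) a" "involves_only (V \<union> V') ((W \<union> W') \<union> range Param) b"
    by (rule inv[THEN involves_only_mono]; auto)+
  then have "involves_only (V \<union> V') ((W \<union> W') \<union> range Param) (a * b)"
    by (rule involves_only_mult)
  then show "tame (a * b)" using fin unfolding tame_def by blast
qed

lemma tame_scaleR: "tame a \<Longrightarrow> tame (r *\<^sub>R a)"
  unfolding tame_def using involves_only_scaleR by blast

lemma tame_params: "involves_only {} (range Param) a \<Longrightarrow> tame a"
  unfolding tame_def by (rule exI[of _ "{}"])+ simp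

lemma gen_hom_add:
  assumes "admissible e d" "tame a" "tame b"
  shows "gen_hom e d (a + b) = gen_hom e d a + gen_hom e d b"
  unfolding gen_hom_def
  by (simp add: scaleR_add_left formal_sum_add locally_finite_gen_hom assms)

lemma gen_hom_scaleR:
  assumes "admissible e d" "tame a"
  shows "gen_hom e d (r *\<^sub>R a) = r *\<^sub>R gen_hom e d a"
  unfolding gen_hom_def
  using formal_sum_scaleR[OF locally_finite_gen_hom[OF assms], of r] by simp

lemma gen_hom_0 [simp]: "gen_hom e d 0 = 0"
  by (simp add: gen_hom_def)

lemma gen_hom_cong:
  assumes "involves_only V W a" and "\<And>v. v \<in> V \<Longrightarrow> e v = e' v" and "\<And>w. w \<in> W \<Longrightarrow> d w = d' w"
  shows "gen_hom e d a = gen_hom e' d' a"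
  unfolding gen_hom_def
proof (intro arg_cong[where f = formal_sum] ext)
  fix m
  show "coeff a m *\<^sub>R gen_subst e d m = coeff a m *\<^sub>R gen_subst e' d' m"
  proof (cases "coeff a m = 0")
    case False
    then have "set_mset (fst m) \<subseteq> V" "fset (snd m) \<subseteq> W"
      using assms(1) by (metis involves_only_def prod.collapse)+
    then have "gen_subst e d m = gen_subst e' d' m"
      using assms(2,3) by (intro gen_subst_cong) auto
    then show ?thesis by simp
  qed simp
qed

section \<open>Parity-preserving substitutions as algebra homomorphisms\<close>

definition parity_subst :: "(evar \<Rightarrow> sfps) \<Rightarrow> (ovar \<Rightarrow> sfps) \<Rightarrow> bool" where
  "parity_subst e d \<longleftrightarrow> (\<forall>v. has_parity False (e v)) \<and> (\<forall>w. has_parity True (d w))"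

lemma parity_substD:
  "parity_subst e d \<Longrightarrow> has_parity False (e v)" "parity_subst e d \<Longrightarrow> has_parity True (d w)"
  by (simp_all add: parity_subst_def)

lemma prod_list_parity:
  assumes "\<And>x. has_parity s (f x)"
  shows "has_parity (s \<and> odd (length xs)) (prod_list (map f xs))"
proof (induction xs)
  case (Cons x xs)
  have "has_parity (s \<noteq> (s \<and> odd (length xs))) (f x * prod_list (map f xs))"
    by (rule has_parity_mult[OF assms Cons.IH])
  moreover have "(s \<noteq> (s \<and> odd (length xs))) = (s \<and> odd (length (x # xs)))" by auto
  ultimately show ?case by simp
qed simp

lemma even_prod_parity: "parity_subst e d \<Longrightarrow> has_parity False (even_prod e A)"
  using prod_list_parity[of False e] by (simp add: parity_subst_def even_prod_def)

lemma odd_prod_parity: "parity_subst e d \<Longrightarrow> has_parity (odd (fcard J)) (odd_prod d J)"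
  using prod_list_parity[of True d "sorted_list_of_fset J"] by (simp add: parity_subst_def odd_prod_def)

lemma gen_subst_parity:
  assumes "parity_subst e d"
  shows "has_parity (odd (fcard (snd m))) (gen_subst e d m)"
  using has_parity_mult[OF even_prod_parity[OF assms, of "fst m"] odd_prod_parity[OF assms, of "snd m"]]
  by (simp add: gen_subst_def)

lemma gen_hom_parity:
  assumes "parity_subst e d" and "has_parity s a"
  shows "has_parity s (gen_hom e d a)"
  unfolding gen_hom_def
proof (rule has_parity_formal_sum)
  fix m
  show "has_parity s (coeff a m *\<^sub>R gen_subst e d m)"
    using gen_subst_parity[OF assms(1), of m] assms(2)
    by (cases "odd (fcard (snd m)) = s") (auto simp: has_parity_iff[of s a] intro!: has_parity_scaleR)
qed

lemma even_prod_add_mset: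
  assumes "parity_subst e d"
  shows "even_prod e (add_mset v A) = e v * even_prod e A"
proof -
  have "prod_list (map e (insort v xs)) = e v * prod_list (map e xs)" for xs
  proof (induction xs)
    case (Cons x xs)
    have "e x * e v = e v * e x" by (intro even_central parity_substD(1)[OF assms])
    then have "e x * (e v * c) = e v * (e x * c)" for c by (metis mult.assoc)
    then show ?case using Cons by simp
  qed simp
  then show ?thesis by (simp add: even_prod_def)
qed

lemma even_prod_union:
  assumes "parity_subst e d"
  shows "even_prod e (A + B) = even_prod e A * even_prod e B"
  by (induction A) (simp_all add: even_prod_add_mset[OF assms] mult.assoc)

lemma koszul_empty [simp]: "koszul (A, {||}) m = 1"
  by (simp add: koszul_def inversions_def)

text \<open>Moving \<open>d v\<close> to its place in the ordered product passes exactly the factors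
  with smaller index, each at the cost of a sign.\<close>

lemma odd_prod_finsert:
  assumes "parity_subst e d" and "v |\<notin>| J"
  shows "d v * odd_prod d J = (- 1) ^ card {w. w |\<in>| J \<and> w < v} *\<^sub>R odd_prod d (finsert v J)"
  using assms(2)
proof (induction J rule: fset_min_induct)
  case empty
  then show ?case using odd_prod_finsert_min[of "{||}" v d] by simp
next
  case (insert u J)
  then have uv: "u \<noteq> v" "v |\<notin>| J" "u |\<notin>| J" by auto
  show ?case
  proof (cases "v < u")
    case True
    then have min: "v < w" if "w |\<in>| finsert u J" for w
      using that insert.hyps by (auto intro: order.strict_trans)
    then have "{w. w |\<in>| finsert u J \<and> w < v} = {}" by (auto dest: order.asym)
    then have "card {w. w |\<in>| finsert u J \<and> w < v} = 0" by (simp only: card.empty)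
    then show ?thesis using odd_prod_finsert_min[OF min] by (simp only:) simp
  next
    case False
    then have uv': "u < v" using uv by auto
    have "{w. w |\<in>| finsert u J \<and> w < v} = insert u {w. w |\<in>| J \<and> w < v}" using uv' by auto
    moreover have "finite {w. w |\<in>| J \<and> w < v}" by (rule finite_subset[of _ "fset J"]) auto
    ultimately have card: "card {w. w |\<in>| finsert u J \<and> w < v} = Suc (card {w. w |\<in>| J \<and> w < v})"
      using uv by simp
    have "odd_prod d (finsert u (finsert v J)) = d u * odd_prod d (finsert v J)"
      using insert.hyps uv' by (intro odd_prod_finsert_min) auto
    moreover have "odd_prod d (finsert u J) = d u * odd_prod d J"
      using insert.hyps by (intro odd_prod_finsert_min) auto
    moreover have "d v * (d u * c) = - (d u * (d v * c))" for c
    proof -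
      have "d v * d u = - (d u * d v)" by (intro odd_anticommute parity_substD(2)[OF assms(1)])
      then show ?thesis by (simp add: mult.assoc[symmetric])
    qed
    ultimately show ?thesis
      using insert.IH uv unfolding card by (simp add: finsert_commute[of v u])
  qed
qed

text \<open>Up to sign the factor \<open>d v\<close> of the product can be brought to the front,
  where it meets the other copy, and odd elements have square zero.\<close>

lemma odd_prod_mem:
  assumes "parity_subst e d" and "v |\<in>| J"
  shows "d v * odd_prod d J = 0"
proof -
  have fin: "finsert v (J |-| {|v|}) = J" using assms(2) by auto
  let ?s = "(- 1) ^ card {w. w |\<in>| J |-| {|v|} \<and> w < v} :: real"
  have "d v * odd_prod d (J |-| {|v|}) = ?s *\<^sub>R odd_prod d J"
    using odd_prod_finsert[OF assms(1), of v "J |-| {|v|}"] unfolding fin by simp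
  moreover have "d v * (d v * odd_prod d (J |-| {|v|})) = 0"
    using odd_square[OF parity_substD(2)[OF assms(1)], of v] by (simp add: mult.assoc[symmetric])
  ultimately show ?thesis by simp
qed

lemma odd_prod_mult:
  assumes "parity_subst e d"
  shows "odd_prod d J * odd_prod d K = koszul (A, J) (B, K) *\<^sub>R odd_prod d (J |\<union>| K)"
proof (induction J rule: fset_min_induct)
  case (insert v J)
  then have nv: "v |\<notin>| J" by blast
  have "odd_prod d (finsert v J) * odd_prod d K = d v * (odd_prod d J * odd_prod d K)"
    using insert.hyps by (simp add: odd_prod_finsert_min mult.assoc)
  also have "\<dots> = koszul (A, J) (B, K) *\<^sub>R (d v * odd_prod d (J |\<union>| K))"
    by (simp add: insert.IH)
  also have "\<dots> = koszul (A, finsert v J) (B, K) *\<^sub>R odd_prod d (finsert v J |\<union>| K)"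
  proof (cases "v |\<in>| K")
    case True
    then have "finsert v J |\<inter>| K \<noteq> {||}" by auto
    moreover have "d v * odd_prod d (J |\<union>| K) = 0"
      using True by (intro odd_prod_mem[OF assms]) auto
    ultimately show ?thesis by (simp only: koszul_def snd_conv if_False) simp
  next
    case False
    have "{w. w |\<in>| J |\<union>| K \<and> w < v} = {w. w |\<in>| K \<and> w < v}"
      using insert.hyps by (auto dest: order.asym)
    then have 1: "d v * odd_prod d (J |\<union>| K) = (- 1) ^ card {w. w |\<in>| K \<and> w < v} *\<^sub>R odd_prod d (finsert v (J |\<union>| K))"
      using odd_prod_finsert[OF assms, of v "J |\<union>| K"] nv False by simp
    \<comment> \<open>Only the new minimum \<open>v\<close> creates further inversions, one for each
      smaller element of \<open>K\<close>; this is the sign from inserting \<open>d v\<close> into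
      the product over \<open>J |\<union>| K\<close>.\<close>
    have "inversions (finsert v J) K = inversions J K \<union> Pair v ` {w. w |\<in>| K \<and> w < v}"
      by (auto simp: inversions_def)
    moreover have "finite {w. w |\<in>| K \<and> w < v}" by (rule finite_subset[of _ "fset K"]) auto
    moreover have "inversions J K \<inter> Pair v ` {w. w |\<in>| K \<and> w < v} = {}"
      using nv by (auto simp: inversions_def)
    ultimately have "card (inversions (finsert v J) K) = card (inversions J K) + card {w. w |\<in>| K \<and> w < v}"
      by (simp add: card_Un_disjoint card_image inj_on_def)
    moreover have "finsert v J |\<inter>| K = {||} \<longleftrightarrow> J |\<inter>| K = {||}" using False by auto
    ultimately have "koszul (A, finsert v J) (B, K) = koszul (A, J) (B, K) * (- 1) ^ card {w. w |\<in>| K \<and> w < v}"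
      by (simp add: koszul_def power_add)
    then show ?thesis by (simp add: 1)
  qed
  finally show ?case .
qed simp

lemma gen_subst_mult:
  assumes "parity_subst e d"
  shows "gen_subst e d k * gen_subst e d l = koszul k l *\<^sub>R gen_subst e d (mono_join k l)"
proof -
  obtain A J B K where kl: "k = (A, J)" "l = (B, K)" by (meson surj_pair)
  have "gen_subst e d k * gen_subst e d l
      = even_prod e A * (odd_prod d J * even_prod e B) * odd_prod d K"
    by (simp add: gen_subst_def kl mult.assoc)
  also have "odd_prod d J * even_prod e B = even_prod e B * odd_prod d J"
    by (rule even_central[OF even_prod_parity[OF assms], symmetric])
  also have "even_prod e A * (even_prod e B * odd_prod d J) * odd_prod d K
      = (even_prod e A * even_prod e B) * (odd_prod d J * odd_prod d K)"
    by (simp add: mult.assoc)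
  also have "\<dots> = koszul k l *\<^sub>R gen_subst e d (mono_join k l)"
    by (simp add: even_prod_union[OF assms, symmetric] odd_prod_mult[OF assms, of J K A B] gen_subst_def mono_join_def kl)
  finally show ?thesis .
qed

text \<open>Substituted monomials multiply with the same Koszul signs as the basis monomials, so
  collecting the double sum by joined monomials reproduces the product formula.\<close>

lemma gen_hom_mult:
  assumes "admissible e d" "parity_subst e d" "tame a" "tame b"
  shows "gen_hom e d (a * b) = gen_hom e d a * gen_hom e d b"
proof -
  let ?F = "\<lambda>m. coeff a m *\<^sub>R gen_subst e d m" and ?G = "\<lambda>m. coeff b m *\<^sub>R gen_subst e d m"
  note lf = locally_finite_gen_hom[OF assms(1,3)] locally_finite_gen_hom[OF assms(1,4)]
  have "gen_hom e d a * gen_hom e d b = formal_sum (\<lambda>(k, l). ?F k * ?G l)"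
    unfolding gen_hom_def by (rule formal_sum_mult[OF lf, symmetric])
  also have "\<dots> = formal_sum (\<lambda>m. \<Sum>p \<in> {(k, l). mono_join k l = m}. (\<lambda>(k, l). ?F k * ?G l) p)"
    by (rule formal_sum_group[symmetric, where h = "case_prod mono_join", OF locally_finite_mult[OF lf]]) auto
  also have "\<dots> = gen_hom e d (a * b)"
    unfolding gen_hom_def
  proof (intro arg_cong[where f = formal_sum] ext)
    fix m
    have "(\<Sum>p \<in> {(k, l). mono_join k l = m}. (\<lambda>(k, l). ?F k * ?G l) p)
        = (\<Sum>(k, l) \<in> {(k, l). mono_join k l = m}. (koszul k l * (coeff a k * coeff b l)) *\<^sub>R gen_subst e d m)"
      by (intro sum.cong refl) (auto simp: gen_subst_mult[OF assms(2)] mult_ac)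
    also have "\<dots> = coeff (a * b) m *\<^sub>R gen_subst e d m"
      by (simp add: coeff_mult scaleR_sum_left case_prod_unfold)
    finally show "(\<Sum>p \<in> {(k, l). mono_join k l = m}. (\<lambda>(k, l). ?F k * ?G l) p)
        = coeff (a * b) m *\<^sub>R gen_subst e d m" .
  qed
  finally show ?thesis ..
qed

definition monomial :: "mono \<Rightarrow> sfps" where
  "monomial m = Sfps (\<lambda>n. if n = m then 1 else 0)"

lemma monomial_mult: "monomial k * monomial l = koszul k l *\<^sub>R monomial (mono_join k l)"
proof (rule sfps_eqI)
  fix m
  have "coeff (monomial k * monomial l) m = (\<Sum>p \<in> {(k, l). mono_join k l = m}. if p = (k, l) then koszul k l else 0)"
    unfolding coeff_mult by (intro sum.cong refl) (auto simp: monomial_def split: if_splits)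
  also have "\<dots> = coeff (koszul k l *\<^sub>R monomial (mono_join k l)) m"
    by (subst sum.delta[OF finite_splits]) (auto simp: monomial_def)
  finally show "coeff (monomial k * monomial l) m = coeff (koszul k l *\<^sub>R monomial (mono_join k l)) m" .
qed

lemma odd_prod_odd_gen: "odd_prod odd_gen J = monomial ({#}, J)"
proof (induction J rule: fset_min_induct)
  case empty
  show ?case by (rule sfps_eqI) (simp add: monomial_def)
next
  case (insert v J)
  have "inversions {|v|} J = {}" using insert.hyps by (auto simp: inversions_def dest: order.asym)
  moreover have "{|v|} |\<inter>| J = {||}" using insert.hyps by auto
  ultimately have "koszul ({#}, {|v|}) ({#}, J) = 1" by (simp add: koszul_def)
  moreover have "odd_gen v = monomial ({#}, {|v|})" by (simp add: odd_gen_def monomial_def)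
  ultimately show ?case
    using insert by (simp add: odd_prod_finsert_min monomial_mult mono_join_def)
qed

text \<open>Series in the parameters are constants for a substitution, which later allows \<epsilon>
  to be pulled out of it.\<close>

lemma gen_hom_params:
  assumes "admissible e d" and "involves_only {} (range Param) a"
  shows "gen_hom e d a = a"
proof (rule sfps_eqI)
  fix n
  have *: "coeff (coeff a m *\<^sub>R gen_subst e d m) n = (if m = n then coeff a n else 0)" for m
  proof (cases "coeff a m = 0")
    case False
    then have m: "fst m = {#}" "fset (snd m) \<subseteq> range Param"
      using assms(2) by (metis involves_only_def prod.collapse set_mset_eq_empty_iff subset_empty)+
    then have "gen_subst e d m = gen_subst e odd_gen m"
      using assms(1) by (intro gen_subst_cong) (auto simp: admissible_def)
    also have "\<dots> = monomial m"
      using m(1) by (simp add: gen_subst_def odd_prod_odd_gen) (metis prod.collapse)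
    finally show ?thesis by (simp add: monomial_def)
  qed auto
  have "coeff (gen_hom e d a) n = (\<Sum>m\<in>{n}. coeff (coeff a m *\<^sub>R gen_subst e d m) n)"
    unfolding gen_hom_def by (rule coeff_formal_sum_superset) (auto simp only: * split: if_splits)
  then show "coeff (gen_hom e d a) n = coeff a n" by (simp only: *) simp
qed

section \<open>First-order expansion of substitutions\<close>

text \<open>Since products of two increments vanish, the Leibniz rule gives the exact value;
  \<open>count A v\<close> is the exponent produced by differentiating a power.\<close>

lemma even_prod_expand:
  assumes "parity_subst e d" "parity_subst e' d'"
    and "finite V" and "\<And>v. v \<notin> V \<Longrightarrow> h v = 0" and "\<And>v. e' v = e v + h v"
    and "\<And>v w. h v * h w = 0"
  shows "even_prod e' A =
    even_prod e A + (\<Sum>v\<in>V. real (count A v) *\<^sub>R (h v * even_prod e (A - {#v#})))"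
proof (induction A)
  case (add u A)
  let ?E = "even_prod e"
  have h: "has_parity False (h v)" for v
    using has_parity_diff[OF parity_substD(1)[OF assms(2)] parity_substD(1)[OF assms(1)], of v v]
    by (simp add: assms(5))
  have *: "e u * (real (count A v) *\<^sub>R (h v * ?E (A - {#v#}))) + (if v = u then h u * ?E A else 0)
      = real (count (add_mset u A) v) *\<^sub>R (h v * ?E (add_mset u A - {#v#}))" for v
  proof -
    have c: "e u * (h v * c) = h v * (e u * c)" for c
      by (metis even_central[OF h] mult.assoc)
    show ?thesis
    proof (cases "v \<in># A")
      case True
      then have "e u * ?E (A - {#v#}) = ?E (add_mset u A - {#v#})"
        by (simp add: even_prod_add_mset[OF assms(1), symmetric])
      then show ?thesis by (auto simp: c scaleR_add_left)
    next
      case False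
      then show ?thesis by (cases "v = u") (simp_all add: not_in_iff)
    qed
  qed
  have "even_prod e' (add_mset u A) = (e u + h u) * (?E A + (\<Sum>v\<in>V. real (count A v) *\<^sub>R (h v * ?E (A - {#v#}))))"
    by (simp add: even_prod_add_mset[OF assms(2)] add.IH assms(5))
  also have "\<dots> = ?E (add_mset u A) + h u * ?E A + e u * (\<Sum>v\<in>V. real (count A v) *\<^sub>R (h v * ?E (A - {#v#})))"
  proof -
    have "h u * (\<Sum>v\<in>V. real (count A v) *\<^sub>R (h v * ?E (A - {#v#}))) = 0"
      by (simp add: sum_distrib_left mult.assoc[symmetric] assms(6))
    then show ?thesis
      by (simp add: distrib_left distrib_right even_prod_add_mset[OF assms(1)])
  qed
  \<comment> \<open>Written as a sum over \<open>V\<close>, the term merges with the other sum index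
    by index; outside \<open>V\<close> the increment is zero.\<close>
  also have "h u * ?E A = (\<Sum>v\<in>V. if v = u then h u * ?E A else 0)"
    using assms(3,4) by (simp add: sum.delta)
  also have "?E (add_mset u A) + \<dots> + e u * (\<Sum>v\<in>V. real (count A v) *\<^sub>R (h v * ?E (A - {#v#})))
     = ?E (add_mset u A) + (\<Sum>v\<in>V. real (count (add_mset u A) v) *\<^sub>R (h v * ?E (add_mset u A - {#v#})))"
    unfolding sum_distrib_left add.assoc
    by (simp only: sum.distrib[symmetric] *[symmetric] add.commute)
  finally show ?case .
qed simp

text \<open>The signs are those of the left derivative: a new minimal factor has to be passed by the
  increment, which matches the increase by one of the number of smaller generators.\<close>

lemma odd_prod_expand:
  assumes "parity_subst e d" "parity_subst e' d'"
    and "finite W" and "\<And>w. w \<notin> W \<Longrightarrow> h w = 0" and "\<And>w. d' w = d w + h w"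
    and "\<And>v w. h v * h w = 0"
  shows "odd_prod d' J = odd_prod d J +
    (\<Sum>w\<in>W. if w |\<in>| J then (- 1) ^ card {v. v |\<in>| J \<and> v < w} *\<^sub>R (h w * odd_prod d (J |-| {|w|})) else 0)"
proof (induction J rule: fset_min_induct)
  case (insert u J)
  let ?O = "odd_prod d" and ?c = "\<lambda>J w. card {v. v |\<in>| J \<and> v < w}"
  let ?t = "\<lambda>J w. if w |\<in>| J then (- 1) ^ ?c J w *\<^sub>R (h w * ?O (J |-| {|w|})) else 0"
  have nu: "u |\<notin>| J" using insert.hyps by blast
  have h: "has_parity True (h w)" for w
    using has_parity_diff[OF parity_substD(2)[OF assms(2)] parity_substD(2)[OF assms(1)], of w w]
    by (simp add: assms(5))
  have *: "d u * ?t J w + (if w = u then h u * ?O J else 0) = ?t (finsert u J) w" for w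
  proof -
    have "d u * h w = - (h w * d u)" by (rule odd_anticommute[OF parity_substD(2)[OF assms(1)] h])
    then have c: "d u * (h w * c) = - (h w * (d u * c))" for c
      by (simp add: mult.assoc[symmetric])
    consider "w = u" | "w \<noteq> u" "w |\<in>| J" | "w \<noteq> u" "w |\<notin>| J" by blast
    then show ?thesis
    proof cases
      case 1
      have "{v. v |\<in>| finsert u J \<and> v < u} = {}" using insert.hyps by (auto dest: order.asym)
      then have "?c (finsert u J) u = 0" by (simp only: card.empty)
      moreover have "finsert u J |-| {|u|} = J" using nu by auto
      ultimately have "?t (finsert u J) u = h u * ?O J"
        by (simp only: finsert_iff simp_thms if_True power_0 scaleR_one)
      then show ?thesis unfolding 1 using nu by (simp only:) simp
    next
      case 2
      have "{v. v |\<in>| finsert u J \<and> v < w} = insert u {v. v |\<in>| J \<and> v < w}"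
        using insert.hyps[OF 2(2)] by auto
      moreover have "finite {v. v |\<in>| J \<and> v < w}" by (rule finite_subset[of _ "fset J"]) auto
      ultimately have card: "?c (finsert u J) w = Suc (?c J w)" using nu by simp
      have "finsert u J |-| {|w|} = finsert u (J |-| {|w|})" using 2 by auto
      moreover have "?O (finsert u (J |-| {|w|})) = d u * ?O (J |-| {|w|})"
        using insert.hyps by (intro odd_prod_finsert_min) auto
      ultimately show ?thesis using 2 unfolding card by (simp add: c)
    qed auto
  qed
  have "odd_prod d' (finsert u J) = (d u + h u) * (?O J + (\<Sum>w\<in>W. ?t J w))"
    using insert.hyps by (simp add: odd_prod_finsert_min insert.IH assms(5))
  also have "\<dots> = ?O (finsert u J) + h u * ?O J + d u * (\<Sum>w\<in>W. ?t J w)"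
  proof -
    have "h u * ?t J w = 0" for w by (simp add: mult.assoc[symmetric] assms(6))
    then have "h u * (\<Sum>w\<in>W. ?t J w) = 0" by (simp add: sum_distrib_left)
    then show ?thesis
      using insert.hyps by (simp add: distrib_left distrib_right odd_prod_finsert_min)
  qed
  also have "h u * ?O J = (\<Sum>w\<in>W. if w = u then h u * ?O J else 0)"
    using assms(3,4) by (simp add: sum.delta)
  also have "?O (finsert u J) + \<dots> + d u * (\<Sum>w\<in>W. ?t J w) = ?O (finsert u J) + (\<Sum>w\<in>W. ?t (finsert u J) w)"
    unfolding sum_distrib_left add.assoc
    by (simp only: sum.distrib[symmetric] *[symmetric] add.commute)
  finally show ?case .
qed simp

text \<open>Made for derivatives, which shift monomials: \<open>h\<close> restores the removed
  generator and is a bijection only onto the monomials that contain it.\<close>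

lemma
  assumes "bij_betw h S T" and "\<And>i. i \<notin> T \<Longrightarrow> F i = 0" and "\<And>i. i \<in> S \<Longrightarrow> G i = F (h i)"
    and "\<And>i. i \<notin> S \<Longrightarrow> G i = 0"
  shows locally_finite_reindex_partial: "locally_finite F \<longleftrightarrow> locally_finite G"
    and formal_sum_reindex_partial: "formal_sum F = formal_sum G"
proof -
  have G: "coeff (F (h i)) m = coeff (G i) m" if "coeff (G i) m \<noteq> 0" for i m
  proof -
    have "i \<in> S" using assms(4)[of i] that by (cases "i \<in> S") simp_all
    then show ?thesis by (simp add: assms(3))
  qed
  have bij: "bij_betw h {i. coeff (G i) m \<noteq> 0} {i. coeff (F i) m \<noteq> 0}" for m
  proof (rule bij_betw_subset[OF assms(1)])
    show "{i. coeff (G i) m \<noteq> 0} \<subseteq> S" using assms(4) by force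
    show "h ` {i. coeff (G i) m \<noteq> 0} = {i. coeff (F i) m \<noteq> 0}"
    proof
      show "h ` {i. coeff (G i) m \<noteq> 0} \<subseteq> {i. coeff (F i) m \<noteq> 0}"
        by (auto simp: G)
      show "{i. coeff (F i) m \<noteq> 0} \<subseteq> h ` {i. coeff (G i) m \<noteq> 0}"
      proof
        fix i assume i: "i \<in> {i. coeff (F i) m \<noteq> 0}"
        then have "i \<in> T" using assms(2) by force
        then obtain j where "j \<in> S" "i = h j" using assms(1) by (auto simp: bij_betw_def)
        then show "i \<in> h ` {i. coeff (G i) m \<noteq> 0}" using i assms(3) by auto
      qed
    qed
  qed
  show "locally_finite F \<longleftrightarrow> locally_finite G"
    unfolding locally_finite_def using bij_betw_finite[OF bij] by blast
  show "formal_sum F = formal_sum G"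
  proof (rule sfps_eqI)
    fix m
    have "(\<Sum>i | coeff (G i) m \<noteq> 0. coeff (F (h i)) m) = (\<Sum>i | coeff (F i) m \<noteq> 0. coeff (F i) m)"
      by (rule sum.reindex_bij_betw[OF bij])
    moreover have "(\<Sum>i | coeff (G i) m \<noteq> 0. coeff (F (h i)) m) = (\<Sum>i | coeff (G i) m \<noteq> 0. coeff (G i) m)"
      by (intro sum.cong refl) (simp add: G)
    ultimately show "coeff (formal_sum F) m = coeff (formal_sum G) m"
      by (simp add: coeff_formal_sum Sum_any.expand_set)
  qed
qed

text \<open>Re-indexing by the monomial before differentiation brings the substituted derivative
  into the form in which it appears in the expansion of a product.\<close>

lemma
  fixes a :: sfps and v :: evar and e d
  defines "F \<equiv> \<lambda>m. coeff a m *\<^sub>R (real (count (fst m) v) *\<^sub>R gen_subst e d (fst m - {#v#}, snd m))"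
  shows gen_hom_even_deriv: "gen_hom e d (even_deriv v a) = formal_sum F"
    and locally_finite_even_deriv:
      "locally_finite (\<lambda>m. coeff (even_deriv v a) m *\<^sub>R gen_subst e d m) \<Longrightarrow> locally_finite F"
proof -
  let ?G = "\<lambda>m. coeff (even_deriv v a) m *\<^sub>R gen_subst e d m"
  have bij: "bij_betw (\<lambda>m. (add_mset v (fst m), snd m :: ovar fset)) UNIV {m. v \<in># fst m}"
    by (rule bij_betw_byWitness[of _ "\<lambda>m. (fst m - {#v#}, snd m)"]) auto
  have G: "?G m = F (add_mset v (fst m), snd m)" for m
    by (simp add: F_def even_deriv_def case_prod_unfold)
  have "F m = 0" if "m \<notin> {m. v \<in># fst m}" for m
    using that by (simp add: F_def not_in_iff)
  note r = locally_finite_reindex_partial[where F = F and G = ?G, OF bij this G]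
    formal_sum_reindex_partial[symmetric, where F = F and G = ?G, OF bij this G]
  show "gen_hom e d (even_deriv v a) = formal_sum F"
    unfolding gen_hom_def by (rule r(2)) simp_all
  show "locally_finite F" if "locally_finite ?G"
    using r(1) that by simp
qed

lemma
  fixes a :: sfps and w :: ovar and e d
  defines "F \<equiv> \<lambda>m. coeff a m *\<^sub>R (if w |\<in>| snd m
       then (- 1) ^ card {v. v |\<in>| snd m \<and> v < w} *\<^sub>R gen_subst e d (fst m, snd m |-| {|w|}) else 0)"
  shows gen_hom_odd_deriv: "gen_hom e d (odd_deriv w a) = formal_sum F"
    and locally_finite_odd_deriv:
      "locally_finite (\<lambda>m. coeff (odd_deriv w a) m *\<^sub>R gen_subst e d m) \<Longrightarrow> locally_finite F"
proof -
  let ?G = "\<lambda>m. coeff (odd_deriv w a) m *\<^sub>R gen_subst e d m"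
  have bij: "bij_betw (\<lambda>m :: mono. (fst m, finsert w (snd m))) {m. w |\<notin>| snd m} {m. w |\<in>| snd m}"
    by (rule bij_betw_byWitness[of _ "\<lambda>m. (fst m, snd m |-| {|w|})"]) (auto simp: prod_eq_iff fset_eq_iff)
  have G: "?G m = F (fst m, finsert w (snd m))" if "m \<in> {m. w |\<notin>| snd m}" for m
  proof -
    have w: "w |\<notin>| snd m" using that by simp
    have "{v. v |\<in>| finsert w (snd m) \<and> v < w} = {v. v |\<in>| snd m \<and> v < w}" by auto
    moreover have "finsert w (snd m) |-| {|w|} = snd m" using w by auto
    ultimately show ?thesis
      using w unfolding F_def fst_conv snd_conv by (simp only:) (simp add: odd_deriv_def case_prod_unfold)
  qed
  have G0: "?G m = 0" if "m \<notin> {m. w |\<notin>| snd m}" for m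
    using that by (simp add: odd_deriv_def case_prod_unfold)
  have "F m = 0" if "m \<notin> {m. w |\<in>| snd m}" for m
    using that by (simp add: F_def)
  note r = locally_finite_reindex_partial[where F = F and G = ?G, OF bij this G G0]
    formal_sum_reindex_partial[symmetric, where F = F and G = ?G, OF bij this G G0]
  show "gen_hom e d (odd_deriv w a) = formal_sum F"
    unfolding gen_hom_def by (rule r(2)) simp_all
  show "locally_finite F" if "locally_finite ?G"
    using r(1) that by simp
qed

lemma involves_only_even_deriv: "involves_only V W a \<Longrightarrow> involves_only V W (even_deriv v a)"
  unfolding involves_only_def even_deriv_def by (auto, metis add_mset_add_single insert_subset set_mset_add_mset_insert subsetD)

lemma involves_only_odd_deriv: "involves_only V W a \<Longrightarrow> involves_only V W (odd_deriv v a)"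
  unfolding involves_only_def odd_deriv_def by (auto split: if_splits)

lemma tame_even_deriv: "tame a \<Longrightarrow> tame (even_deriv v a)"
  and tame_odd_deriv: "tame a \<Longrightarrow> tame (odd_deriv w a)"
  by (meson tame_def involves_only_even_deriv, meson tame_def involves_only_odd_deriv)

lemma has_parity_even_deriv: "has_parity s a \<Longrightarrow> has_parity s (even_deriv v a)"
  by (auto simp: has_parity_def even_deriv_def)

lemma has_parity_odd_deriv: "has_parity s a \<Longrightarrow> has_parity (\<not> s) (odd_deriv v a)"
  unfolding has_parity_def
proof (intro allI impI)
  fix A J assume a: "\<forall>A J. coeff a (A, J) \<noteq> 0 \<longrightarrow> odd (fcard J) = s" and c: "coeff (odd_deriv v a) (A, J) \<noteq> 0"
  then have "v |\<notin>| J" "coeff a (A, finsert v J) \<noteq> 0" by (auto simp: odd_deriv_def split: if_splits)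
  then have "odd (fcard (finsert v J)) = s" "fcard (finsert v J) = Suc (fcard J)"
    using a by (blast, simp add: fcard_finsert_disjoint)
  then show "odd (fcard J) = (\<not> s)" by auto
qed

text \<open>Even and odd parts of each monomial are expanded separately and multiplied out. Tameness
  passes to the derivatives, so all sums are locally finite and the expansion may be summed over
  monomials.\<close>

lemma gen_hom_expand:
  assumes par: "parity_subst e d" "parity_subst e' d'"
    and adm: "admissible e d" and "tame a"
    and V: "finite V" "\<And>v. v \<notin> V \<Longrightarrow> h v = 0" "\<And>v. e' v = e v + h v"
    and W: "finite W" "\<And>w. w \<notin> W \<Longrightarrow> k w = 0" "\<And>w. d' w = d w + k w"
    and sq: "\<And>v w. h v * h w = 0" "\<And>v w. k v * k w = 0" "\<And>v w. h v * k w = 0"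
  shows "gen_hom e' d' a = gen_hom e d a + (\<Sum>v\<in>V. h v * gen_hom e d (even_deriv v a))
     + (\<Sum>w\<in>W. k w * gen_hom e d (odd_deriv w a))"
proof -
  let ?E = "even_prod e" and ?O = "odd_prod d" and ?g = "gen_subst e d"
  let ?s = "\<lambda>J w. (if w |\<in>| J then (- 1) ^ card {v. v |\<in>| J \<and> v < w} else 0) :: real"
  let ?X = "\<lambda>v m. real (count (fst m) v) *\<^sub>R ?g (fst m - {#v#}, snd m)"
  let ?Y = "\<lambda>w m. if w |\<in>| snd m then (- 1) ^ card {v. v |\<in>| snd m \<and> v < w} *\<^sub>R ?g (fst m, snd m |-| {|w|}) else 0"
  have *: "gen_subst e' d' m = ?g m + (\<Sum>v\<in>V. h v * ?X v m) + (\<Sum>w\<in>W. k w * ?Y w m)" for m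
  proof -
    obtain A J where m: "m = (A, J)" by (rule prod.exhaust)
    let ?P = "\<Sum>v\<in>V. real (count A v) *\<^sub>R (h v * ?E (A - {#v#}))"
    let ?Q = "\<Sum>w\<in>W. if w |\<in>| J then (- 1) ^ card {v. v |\<in>| J \<and> v < w} *\<^sub>R (k w * ?O (J |-| {|w|})) else 0"
    have "gen_subst e' d' m = (?E A + ?P) * (?O J + ?Q)"
      using even_prod_expand[OF par V sq(1), of A] odd_prod_expand[OF par W sq(2), of J]
      by (simp add: gen_subst_def m)
    also have "\<dots> = ?E A * ?O J + ?P * ?O J + ?E A * ?Q + ?P * ?Q"
      by (simp add: distrib_left distrib_right)
    also have "?P * ?O J = (\<Sum>v\<in>V. h v * ?X v m)"
      by (simp add: sum_distrib_right gen_subst_def m mult.assoc)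
    also have "?E A * ?Q = (\<Sum>w\<in>W. k w * ?Y w m)"
      unfolding sum_distrib_left
    proof (rule sum.cong[OF refl])
      fix w
      have "?E A * (k w * c) = k w * (?E A * c)" for c
        by (metis even_central[OF even_prod_parity[OF par(1)]] mult.assoc)
      then show "?E A * (if w |\<in>| J then (- 1) ^ card {v. v |\<in>| J \<and> v < w} *\<^sub>R (k w * ?O (J |-| {|w|})) else 0) = k w * ?Y w m"
        by (simp add: gen_subst_def m)
    qed
    \<comment> \<open>The second-order terms vanish once the even factor between the two increments
      is moved aside.\<close>
    also have "?P * ?Q = 0"
    proof -
      have "(h v * ?E B) * (k w * c) = 0" for v B w c
        by (metis even_central[OF even_prod_parity[OF par(1)]] mult.assoc sq(3) mult_zero_left)
      then show ?thesis
        unfolding sum_product by (intro sum.neutral ballI) simp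
    qed
    finally show ?thesis by (simp add: gen_subst_def m)
  qed
  have lX: "locally_finite (\<lambda>m. coeff a m *\<^sub>R ?X v m)" for v
    by (intro locally_finite_even_deriv locally_finite_gen_hom adm tame_even_deriv assms(4))
  have lY: "locally_finite (\<lambda>m. coeff a m *\<^sub>R ?Y w m)" for w
    by (intro locally_finite_odd_deriv locally_finite_gen_hom adm tame_odd_deriv assms(4))
  have "gen_hom e' d' a = formal_sum (\<lambda>m. coeff a m *\<^sub>R ?g m + (\<Sum>v\<in>V. h v * (coeff a m *\<^sub>R ?X v m))
      + (\<Sum>w\<in>W. k w * (coeff a m *\<^sub>R ?Y w m)))"
    unfolding gen_hom_def * by (simp only: scaleR_add_right scaleR_sum_right mult_scaleR_right)
  also have "\<dots> = gen_hom e d a + (\<Sum>v\<in>V. h v * formal_sum (\<lambda>m. coeff a m *\<^sub>R ?X v m))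
      + (\<Sum>w\<in>W. k w * formal_sum (\<lambda>m. coeff a m *\<^sub>R ?Y w m))"
    unfolding gen_hom_def
    by (simp only: formal_sum_add locally_finite_add formal_sum_sum locally_finite_sum V(1) W(1)
        formal_sum_mult_left locally_finite_mult_left lX lY locally_finite_gen_hom[OF adm assms(4)])
  finally show ?thesis by (simp only: gen_hom_even_deriv gen_hom_odd_deriv)
qed

section \<open>Taylor series of jets\<close>

text \<open>
  A jet lists the values of all iterated partial derivatives; its Taylor series at the increment
  \<open>v\<close> is built recursively in the order, which makes first-order expansion a short induction.
\<close>

primrec jet_sum :: "nat \<Rightarrow> (nat \<Rightarrow> sfps) \<Rightarrow> (sfps \<Rightarrow> sfps) \<Rightarrow> nat \<Rightarrow> (nat list \<Rightarrow> sfps) \<Rightarrow> sfps" where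
  "jet_sum n v h 0 T = h (T [])"
| "jet_sum n v h (Suc r) T = (\<Sum>k<n. v k * jet_sum n v h r (\<lambda>is. T (k # is)))"

definition taylor :: "nat \<Rightarrow> (nat \<Rightarrow> sfps) \<Rightarrow> (sfps \<Rightarrow> sfps) \<Rightarrow> (nat list \<Rightarrow> sfps) \<Rightarrow> sfps" where
  "taylor n v h T = formal_sum (\<lambda>r. (1 / fact r) *\<^sub>R jet_sum n v h r T)"

definition jet :: "superfun \<Rightarrow> point \<Rightarrow> nat list \<Rightarrow> sfps" where
  "jet f x is = Sfps (\<lambda>m. partials is (\<lambda>z. coeff (f z) m) x)"

lemma jet_sum_eq_sum:
  "jet_sum n v h r T = (\<Sum>is | set is \<subseteq> {..<n} \<and> length is = r. prod_list (map v is) * h (T is))"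
proof (induction r arbitrary: T)
  case 0
  have "{is. set is \<subseteq> {..<n} \<and> length is = 0} = {[]}" by auto
  then show ?case by simp
next
  case (Suc r)
  have inj: "inj_on (\<lambda>(xs, n). n # xs) X" for X :: "(nat list \<times> nat) set" by (auto simp: inj_on_def)
  have "(\<Sum>is | set is \<subseteq> {..<n} \<and> length is = Suc r. prod_list (map v is) * h (T is))
      = (\<Sum>(is, k)\<in>{is. set is \<subseteq> {..<n} \<and> length is = r} \<times> {..<n}. v k * (prod_list (map v is) * h (T (k # is))))"
    unfolding lists_length_Suc_eq sum.reindex[OF inj]
    by (simp add: case_prod_unfold mult.assoc)
  also have "\<dots> = (\<Sum>k<n. \<Sum>is | set is \<subseteq> {..<n} \<and> length is = r. v k * (prod_list (map v is) * h (T (k # is))))"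
    by (subst sum.swap) (simp add: sum.cartesian_product)
  finally show ?case by (simp add: Suc.IH sum_distrib_left)
qed

text \<open>\<open>substitute\<close> is one sum over pairs of a multi-index and a monomial. Each
  increment has positive total degree, which bounds the length of a contributing multi-index, and
  tameness bounds the monomials; hence one may sum over monomials first and then collect
  multi-indices by length.\<close>

lemma substitute_eq_taylor:
  fixes y q :: "coord \<Rightarrow> sfps" and n :: nat
  defines "x \<equiv> body n y"
  assumes adm: "admissible (even_subst q) (odd_subst y q)"
    and tame: "\<And>is. set is \<subseteq> {..<n} \<Longrightarrow> tame (jet f x is)"
  shows "substitute n f y q = taylor n (\<lambda>i. y (Ev i) - of_real (x i))
    (gen_hom (even_subst q) (odd_subst y q)) (jet f x)"
proof -
  let ?g = "gen_subst (even_subst q) (odd_subst y q)" and ?h = "gen_hom (even_subst q) (odd_subst y q)"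
  let ?v = "\<lambda>i. y (Ev i) - of_real (x i)"
  let ?p = "\<lambda>is. prod_list (map ?v is)"
  \<comment> \<open>The coefficient absorbs the restriction on multi-indices, so that
    \<open>F\<close> is defined on all pairs.\<close>
  let ?c = "\<lambda>is. if set is \<subseteq> {..<n} then 1 / fact (length is) else 0 :: real"
  define F where "F = (\<lambda>(is, m). ?c is *\<^sub>R (?p is * (coeff (jet f x is) m *\<^sub>R ?g m)))"
  have F0: "F (is, m) = 0" if "\<not> set is \<subseteq> {..<n}" for "is" m
    unfolding F_def using that by simp
  have v: "?v i \<in> filt total_degree 1" if "i < n" for i
    using that unfolding const_term_eq_0_iff[symmetric]
    by (simp add: x_def const_term_def body_def of_real_def)
  have p: "?p is \<in> filt total_degree (length is)" if "set is \<subseteq> {..<n}" for "is"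
    using that by (intro prod_list_filt v) auto
  have inner: "locally_finite (\<lambda>m. ?p is * (coeff (jet f x is) m *\<^sub>R ?g m))"
    and inner_sum: "formal_sum (\<lambda>m. ?p is * (coeff (jet f x is) m *\<^sub>R ?g m)) = ?p is * ?h (jet f x is)"
    if "set is \<subseteq> {..<n}" for "is"
    unfolding gen_hom_def
    by (intro locally_finite_mult_left formal_sum_mult_left locally_finite_gen_hom adm tame that)+
  have lf: "locally_finite F"
    unfolding locally_finite_def
  proof
    fix t
    let ?L = "{is. set is \<subseteq> {..<n} \<and> length is \<le> total_degree t}"
    let ?M = "\<lambda>is. {m. coeff (?p is * (coeff (jet f x is) m *\<^sub>R ?g m)) t \<noteq> 0}"
    have "{i. coeff (F i) t \<noteq> 0} \<subseteq> Sigma ?L ?M"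
    proof
      fix i assume i: "i \<in> {i. coeff (F i) t \<noteq> 0}"
      obtain "is" m where im: "i = (is, m)" by (rule prod.exhaust)
      have L: "set is \<subseteq> {..<n}" using i F0[of "is" m] unfolding im by force
      have nz: "coeff (?p is * (coeff (jet f x is) m *\<^sub>R ?g m)) t \<noteq> 0"
        using i by (auto simp: im F_def)
      have "?p is * (coeff (jet f x is) m *\<^sub>R ?g m) \<in> filt total_degree (length is)"
        by (intro filt_mult_right p L weight_total_degree)
      then have "length is \<le> total_degree t" using nz by (auto simp: filt_def not_less[symmetric])
      then show "i \<in> Sigma ?L ?M" using L nz by (simp add: im)
    qed
    moreover have "finite (Sigma ?L ?M)"
      by (intro finite_SigmaI finite_lists_length_le locally_finiteD inner) auto
    ultimately show "finite {i. coeff (F i) t \<noteq> 0}" by (rule finite_subset)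
  qed
  let ?S = "\<lambda>r. {is. set is \<subseteq> {..<n} \<and> length is = r}"
  let ?B = "\<lambda>is. ?c is *\<^sub>R (?p is * ?h (jet f x is))"
  have B: "formal_sum (\<lambda>m. F (is, m)) = ?B is" for "is"
  proof (cases "set is \<subseteq> {..<n}")
    case True
    show ?thesis unfolding F_def prod.case by (simp only: True formal_sum_scaleR inner inner_sum)
  qed (simp add: F_def)
  have lfB: "locally_finite ?B"
    unfolding locally_finite_def
  proof
    fix t
    have "{is. coeff (?B is) t \<noteq> 0} \<subseteq> {is. set is \<subseteq> {..<n} \<and> length is \<le> total_degree t}"
    proof
      fix "is" assume nz: "is \<in> {is. coeff (?B is) t \<noteq> 0}"
      then have L: "set is \<subseteq> {..<n}" by (auto split: if_splits)
      have "?B is \<in> filt total_degree (length is)"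
        by (intro filt_scaleR filt_mult_right p L weight_total_degree)
      then show "is \<in> {is. set is \<subseteq> {..<n} \<and> length is \<le> total_degree t}"
        using nz L by (auto simp: filt_def not_less[symmetric] simp del: coeff_simps)
    qed
    then show "finite {is. coeff (?B is) t \<noteq> 0}"
      by (rule finite_subset) (simp add: finite_lists_length_le)
  qed
  have "substitute n f y q = formal_sum F"
    unfolding substitute_def F_def x_def mono_subst_eq
    by (intro arg_cong[where f = formal_sum] ext) (auto simp: jet_def lists_eq_set)
  also have "\<dots> = formal_sum ?B"
    by (subst formal_sum_Fubini[OF lf]) (simp only: B)
  also have "\<dots> = formal_sum (\<lambda>r. \<Sum>is\<in>?S r. ?B is)"
    by (rule formal_sum_group[symmetric, where h = length, OF lfB])
      (auto simp: finite_lists_length_eq split: if_splits)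
  also have "\<dots> = taylor n ?v ?h (jet f x)"
    unfolding taylor_def jet_sum_eq_sum scaleR_sum_right
    by (intro arg_cong[where f = formal_sum] ext sum.cong refl) auto
  finally show ?thesis .
qed

lemma jet_sum_filt:
  assumes "\<And>k. k < n \<Longrightarrow> v k \<in> filt total_degree 1"
  shows "jet_sum n v h r T \<in> filt total_degree r"
proof (induction r arbitrary: T)
  case (Suc r)
  have "v k * jet_sum n v h r (\<lambda>is. T (k # is)) \<in> filt total_degree (1 + r)" if "k < n" for k
    by (intro filt_mult weight_total_degree assms that Suc.IH)
  then show ?case by (auto intro!: filt_sum)
qed simp

lemma locally_finite_taylor:
  assumes "\<And>k. k < n \<Longrightarrow> v k \<in> filt total_degree 1"
  shows "locally_finite (\<lambda>r. c r *\<^sub>R jet_sum n v h r T)"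
  by (intro locally_finite_filt[of _ total_degree] filt_scaleR jet_sum_filt assms)

text \<open>The factors \<open>a\<close> and \<open>b\<close> may be odd or inhomogeneous; they move
  to the left because the increments are even and hence central.\<close>

lemma jet_sum_lincomb:
  assumes "\<And>k. k < n \<Longrightarrow> has_parity False (v k)"
    and "\<And>is. set is \<subseteq> {..<n} \<Longrightarrow> h (T is) = a * h (T1 is) + b * h (T2 is)"
  shows "jet_sum n v h r T = a * jet_sum n v h r T1 + b * jet_sum n v h r T2"
  using assms(2)
proof (induction r arbitrary: T T1 T2)
  case (Suc r)
  have "v k * jet_sum n v h r (\<lambda>is. T (k # is)) = a * (v k * jet_sum n v h r (\<lambda>is. T1 (k # is)))
      + b * (v k * jet_sum n v h r (\<lambda>is. T2 (k # is)))" if "k < n" for k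
  proof -
    have "v k * (c * d) = c * (v k * d)" for c d
      by (metis even_central[OF assms(1)[OF that]] mult.assoc)
    moreover have "jet_sum n v h r (\<lambda>is. T (k # is))
        = a * jet_sum n v h r (\<lambda>is. T1 (k # is)) + b * jet_sum n v h r (\<lambda>is. T2 (k # is))"
      by (intro Suc) (use that in auto)
    ultimately show ?thesis by (simp add: distrib_left)
  qed
  then show ?case by (simp add: sum_distrib_left sum.distrib)
qed simp

lemma taylor_lincomb:
  assumes "\<And>k. k < n \<Longrightarrow> v k \<in> filt total_degree 1" and "\<And>k. k < n \<Longrightarrow> has_parity False (v k)"
    and "\<And>is. set is \<subseteq> {..<n} \<Longrightarrow> h (T is) = a * h (T1 is) + b * h (T2 is)"
  shows "taylor n v h T = a * taylor n v h T1 + b * taylor n v h T2"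
proof -
  have "(1 / fact r) *\<^sub>R jet_sum n v h r T
      = a * ((1 / fact r) *\<^sub>R jet_sum n v h r T1) + b * ((1 / fact r) *\<^sub>R jet_sum n v h r T2)" for r
    using jet_sum_lincomb[of n v h T a T1 b T2 r] assms(2,3) by (simp add: scaleR_add_right)
  then show ?thesis
    unfolding taylor_def
    by (simp only: formal_sum_add formal_sum_mult_left locally_finite_mult_left locally_finite_taylor[OF assms(1)])
qed

lemma jet_sum_cong:
  assumes "\<And>k. k < n \<Longrightarrow> v k = v' k" and "\<And>is. set is \<subseteq> {..<n} \<Longrightarrow> h (T is) = h' (T' is)"
  shows "jet_sum n v h r T = jet_sum n v' h' r T'"
  using assms(2)
proof (induction r arbitrary: T T')
  case (Suc r)
  have "jet_sum n v h r (\<lambda>is. T (k # is)) = jet_sum n v' h' r (\<lambda>is. T' (k # is))" if "k < n" for k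
    by (intro Suc) (use that in auto)
  then show ?case by (simp add: assms(1))
qed simp

lemma taylor_cong:
  assumes "\<And>k. k < n \<Longrightarrow> v k = v' k" and "\<And>is. set is \<subseteq> {..<n} \<Longrightarrow> h (T is) = h' (T' is)"
  shows "taylor n v h T = taylor n v' h' T'"
  unfolding taylor_def using jet_sum_cong[of n v v' h T h' T', OF assms] by simp

lemma jet_sum_parity:
  assumes "\<And>k. k < n \<Longrightarrow> has_parity False (v k)"
    and "\<And>is. set is \<subseteq> {..<n} \<Longrightarrow> has_parity s (h (T is))"
  shows "has_parity s (jet_sum n v h r T)"
  using assms(2)
proof (induction r arbitrary: T)
  case (Suc r)
  have "has_parity s (v k * jet_sum n v h r (\<lambda>is. T (k # is)))" if "k < n" for k
  proof -
    have "has_parity s (jet_sum n v h r (\<lambda>is. T (k # is)))"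
      by (intro Suc) (use that in auto)
    then show ?thesis using has_parity_mult[OF assms(1)[OF that]] by fastforce
  qed
  then show ?case by (auto intro!: has_parity_sum)
qed simp

lemma taylor_parity:
  assumes "\<And>k. k < n \<Longrightarrow> has_parity False (v k)"
    and "\<And>is. set is \<subseteq> {..<n} \<Longrightarrow> has_parity s (h (T is))"
  shows "has_parity s (taylor n v h T)"
  unfolding taylor_def by (intro has_parity_formal_sum has_parity_scaleR jet_sum_parity assms)

text \<open>A form of degree \<open>r\<close> varies to first order in \<open>r\<close> slots, and
  symmetry makes these variations equal. Symmetry behind an arbitrary prefix \<open>js\<close> is
  what the induction hypothesis inherits for the tails \<open>T (k # is)\<close>.\<close>

lemma jet_sum_expand:
  assumes "\<And>k. k < n \<Longrightarrow> has_parity False (v k)"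
    and "\<And>k. k < n \<Longrightarrow> v' k = v k + \<eta> k"
    and "\<And>k l. k < n \<Longrightarrow> l < n \<Longrightarrow> \<eta> k * \<eta> l = 0" and "\<And>k w. k < n \<Longrightarrow> \<eta> k * c w = 0"
    and "\<And>is. set is \<subseteq> {..<n} \<Longrightarrow> h' (T is) = h (T is) + (\<Sum>w\<in>W. c w * h (U w is))"
    and "\<And>k l is. k < n \<Longrightarrow> l < n \<Longrightarrow> set is \<subseteq> {..<n} \<Longrightarrow> T (k # l # is) = T (l # k # is)"
    and "\<And>k l is js. k < n \<Longrightarrow> l < n \<Longrightarrow> set is \<subseteq> {..<n} \<Longrightarrow> set js \<subseteq> {..<n} \<Longrightarrow>
      T (js @ k # l # is) = T (js @ l # k # is)"
  shows "jet_sum n v' h' r T = jet_sum n v h r T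
    + real r *\<^sub>R (\<Sum>k<n. \<eta> k * jet_sum n v h (r - 1) (\<lambda>is. T (k # is)))
    + (\<Sum>w\<in>W. c w * jet_sum n v h r (U w))"
  using assms(5-)
proof (induction r arbitrary: T U)
  case (Suc r)
  let ?J = "jet_sum n v h" and ?T = "\<lambda>k is. T (k # is)" and ?U = "\<lambda>k w is. U w (k # is)"
  have comm: "v k * (c * d) = c * (v k * d)" if "k < n" for k c d
    by (metis even_central[OF assms(1)[OF that]] mult.assoc)
  have IH: "jet_sum n v' h' r (?T k) = ?J r (?T k)
    + real r *\<^sub>R (\<Sum>l<n. \<eta> l * ?J (r - 1) (\<lambda>is. T (k # l # is)))
    + (\<Sum>w\<in>W. c w * ?J r (?U k w))" if "k < n" for k
  proof (rule Suc.IH)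
    show "h' (?T k is) = h (?T k is) + (\<Sum>w\<in>W. c w * h (?U k w is))" if "set is \<subseteq> {..<n}" for "is"
      using Suc.prems(1)[of "k # is"] that \<open>k < n\<close> by simp
    show "?T k (l # l' # is) = ?T k (l' # l # is)" if "l < n" "l' < n" "set is \<subseteq> {..<n}" for l l' "is"
      using Suc.prems(3)[of l l' "is" "[k]"] that \<open>k < n\<close> by simp
    show "?T k (js @ l # l' # is) = ?T k (js @ l' # l # is)"
      if "l < n" "l' < n" "set is \<subseteq> {..<n}" "set js \<subseteq> {..<n}" for l l' "is" js
      using Suc.prems(3)[of l l' "is" "k # js"] that \<open>k < n\<close> by simp
  qed
  have step: "v' k * jet_sum n v' h' r (?T k) = v k * ?J r (?T k) + \<eta> k * ?J r (?T k)
     + real r *\<^sub>R (\<Sum>l<n. \<eta> l * (v k * ?J (r - 1) (\<lambda>is. T (k # l # is))))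
     + (\<Sum>w\<in>W. c w * (v k * ?J r (?U k w)))" if k: "k < n" for k
  proof -
    have "\<eta> k * (\<Sum>l<n. \<eta> l * ?J (r - 1) (\<lambda>is. T (k # l # is))) = 0"
      by (simp add: sum_distrib_left mult.assoc[symmetric] assms(3) k)
    moreover have "\<eta> k * (\<Sum>w\<in>W. c w * ?J r (?U k w)) = 0"
      by (simp add: sum_distrib_left mult.assoc[symmetric] assms(4) k)
    ultimately have "\<eta> k * jet_sum n v' h' r (?T k) = \<eta> k * ?J r (?T k)"
      by (simp add: IH[OF k] distrib_left)
    moreover have "v k * jet_sum n v' h' r (?T k) = v k * ?J r (?T k)
       + real r *\<^sub>R (\<Sum>l<n. \<eta> l * (v k * ?J (r - 1) (\<lambda>is. T (k # l # is))))
       + (\<Sum>w\<in>W. c w * (v k * ?J r (?U k w)))"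
      by (simp add: IH[OF k] distrib_left sum_distrib_left comm[OF k])
    ultimately show ?thesis
      by (simp add: assms(2)[OF k] distrib_right)
  qed
  \<comment> \<open>Symmetry of the jet exchanges the slot of the unchanged factor
    \<open>v k\<close> with the varied slot, which turns the \<open>r\<close> variations of the
    tails into variations of the first slot. For \<open>r = 0\<close> both sides vanish with the
    factor \<open>real r\<close>.\<close>
  have swap: "real r *\<^sub>R (\<Sum>k<n. \<Sum>l<n. \<eta> l * (v k * ?J (r - 1) (\<lambda>is. T (k # l # is))))
      = real r *\<^sub>R (\<Sum>l<n. \<eta> l * ?J r (?T l))"
  proof (cases r)
    case (Suc r')
    have "?J r' (\<lambda>is. T (k # l # is)) = ?J r' (\<lambda>is. T (l # k # is))" if "k < n" "l < n" for k l
      by (intro jet_sum_cong arg_cong[where f = h] refl Suc.prems(2) that)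
    then show ?thesis
      unfolding Suc by (subst sum.swap) (simp add: sum_distrib_left)
  qed simp
  have "jet_sum n v' h' (Suc r) T = ?J (Suc r) T + (\<Sum>k<n. \<eta> k * ?J r (?T k))
     + real r *\<^sub>R (\<Sum>k<n. \<Sum>l<n. \<eta> l * (v k * ?J (r - 1) (\<lambda>is. T (k # l # is))))
     + (\<Sum>k<n. \<Sum>w\<in>W. c w * (v k * ?J r (?U k w)))"
    by (simp add: step sum.distrib scaleR_sum_right)
  also have "(\<Sum>k<n. \<Sum>w\<in>W. c w * (v k * ?J r (?U k w))) = (\<Sum>w\<in>W. c w * ?J (Suc r) (U w))"
    by (subst sum.swap) (simp add: sum_distrib_left)
  finally show ?case
    unfolding swap by (simp add: scaleR_add_left)
qed simp

lemma taylor_expand: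
  assumes "finite W"
    and v: "\<And>k. k < n \<Longrightarrow> v k \<in> filt total_degree 1" "\<And>k. k < n \<Longrightarrow> has_parity False (v k)"
    and ex: "\<And>k. k < n \<Longrightarrow> v' k = v k + \<eta> k"
      "\<And>k l. k < n \<Longrightarrow> l < n \<Longrightarrow> \<eta> k * \<eta> l = 0" "\<And>k w. k < n \<Longrightarrow> \<eta> k * c w = 0"
      "\<And>is. set is \<subseteq> {..<n} \<Longrightarrow> h' (T is) = h (T is) + (\<Sum>w\<in>W. c w * h (U w is))"
    and sym: "\<And>k l is js. k < n \<Longrightarrow> l < n \<Longrightarrow> set is \<subseteq> {..<n} \<Longrightarrow> set js \<subseteq> {..<n} \<Longrightarrow>
      T (js @ k # l # is) = T (js @ l # k # is)"
  shows "taylor n v' h' T = taylor n v h T + (\<Sum>k<n. \<eta> k * taylor n v h (\<lambda>is. T (k # is)))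
    + (\<Sum>w\<in>W. c w * taylor n v h (U w))"
proof -
  let ?J = "jet_sum n v h" and ?T = "\<lambda>k is. T (k # is)"
  have sym': "T (k # l # is) = T (l # k # is)" if "k < n" "l < n" "set is \<subseteq> {..<n}" for k l "is"
    using sym[of k l "is" "[]"] that by simp
  note lf = locally_finite_taylor[of n v, OF v(1)]
  \<comment> \<open>Since \<open>r / r!\<close> is \<open>1 / (r - 1)!\<close>, the varied series is
    the Taylor series shifted by one; at \<open>r = 0\<close> the truncated \<open>r - 1\<close> is
    harmless because its coefficient is zero.\<close>
  have shift: "formal_sum (\<lambda>r. (real r / fact r) *\<^sub>R ?J (r - 1) T') = taylor n v h T'"
    and shift_lf: "locally_finite (\<lambda>r. (real r / fact r) *\<^sub>R ?J (r - 1) T')" for T'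
  proof -
    have bij: "bij_betw Suc UNIV {r. r \<noteq> 0}"
      by (rule bij_betw_byWitness[of _ "\<lambda>r. r - 1"]) auto
    have 1: "(real r / fact r) *\<^sub>R ?J (r - 1) T' = 0" if "r \<notin> {r. r \<noteq> 0}" for r :: nat
      using that by simp
    have 2: "(1 / fact r) *\<^sub>R ?J r T' = (real (Suc r) / fact (Suc r)) *\<^sub>R ?J (Suc r - 1) T'" for r
      by (simp del: of_nat_Suc)
    show "formal_sum (\<lambda>r. (real r / fact r) *\<^sub>R ?J (r - 1) T') = taylor n v h T'"
      unfolding taylor_def
      by (rule formal_sum_reindex_partial[where h = Suc, OF bij]) (use 1 2 in auto)
    show "locally_finite (\<lambda>r. (real r / fact r) *\<^sub>R ?J (r - 1) T')"
      by (subst locally_finite_reindex_partial[where h = Suc and G = "\<lambda>r. (1 / fact r) *\<^sub>R ?J r T'", OF bij])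
        (use 1 2 lf in auto)
  qed
  have "(1 / fact r) *\<^sub>R jet_sum n v' h' r T = (1 / fact r) *\<^sub>R ?J r T
      + (\<Sum>k<n. \<eta> k * ((real r / fact r) *\<^sub>R ?J (r - 1) (?T k)))
      + (\<Sum>w\<in>W. c w * ((1 / fact r) *\<^sub>R ?J r (U w)))" for r
  proof -
    have "jet_sum n v' h' r T = ?J r T + real r *\<^sub>R (\<Sum>k<n. \<eta> k * ?J (r - 1) (?T k))
        + (\<Sum>w\<in>W. c w * ?J r (U w))"
      by (rule jet_sum_expand[where n = n and v = v and v' = v' and \<eta> = \<eta> and c = c and h = h and h' = h'
            and T = T and U = U and W = W, OF v(2) ex sym' sym])
    then show ?thesis
      by (simp add: scaleR_add_right scaleR_sum_right)
  qed
  then have "taylor n v' h' T = formal_sum (\<lambda>r. (1 / fact r) *\<^sub>R ?J r T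
      + (\<Sum>k<n. \<eta> k * ((real r / fact r) *\<^sub>R ?J (r - 1) (?T k)))
      + (\<Sum>w\<in>W. c w * ((1 / fact r) *\<^sub>R ?J r (U w))))"
    by (simp only: taylor_def)
  also have "\<dots> = taylor n v h T + (\<Sum>k<n. \<eta> k * formal_sum (\<lambda>r. (real r / fact r) *\<^sub>R ?J (r - 1) (?T k)))
      + (\<Sum>w\<in>W. c w * taylor n v h (U w))"
    unfolding taylor_def
    by (simp only: formal_sum_add locally_finite_add formal_sum_sum locally_finite_sum assms(1) finite_lessThan
        formal_sum_mult_left locally_finite_mult_left shift_lf lf)
  finally show ?thesis by (simp only: shift)
qed

section \<open>Ideal chains\<close>

text \<open>
  Two chains matter: the filtration by formal degree, which gives existence and uniqueness of the
  solution of the equation for \<open>y\<close>, and a closed version of the chain of ideals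
  \<open>\<epsilon>A + F\<^sub>N\<close>, which shows that the solution for \<open>g + \<epsilon>u\<close> differs from the one for \<open>g\<close> by
  elements of an ideal of square zero.
\<close>

locale ideal_chain =
  fixes P :: "nat \<Rightarrow> sfps set"
  assumes P_0 [simp]: "a \<in> P 0"
    and zero [simp]: "0 \<in> P N"
    and add: "a \<in> P N \<Longrightarrow> b \<in> P N \<Longrightarrow> a + b \<in> P N"
    and mult_left: "a \<in> P N \<Longrightarrow> c * a \<in> P N"
    and mult_right: "a \<in> P N \<Longrightarrow> a * c \<in> P N"
    and formal_sum_mono: "locally_finite F \<Longrightarrow> (\<And>m :: mono. F m \<in> P N) \<Longrightarrow> formal_sum F \<in> P N"
    and formal_sum_nat: "locally_finite H \<Longrightarrow> (\<And>r :: nat. H r \<in> P N) \<Longrightarrow> formal_sum H \<in> P N"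
    and mult_left_Suc: "f \<in> filt formal_degree 1 \<Longrightarrow> a \<in> P N \<Longrightarrow> f * a \<in> P (Suc N)"
    and mult_right_Suc: "f \<in> filt formal_degree 1 \<Longrightarrow> a \<in> P N \<Longrightarrow> a * f \<in> P (Suc N)"
begin

lemma scaleR: "a \<in> P N \<Longrightarrow> r *\<^sub>R a \<in> P N"
  using mult_left[of a N "r *\<^sub>R 1"] by simp

lemma sum_mem: "(\<And>i. i \<in> B \<Longrightarrow> F i \<in> P N) \<Longrightarrow> sum F B \<in> P N"
  by (induction B rule: infinite_finite_induct) (auto intro: add)

lemma mult_diff:
  assumes "a - a' \<in> P N" and "b - b' \<in> P N"
  shows "a * b - a' * b' \<in> P N"
proof -
  have "a * b - a' * b' = a * (b - b') + (a - a') * b'" by (simp add: algebra_simps)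
  then show ?thesis using assms by (simp add: add mult_left mult_right)
qed

text \<open>The gain of one degree starts here: in \<open>a * (b - b') + (a - a') * b'\<close> the
  small factor \<open>b'\<close> lifts the cruder difference \<open>a - a'\<close> by one
  step.\<close>

lemma mult_diff_Suc:
  assumes "a - a' \<in> P N" and "b' \<in> filt formal_degree 1" and "b - b' \<in> P (Suc N)"
  shows "a * b - a' * b' \<in> P (Suc N)" "b * a - b' * a' \<in> P (Suc N)"
proof -
  have "a * b - a' * b' = a * (b - b') + (a - a') * b'" by (simp add: algebra_simps)
  then show "a * b - a' * b' \<in> P (Suc N)" using assms by (simp add: add mult_left mult_right_Suc)
  have "b * a - b' * a' = (b - b') * a + b' * (a - a')" by (simp add: algebra_simps)
  then show "b * a - b' * a' \<in> P (Suc N)" using assms by (simp add: add mult_right mult_left_Suc)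
qed

lemma prod_list_diff:
  assumes "\<And>x. f x - g x \<in> P N"
  shows "prod_list (map f xs) - prod_list (map g xs) \<in> P N"
  by (induction xs) (simp_all add: mult_diff assms)

lemma prod_list_diff_Suc:
  assumes "\<And>x. f x - g x \<in> P N" and "x \<in> set xs" and "f x = g x" and "g x \<in> filt formal_degree 1"
  shows "prod_list (map f xs) - prod_list (map g xs) \<in> P (Suc N)"
  using assms(2)
proof (induction xs)
  case (Cons y xs)
  show ?case
  proof (cases "y = x")
    case True
    then show ?thesis
      using mult_diff_Suc(2)[OF prod_list_diff[of f g N xs, OF assms(1)] assms(4), of "f x"]
      by (simp add: assms(3))
  next
    case False
    then have x: "x \<in> set xs" using Cons.prems by simp
    have "prod_list (map g xs) \<in> filt formal_degree 1"
      by (rule prod_list_filt_1[where f = g, OF weight_formal_degree x assms(4)])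
    then show ?thesis
      using mult_diff_Suc(1)[OF assms(1)[of y], of "prod_list (map g xs)" "prod_list (map f xs)"] Cons.IH[OF x] by simp
  qed
qed simp

lemma gen_subst_diff:
  assumes "\<And>v. e v - e' v \<in> P N" and "\<And>w. d w - d' w \<in> P N"
  shows "gen_subst e d m - gen_subst e' d' m \<in> P N"
  unfolding gen_subst_def even_prod_def odd_prod_def by (intro mult_diff prod_list_diff assms)

text \<open>A monomial of positive formal degree contains \<open>Scale\<close> or a parameter. That
  factor has the same small value under both substitutions, so its own difference is zero and it
  improves the differences of all other factors.\<close>

lemma gen_subst_diff_Suc:
  assumes "\<And>v. e v - e' v \<in> P N" and "\<And>w. d w - d' w \<in> P N"
    and "e Scale = e' Scale" and "e' Scale \<in> filt formal_degree 1"
    and "\<And>k. d (Param k) = d' (Param k)" and "\<And>k. d' (Param k) \<in> filt formal_degree 1"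
    and "formal_degree m \<noteq> 0"
  shows "gen_subst e d m - gen_subst e' d' m \<in> P (Suc N)"
proof -
  from formal_degree_nonzero[OF assms(7)] show ?thesis
  proof
    assume s: "Scale \<in># fst m"
    then have "Scale \<in> set (sorted_list_of_multiset (fst m))" by simp
    then show ?thesis
      unfolding gen_subst_def even_prod_def odd_prod_def
      by (intro mult_diff_Suc(2) prod_list_diff prod_list_diff_Suc[where f = e and g = e', OF assms(1) _ assms(3,4)]
          prod_list_filt_1[where f = e', OF weight_formal_degree _ assms(4)] assms(2))
  next
    assume "\<exists>k. Param k |\<in>| snd m"
    then obtain k where "Param k \<in> set (sorted_list_of_fset (snd m))" by auto
    then show ?thesis
      unfolding gen_subst_def even_prod_def odd_prod_def
      by (intro mult_diff_Suc(1) prod_list_diff prod_list_diff_Suc[where f = d and g = d', OF assms(2) _ assms(5,6)]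
          prod_list_filt_1[where f = d', OF weight_formal_degree _ assms(6)] assms(1))
  qed
qed

lemma gen_hom_diff:
  assumes "admissible e d" "admissible e' d'" "tame a"
    and "\<And>v. e v - e' v \<in> P N" and "\<And>w. d w - d' w \<in> P N"
  shows "gen_hom e d a - gen_hom e' d' a \<in> P N"
proof -
  note lf = locally_finite_gen_hom[OF assms(1,3)] locally_finite_gen_hom[OF assms(2,3)]
  have "gen_hom e d a - gen_hom e' d' a = formal_sum (\<lambda>m. coeff a m *\<^sub>R (gen_subst e d m - gen_subst e' d' m))"
    unfolding gen_hom_def scaleR_diff_right by (rule formal_sum_diff[symmetric, OF lf])
  moreover have "locally_finite (\<lambda>m. coeff a m *\<^sub>R (gen_subst e d m - gen_subst e' d' m))"
    using locally_finite_add[OF lf(1) locally_finite_scaleR[OF lf(2), of "- 1"]] by (simp add: algebra_simps)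
  ultimately show ?thesis
    by (simp add: formal_sum_mono scaleR gen_subst_diff assms(4,5))
qed

lemma gen_hom_diff_Suc:
  assumes "admissible e d" "admissible e' d'" "tame a" "a \<in> filt formal_degree 1"
    and "\<And>v. e v - e' v \<in> P N" and "\<And>w. d w - d' w \<in> P N"
    and "e Scale = e' Scale" and "e' Scale \<in> filt formal_degree 1"
    and "\<And>k. d (Param k) = d' (Param k)" and "\<And>k. d' (Param k) \<in> filt formal_degree 1"
  shows "gen_hom e d a - gen_hom e' d' a \<in> P (Suc N)"
proof -
  note lf = locally_finite_gen_hom[OF assms(1,3)] locally_finite_gen_hom[OF assms(2,3)]
  have "gen_hom e d a - gen_hom e' d' a = formal_sum (\<lambda>m. coeff a m *\<^sub>R (gen_subst e d m - gen_subst e' d' m))"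
    unfolding gen_hom_def scaleR_diff_right by (rule formal_sum_diff[symmetric, OF lf])
  moreover have "locally_finite (\<lambda>m. coeff a m *\<^sub>R (gen_subst e d m - gen_subst e' d' m))"
    using locally_finite_add[OF lf(1) locally_finite_scaleR[OF lf(2), of "- 1"]] by (simp add: algebra_simps)
  moreover have "coeff a m *\<^sub>R (gen_subst e d m - gen_subst e' d' m) \<in> P (Suc N)" for m
  proof (cases "formal_degree m = 0")
    case True
    then have "coeff a m = 0" using assms(4) by (simp add: filt_def)
    then show ?thesis by simp
  qed (intro scaleR gen_subst_diff_Suc assms)
  ultimately show ?thesis by (simp add: formal_sum_mono)
qed

text \<open>The increments themselves may have formal degree 0 and agree only to order
  \<open>N\<close>; the missing degree comes from the substituted jet values. Smallness of the
  primed sums is therefore carried through the induction together with the difference.\<close>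

lemma taylor_diff_Suc:
  assumes v: "\<And>k. k < n \<Longrightarrow> v k \<in> filt total_degree 1" "\<And>k. k < n \<Longrightarrow> v' k \<in> filt total_degree 1"
    and "\<And>k. k < n \<Longrightarrow> v k - v' k \<in> P N"
    and "\<And>is. set is \<subseteq> {..<n} \<Longrightarrow> h (T is) - h' (T is) \<in> P (Suc N)"
    and "\<And>is. set is \<subseteq> {..<n} \<Longrightarrow> h' (T is) \<in> filt formal_degree 1"
  shows "taylor n v h T - taylor n v' h' T \<in> P (Suc N)"
proof -
  have J: "jet_sum n v' h' r T \<in> filt formal_degree 1 \<and>
      jet_sum n v h r T - jet_sum n v' h' r T \<in> P (Suc N)" for r
    using assms(4,5)
  proof (induction r arbitrary: T)
    case (Suc r)
    let ?J = "\<lambda>k. jet_sum n v h r (\<lambda>is. T (k # is))" and ?J' = "\<lambda>k. jet_sum n v' h' r (\<lambda>is. T (k # is))"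
    have IH: "?J' k \<in> filt formal_degree 1" "?J k - ?J' k \<in> P (Suc N)" if "k < n" for k
      using Suc.IH[of "\<lambda>is. T (k # is)"] Suc.prems that by simp_all
    have "jet_sum n v h (Suc r) T - jet_sum n v' h' (Suc r) T = (\<Sum>k<n. v k * ?J k - v' k * ?J' k)"
      by (simp add: sum_subtractf)
    moreover have "\<dots> \<in> P (Suc N)"
      by (intro sum_mem mult_diff_Suc(1) assms(3) IH) auto
    moreover have "jet_sum n v' h' (Suc r) T \<in> filt formal_degree 1"
      using IH(1) by (auto intro!: filt_sum filt_mult_left)
    ultimately show ?case by simp
  qed simp
  note lf = locally_finite_taylor[of n v "\<lambda>r. 1 / fact r" h T, OF v(1)]
    locally_finite_taylor[of n v' "\<lambda>r. 1 / fact r" h' T, OF v(2)]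
  have "taylor n v h T - taylor n v' h' T
      = formal_sum (\<lambda>r. (1 / fact r) *\<^sub>R (jet_sum n v h r T - jet_sum n v' h' r T))"
    unfolding taylor_def scaleR_diff_right by (rule formal_sum_diff[symmetric, OF lf])
  moreover have "locally_finite (\<lambda>r. (1 / fact r) *\<^sub>R (jet_sum n v h r T - jet_sum n v' h' r T))"
    using locally_finite_add[OF lf(1) locally_finite_scaleR[OF lf(2), of "- 1"]] by (simp add: algebra_simps)
  ultimately show ?thesis using J by (simp add: formal_sum_nat scaleR)
qed

end

lemma ideal_chain_filt: "ideal_chain (filt formal_degree)"
proof
  fix f a :: sfps and N assume "f \<in> filt formal_degree 1" "a \<in> filt formal_degree N"
  then show "f * a \<in> filt formal_degree (Suc N)" "a * f \<in> filt formal_degree (Suc N)"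
    using filt_mult[OF weight_formal_degree, of f 1 a N] filt_mult[OF weight_formal_degree, of a N f 1] by simp_all
qed (auto intro: filt_add filt_mult_left filt_mult_right filt_formal_sum)

text \<open>
  Up to closure this is \<open>\<epsilon>A + F\<^sub>N\<close>; describing it by annihilators makes it visibly closed under
  formal sums.
\<close>

definition eps_chain :: "sfps \<Rightarrow> nat \<Rightarrow> sfps set" where
  "eps_chain \<epsilon> N = {a. \<forall>t b. has_parity t b \<longrightarrow> \<epsilon> * b = 0 \<longrightarrow> a * b \<in> filt formal_degree N}"

lemma eps_chainD: "a \<in> eps_chain \<epsilon> N \<Longrightarrow> has_parity t b \<Longrightarrow> \<epsilon> * b = 0 \<Longrightarrow> a * b \<in> filt formal_degree N"
  by (auto simp: eps_chain_def)

lemma parity_split_mult: "a * b = a * parity_part False b + a * parity_part True b"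
  by (metis distrib_left parity_parts)

lemma eps_mult_parity_part:
  assumes "has_parity s \<epsilon>" and "\<epsilon> * b = 0"
  shows "\<epsilon> * (parity_part t c * b) = 0"
proof -
  have "\<epsilon> * parity_part t c = (if s \<and> t then - (parity_part t c * \<epsilon>) else parity_part t c * \<epsilon>)"
    by (rule supercommute[OF assms(1) has_parity_parity_part])
  then have "\<epsilon> * (parity_part t c * b) = (if s \<and> t then - (parity_part t c * (\<epsilon> * b)) else parity_part t c * (\<epsilon> * b))"
    by (simp add: mult.assoc[symmetric] split: if_splits)
  then show ?thesis by (simp add: assms(2))
qed

lemma ideal_chain_eps:
  assumes "has_parity s \<epsilon>"
  shows "ideal_chain (eps_chain \<epsilon>)"
proof
  fix a b c f :: sfps and N :: nat
  show "a \<in> eps_chain \<epsilon> 0" "0 \<in> eps_chain \<epsilon> N" by (simp_all add: eps_chain_def)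
  show "a + b \<in> eps_chain \<epsilon> N" if "a \<in> eps_chain \<epsilon> N" "b \<in> eps_chain \<epsilon> N"
    using that by (simp add: eps_chain_def distrib_right filt_add)
  show "c * a \<in> eps_chain \<epsilon> N" if "a \<in> eps_chain \<epsilon> N"
    using that by (simp add: eps_chain_def mult.assoc filt_mult_left)
  show "a * c \<in> eps_chain \<epsilon> N" if a: "a \<in> eps_chain \<epsilon> N"
    unfolding eps_chain_def mem_Collect_eq
  proof (intro allI impI)
    fix t b assume b: "has_parity t b" "\<epsilon> * b = 0"
    \<comment> \<open>Test elements have to be homogeneous, hence the splitting of \<open>c\<close>:
      each \<open>parity_part u c * b\<close> is again homogeneous and annihilated by
      \<epsilon>.\<close>
    have "a * (parity_part u c * b) \<in> filt formal_degree N" for u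
      by (rule eps_chainD[OF a has_parity_mult[OF has_parity_parity_part b(1)] eps_mult_parity_part[OF assms b(2)]])
    then show "a * c * b \<in> filt formal_degree N"
      by (simp add: parity_split_mult[of a c] distrib_right mult.assoc filt_add)
  qed
  show "f * a \<in> eps_chain \<epsilon> (Suc N)" if "f \<in> filt formal_degree 1" "a \<in> eps_chain \<epsilon> N"
    using that filt_mult[OF weight_formal_degree, of f 1 _ N] by (simp add: eps_chain_def mult.assoc)
  show "a * f \<in> eps_chain \<epsilon> (Suc N)" if f: "f \<in> filt formal_degree 1" and a: "a \<in> eps_chain \<epsilon> N"
    unfolding eps_chain_def mem_Collect_eq
  proof (intro allI impI)
    fix t b assume b: "has_parity t b" "\<epsilon> * b = 0"
    have "a * parity_part u f * b \<in> filt formal_degree (Suc N)" for u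
    proof -
      \<comment> \<open>Commuting the part of \<open>f\<close> past \<open>b\<close>, at most with a
        sign, separates the tested product \<open>a * b\<close> of order \<open>N\<close> from a
        factor of order one.\<close>
      have "a * b * parity_part u f \<in> filt formal_degree (N + 1)"
        by (intro filt_mult weight_formal_degree eps_chainD[OF a b] filt_parity_part f)
      moreover have "a * parity_part u f * b = (if u \<and> t then - (a * b * parity_part u f) else a * b * parity_part u f)"
        using supercommute[OF has_parity_parity_part[of u f] b(1)] by (simp add: mult.assoc)
      ultimately show ?thesis using filt_uminus[of "a * b * parity_part u f"] by auto
    qed
    then show "a * f * b \<in> filt formal_degree (Suc N)"
      by (simp add: parity_split_mult[of a f] distrib_right filt_add)
  qed
next
  \<comment> \<open>The same closure for two index types, because a locale assumption cannot be
    polymorphic in the index: \<open>gen_hom\<close> sums over monomials, \<open>taylor\<close> over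
    orders.\<close>
  fix F :: "mono \<Rightarrow> sfps" and N
  assume "locally_finite F" "\<And>m. F m \<in> eps_chain \<epsilon> N"
  then show "formal_sum F \<in> eps_chain \<epsilon> N"
    by (simp add: eps_chain_def formal_sum_mult_right[symmetric] filt_formal_sum)
next
  fix F :: "nat \<Rightarrow> sfps" and N
  assume "locally_finite F" "\<And>m. F m \<in> eps_chain \<epsilon> N"
  then show "formal_sum F \<in> eps_chain \<epsilon> N"
    by (simp add: eps_chain_def formal_sum_mult_right[symmetric] filt_formal_sum)
qed

lemma eps_chain_mult_eps:
  assumes "has_parity s \<epsilon>"
  shows "\<epsilon> * c \<in> eps_chain \<epsilon> N"
proof -
  have "\<epsilon> \<in> eps_chain \<epsilon> N" by (simp add: eps_chain_def)
  then show ?thesis by (rule ideal_chain.mult_right[OF ideal_chain_eps[OF assms]])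
qed

text \<open>A homogeneous double annihilator: the filtration has intersection zero, so membership of
  \<open>a\<close> means \<open>a * b = 0\<close> for all homogeneous \<open>b\<close> with
  \<open>\<epsilon> * b = 0\<close>.\<close>

definition eps_ideal :: "sfps \<Rightarrow> sfps set" where
  "eps_ideal \<epsilon> = (\<Inter>N. eps_chain \<epsilon> N)"

text \<open>Because \<open>\<epsilon> * \<epsilon> = 0\<close>, \<epsilon> is a test element for
  \<open>b\<close>, so \<open>b * \<epsilon>\<close> vanishes; then \<open>b\<close> commutes with
  \<epsilon> up to sign and is itself a test element for every \<open>a\<close> of the
  ideal.\<close>

lemma
  assumes "has_parity s \<epsilon>" and "\<epsilon> * \<epsilon> = 0" and "b \<in> eps_ideal \<epsilon>" and "has_parity t b"
  shows eps_mult_eps_ideal: "\<epsilon> * b = 0"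
    and eps_ideal_mult: "a \<in> eps_ideal \<epsilon> \<Longrightarrow> a * b = 0"
proof -
  have "b * \<epsilon> \<in> filt formal_degree N" for N
    using eps_chainD[of b \<epsilon> N s \<epsilon>] assms(1-3) by (simp add: eps_ideal_def)
  then have "b * \<epsilon> = 0" by (rule filt_formal_degree_Inter)
  then show *: "\<epsilon> * b = 0" using supercommute[OF assms(1,4)] by simp
  show "a * b = 0" if "a \<in> eps_ideal \<epsilon>"
    by (rule filt_formal_degree_Inter, rule eps_chainD[OF _ assms(4) *]) (use that in \<open>simp add: eps_ideal_def\<close>)
qed

section \<open>Symmetry of partial derivatives\<close>

text \<open>Clairaut's theorem by second differences: the mean value theorem applied in both orders
  writes the same \<open>\<Delta>\<close> as \<open>h * h\<close> times a value of \<open>E\<close>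
  and as \<open>h * h\<close> times a value of \<open>F\<close>, both taken close to the
  corner.\<close>

lemma mixed_derivatives_eq:
  fixes A B C E F :: "real \<Rightarrow> real \<Rightarrow> real"
  assumes W: "open W" "(a, b) \<in> W"
    and B: "\<And>s t. (s, t) \<in> W \<Longrightarrow> ((\<lambda>s. A s t) has_real_derivative B s t) (at s)"
    and C: "\<And>s t. (s, t) \<in> W \<Longrightarrow> ((\<lambda>t. A s t) has_real_derivative C s t) (at t)"
    and E: "\<And>s t. (s, t) \<in> W \<Longrightarrow> ((\<lambda>t. B s t) has_real_derivative E s t) (at t)"
    and F: "\<And>s t. (s, t) \<in> W \<Longrightarrow> ((\<lambda>s. C s t) has_real_derivative F s t) (at s)"
    and cont: "isCont (\<lambda>(s, t). E s t) (a, b)" "isCont (\<lambda>(s, t). F s t) (a, b)"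
  shows "E a b = F a b"
proof (rule ccontr)
  assume ne: "E a b \<noteq> F a b"
  \<comment> \<open>With half the distance as radius, the values of \<open>E\<close> and of
    \<open>F\<close> near the point cannot coincide.\<close>
  define \<delta> where "\<delta> = dist (E a b) (F a b) / 2"
  have \<delta>: "\<delta> > 0" using ne by (simp add: \<delta>_def)
  have "\<forall>\<^sub>F p in nhds (a, b). p \<in> W" using W by (rule eventually_nhds_in_open)
  moreover have "\<forall>\<^sub>F p in nhds (a, b). dist (case p of (s, t) \<Rightarrow> E s t) (E a b) < \<delta>"
    using tendstoD[OF cont(1)[unfolded isCont_def] \<delta>] \<delta>
    unfolding eventually_at_filter by (auto elim!: eventually_mono)
  moreover have "\<forall>\<^sub>F p in nhds (a, b). dist (case p of (s, t) \<Rightarrow> F s t) (F a b) < \<delta>"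
    using tendstoD[OF cont(2)[unfolded isCont_def] \<delta>] \<delta>
    unfolding eventually_at_filter by (auto elim!: eventually_mono)
  ultimately have "\<forall>\<^sub>F p in nhds (a, b). p \<in> W \<and> dist (case p of (s, t) \<Rightarrow> E s t) (E a b) < \<delta> \<and>
      dist (case p of (s, t) \<Rightarrow> F s t) (F a b) < \<delta>"
    by eventually_elim simp
  then obtain r where r: "r > 0" and near: "\<And>p. dist p (a, b) < r \<Longrightarrow> p \<in> W \<and>
      dist (case p of (s, t) \<Rightarrow> E s t) (E a b) < \<delta> \<and> dist (case p of (s, t) \<Rightarrow> F s t) (F a b) < \<delta>"
    unfolding eventually_nhds_metric by blast
  \<comment> \<open>With a third of \<open>r\<close>, every point of the square of side
    \<open>h\<close> is within \<open>2 * h < r\<close> of the corner, even for the sum of the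
    coordinate distances.\<close>
  define h where "h = r / 3"
  have h: "h > 0" using r by (simp add: h_def)
  have sq: "(s, t) \<in> W" "dist (E s t) (E a b) < \<delta>" "dist (F s t) (F a b) < \<delta>"
    if "a \<le> s" "s \<le> a + h" "b \<le> t" "t \<le> b + h" for s t
  proof -
    have "dist (s, t) (a, b) \<le> dist s a + dist t b"
      unfolding dist_Pair_Pair by (rule real_sqrt_le_mono[THEN order_trans, OF _ sqrt_add_le_add_sqrt[THEN order_trans]]) auto
    also have "\<dots> < r" using that r by (simp add: dist_real_def h_def)
    finally show "(s, t) \<in> W" "dist (E s t) (E a b) < \<delta>" "dist (F s t) (F a b) < \<delta>"
      using near by auto
  qed
  define \<Delta> where "\<Delta> = A (a + h) (b + h) - A (a + h) b - A a (b + h) + A a b"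
  have "\<exists>s t. a < s \<and> s < a + h \<and> b < t \<and> t < b + h \<and> \<Delta> = h * (h * E s t)"
  proof -
    have "\<exists>s. a < s \<and> s < a + h \<and> (A (a + h) (b + h) - A (a + h) b) - (A a (b + h) - A a b)
        = (a + h - a) * (B s (b + h) - B s b)"
      using h sq(1) by (intro MVT2) (auto intro!: derivative_eq_intros B)
    then obtain s where s: "a < s" "s < a + h" "\<Delta> = h * (B s (b + h) - B s b)"
      by (auto simp: \<Delta>_def)
    have "\<exists>t. b < t \<and> t < b + h \<and> B s (b + h) - B s b = (b + h - b) * E s t"
      using h sq(1) s by (intro MVT2) (auto intro!: E)
    then show ?thesis using s by auto
  qed
  then obtain s t where st: "a < s" "s < a + h" "b < t" "t < b + h" "\<Delta> = h * (h * E s t)" by blast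
  have "\<exists>s t. a < s \<and> s < a + h \<and> b < t \<and> t < b + h \<and> \<Delta> = h * (h * F s t)"
  proof -
    have "\<exists>t. b < t \<and> t < b + h \<and> (A (a + h) (b + h) - A a (b + h)) - (A (a + h) b - A a b)
        = (b + h - b) * (C (a + h) t - C a t)"
      using h sq(1) by (intro MVT2) (auto intro!: derivative_eq_intros C)
    then obtain t where t: "b < t" "t < b + h" "\<Delta> = h * (C (a + h) t - C a t)"
      by (auto simp: \<Delta>_def)
    have "\<exists>s. a < s \<and> s < a + h \<and> C (a + h) t - C a t = (a + h - a) * F s t"
      using h sq(1) t by (intro MVT2) (auto intro!: F)
    then show ?thesis using t by auto
  qed
  then obtain s' t' where st': "a < s'" "s' < a + h" "b < t'" "t' < b + h" "\<Delta> = h * (h * F s' t')" by blast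
  have "E s t = F s' t'" using st(5) st'(5) h by simp
  moreover have "dist (E s t) (E a b) < \<delta>" "dist (F s' t') (F a b) < \<delta>"
    by (rule sq(2), use st in auto) (rule sq(3), use st' in auto)
  ultimately show False unfolding \<delta>_def dist_real_def by argo
qed

lemma continuous_on_fun_upd2:
  "continuous_on UNIV (\<lambda>p :: real \<times> real. (x :: nat \<Rightarrow> real)(i := fst p, j := snd p))"
proof (intro continuous_on_coordinatewise_then_product)
  fix k
  show "continuous_on UNIV (\<lambda>p :: real \<times> real. (x(i := fst p, j := snd p)) k)"
    by (cases "k = j"; cases "k = i") (auto intro!: continuous_intros)
qed

lemma partials_zero: "partials is (\<lambda>z. 0) x = 0"
  by (induction "is" arbitrary: x) (simp_all add: partial_def)

text \<open>Openness is relative to sequences vanishing from index \<open>n\<close> on, so a point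
  of \<open>U\<close> can be moved inside \<open>U\<close> only in the directions below
  \<open>n\<close>.\<close>

locale body_open =
  fixes n :: nat and U :: "point set"
  assumes openin: "openin (top_of_set (body_space n)) U"
begin

lemma open_square:
  assumes "x \<in> U" "i < n" "j < n"
  shows "open {p :: real \<times> real. x(i := fst p, j := snd p) \<in> U}"
proof -
  obtain V where V: "open V" "U = body_space n \<inter> V"
    using openin by (auto simp: openin_open)
  have "x(i := s, j := t) \<in> body_space n" for s t
    using assms V by (auto simp: body_space_def)
  then have "{p :: real \<times> real. x(i := fst p, j := snd p) \<in> U} = (\<lambda>p. x(i := fst p, j := snd p)) -` V"
    using V(2) by auto
  then show ?thesis using open_vimage[OF V(1) continuous_on_fun_upd2] by simp
qed

lemma eventually_line:
  assumes "x \<in> U" "i < n"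
  shows "\<forall>\<^sub>F s in nhds (x i). x(i := s) \<in> U"
proof -
  \<comment> \<open>The diagonal of the square with both directions equal: the second update
    overwrites the first.\<close>
  have "open ((\<lambda>s. (s, s)) -` {p :: real \<times> real. x(i := fst p, i := snd p) \<in> U})" (is "open ?V")
    by (intro open_vimage open_square assms continuous_intros)
  then have "\<forall>\<^sub>F s in nhds (x i). s \<in> ?V"
    by (rule eventually_nhds_in_open) (use assms in simp)
  then show ?thesis by simp
qed

lemma partial_cong:
  assumes "\<And>z. z \<in> U \<Longrightarrow> f z = g z" and "x \<in> U" and "i < n"
  shows "partial i f x = partial i g x"
  unfolding partial_def
  by (rule deriv_cong_ev[OF eventually_mono[OF eventually_line]]) (use assms in auto)

lemma partials_cong:
  assumes "\<And>z. z \<in> U \<Longrightarrow> f z = g z" and "set is \<subseteq> {..<n}" and "x \<in> U"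
  shows "partials is f x = partials is g x"
  using assms(2,3) by (induction "is" arbitrary: x) (auto simp: assms(1) intro: partial_cong)

lemma smooth_onD:
  assumes "smooth_on n U h" and "set is \<subseteq> {..<n}"
  shows "continuous_on U (partials is h)"
    and "x \<in> U \<Longrightarrow> i < n \<Longrightarrow>
      ((\<lambda>s. partials is h (x(i := s))) has_real_derivative partials (i # is) h x) (at (x i))"
proof -
  have "is \<in> lists {..<n}" using assms(2) by (simp add: lists_eq_set)
  then have *: "continuous_on U (partials is h) \<and>
     (\<forall>x\<in>U. \<forall>i<n. (\<lambda>s. partials is h (x(i := s))) differentiable at (x i))"
    using assms(1) by (auto simp: smooth_on_def)
  then show "continuous_on U (partials is h)" by blast
  assume "x \<in> U" "i < n"
  then have "(\<lambda>s. partials is h (x(i := s))) differentiable at (x i)" using * by blast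
  then show "((\<lambda>s. partials is h (x(i := s))) has_real_derivative partials (i # is) h x) (at (x i))"
    by (simp add: partial_def DERIV_deriv_iff_real_differentiable)
qed

lemma
  assumes "finite B" and "\<And>j. j \<in> B \<Longrightarrow> smooth_on n U (h j)"
  shows partials_sum: "set is \<subseteq> {..<n} \<Longrightarrow> x \<in> U \<Longrightarrow>
      partials is (\<lambda>z. \<Sum>j\<in>B. c j * h j z) x = (\<Sum>j\<in>B. c j * partials is (h j) x)"
    and smooth_on_sum: "smooth_on n U (\<lambda>z. \<Sum>j\<in>B. c j * h j z)"
proof -
  let ?f = "\<lambda>z. \<Sum>j\<in>B. c j * h j z"
  have deriv: "((\<lambda>s. \<Sum>j\<in>B. c j * partials is (h j) (x(i := s))) has_real_derivative
      (\<Sum>j\<in>B. c j * partials (i # is) (h j) x)) (at (x i))"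
    if "set is \<subseteq> {..<n}" "x \<in> U" "i < n" for "is" x i
    by (intro DERIV_sum DERIV_cmult smooth_onD(2) assms that)
  \<comment> \<open>A derivative along a line depends only on values near the point, and nearby
    points of the line stay in \<open>U\<close>, where the formula is already known.\<close>
  have ev: "((\<lambda>s. partials is ?f (x(i := s))) has_real_derivative
      (\<Sum>j\<in>B. c j * partials (i # is) (h j) x)) (at (x i))"
    if "\<And>x. x \<in> U \<Longrightarrow> partials is ?f x = (\<Sum>j\<in>B. c j * partials is (h j) x)"
      "set is \<subseteq> {..<n}" "x \<in> U" "i < n" for "is" x i
  proof -
    have e: "\<forall>\<^sub>F s in nhds (x i). partials is ?f (x(i := s)) = (\<Sum>j\<in>B. c j * partials is (h j) (x(i := s)))"
      by (rule eventually_mono[OF eventually_line[OF that(3,4)]]) (rule that(1))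
    show ?thesis
      unfolding DERIV_cong_ev[OF refl e refl] by (intro deriv that(2-4))
  qed
  have partials: "partials is ?f x = (\<Sum>j\<in>B. c j * partials is (h j) x)"
    if "set is \<subseteq> {..<n}" "x \<in> U" for "is" x
    using that
  proof (induction "is" arbitrary: x)
    case (Cons i "is")
    have "((\<lambda>s. partials is ?f (x(i := s))) has_real_derivative
        (\<Sum>j\<in>B. c j * partials (i # is) (h j) x)) (at (x i))"
      by (rule ev) (use Cons in auto)
    then show ?case by (simp add: partial_def DERIV_imp_deriv)
  qed simp
  then show "set is \<subseteq> {..<n} \<Longrightarrow> x \<in> U \<Longrightarrow>
      partials is ?f x = (\<Sum>j\<in>B. c j * partials is (h j) x)" .
  show "smooth_on n U ?f"
    unfolding smooth_on_def
  proof (intro ballI allI impI conjI)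
    fix "is" assume "is \<in> lists {..<n}"
    then have is_n: "set is \<subseteq> {..<n}" by (simp add: lists_eq_set)
    have "continuous_on U (\<lambda>x. \<Sum>j\<in>B. c j * partials is (h j) x)"
      by (intro continuous_intros smooth_onD(1) assms is_n)
    then show "continuous_on U (partials is ?f)"
      by (rule continuous_on_eq) (simp add: partials is_n)
    fix x i assume "x \<in> U" "i < n"
    then have "((\<lambda>s. partials is ?f (x(i := s))) has_real_derivative
        (\<Sum>j\<in>B. c j * partials (i # is) (h j) x)) (at (x i))"
      using is_n by (intro ev partials) auto
    then show "(\<lambda>s. partials is ?f (x(i := s))) differentiable at (x i)"
      unfolding real_differentiable_def by (rule exI)
  qed
qed

lemma partials_append: "partials (is @ js) h = partials is (partials js h)"
  by (induction "is") simp_all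

text \<open>Restricting to the plane through \<open>x\<close> in the directions \<open>i\<close> and
  \<open>j\<close> reduces the claim to two real variables.\<close>

lemma partials_swap:
  assumes h: "smooth_on n U h" and x: "x \<in> U" and i: "i < n" and j: "j < n" and "is": "set is \<subseteq> {..<n}"
  shows "partials (i # j # is) h x = partials (j # i # is) h x"
proof (cases "i = j")
  case False
  let ?P = "\<lambda>s t. x(i := s, j := t)" and ?W = "{p :: real \<times> real. x(i := fst p, j := snd p) \<in> U}"
  let ?h = "\<lambda>ks s t. partials (ks @ is) h (?P s t)"
  have ks: "set (ks @ is) \<subseteq> {..<n}" if "set ks \<subseteq> {i, j}" for ks
    using that i j "is" by auto
  have di: "((\<lambda>s. ?h ks s t) has_real_derivative ?h (i # ks) s t) (at s)"
    if "(s, t) \<in> ?W" "set ks \<subseteq> {i, j}" for s t ks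
  proof -
    have "(?P s t)(i := s') = ?P s' t" for s' using False by (simp add: fun_upd_twist)
    then show ?thesis
      using smooth_onD(2)[OF h ks[OF that(2)], of "?P s t" i] that(1) i False by simp
  qed
  have dj: "((\<lambda>t. ?h ks s t) has_real_derivative ?h (j # ks) s t) (at t)"
    if "(s, t) \<in> ?W" "set ks \<subseteq> {i, j}" for s t ks
    using smooth_onD(2)[OF h ks[OF that(2)], of "?P s t" j] that(1) j by simp
  have W: "open ?W" "(x i, x j) \<in> ?W"
    using open_square[OF x i j] x by auto
  have cont: "isCont (\<lambda>(s, t). ?h ks s t) (x i, x j)" if "set ks \<subseteq> {i, j}" for ks
  proof -
    have "continuous_on ?W (\<lambda>p. partials (ks @ is) h (x(i := fst p, j := snd p)))"
      by (rule continuous_on_compose2[OF smooth_onD(1)[OF h ks[OF that]] continuous_on_subset[OF continuous_on_fun_upd2]]) auto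
    then show ?thesis
      using W by (simp add: continuous_on_eq_continuous_at case_prod_unfold)
  qed
  have "?h [j, i] (x i) (x j) = ?h [i, j] (x i) (x j)"
    by (rule mixed_derivatives_eq[OF W, where A = "?h []" and B = "?h [i]" and C = "?h [j]"])
      (rule di dj cont; simp)+
  then show ?thesis by simp
qed simp

lemma partials_swap_append:
  assumes "smooth_on n U h" "x \<in> U" "i < n" "j < n" "set is \<subseteq> {..<n}" "set js \<subseteq> {..<n}"
  shows "partials (js @ i # j # is) h x = partials (js @ j # i # is) h x"
  unfolding partials_append[of js]
  by (rule partials_cong[OF partials_swap]) (use assms in auto)

text \<open>Differentiating a superfunction first puts the new index at the end of the list, while
  jets and Taylor sums extend at the front.\<close>

lemma partials_snoc:
  assumes "smooth_on n U h" "x \<in> U" "i < n" "set is \<subseteq> {..<n}"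
  shows "partials (is @ [i]) h x = partials (i # is) h x"
  using assms(2,4)
proof (induction "is" arbitrary: x)
  case (Cons j "is")
  have "partials ((j # is) @ [i]) h x = partial j (partials (is @ [i]) h) x" by simp
  also have "\<dots> = partial j (partials (i # is) h) x"
    by (rule partial_cong[OF Cons.IH]) (use Cons.prems in auto)
  also have "\<dots> = partials (i # j # is) h x"
    using partials_swap[OF assms(1) Cons.prems(1), of j i "is"] Cons.prems assms(3) by simp
  finally show ?case .
qed simp

section \<open>Jets of superfunctions\<close>

lemma
  assumes "smooth_superfun_on n U f"
  shows smooth_superfun_on_mult_left: "smooth_superfun_on n U (\<lambda>z. a * f z)"
    and jet_mult_left: "set is \<subseteq> {..<n} \<Longrightarrow> x \<in> U \<Longrightarrow> jet (\<lambda>z. a * f z) x is = a * jet f x is"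
proof -
  \<comment> \<open>Each coefficient of the product is a finite linear combination of coefficients
    of \<open>b\<close> with constant weights, so linearity of partial derivatives suffices.\<close>
  have *: "coeff (a * b) m = (\<Sum>p \<in> {(k, l). mono_join k l = m}. (koszul (fst p) (snd p) * coeff a (fst p)) * coeff b (snd p))" for b m
    unfolding coeff_mult by (simp add: case_prod_unfold mult.assoc)
  have s: "smooth_on n U (\<lambda>z. coeff (f z) m)" for m using assms by (simp add: smooth_superfun_on_def)
  show "smooth_superfun_on n U (\<lambda>z. a * f z)"
    unfolding smooth_superfun_on_def * by (intro allI smooth_on_sum finite_splits s)
  show "jet (\<lambda>z. a * f z) x is = a * jet f x is" if "set is \<subseteq> {..<n}" "x \<in> U"
    by (rule sfps_eqI) (simp add: jet_def * partials_sum[OF finite_splits s that])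
qed

lemma
  assumes "smooth_superfun_on n U f" "smooth_superfun_on n U g"
  shows smooth_superfun_on_add: "smooth_superfun_on n U (\<lambda>z. f z + g z)"
    and jet_add: "set is \<subseteq> {..<n} \<Longrightarrow> x \<in> U \<Longrightarrow> jet (\<lambda>z. f z + g z) x is = jet f x is + jet g x is"
proof -
  have *: "coeff (f z + g z) m = (\<Sum>b\<in>UNIV. 1 * coeff (if b then f z else g z) m)" for m z
    by (simp add: UNIV_bool)
  have s: "smooth_on n U (\<lambda>z. coeff (if b then f z else g z) m)" for m b
    using assms by (cases b) (simp_all add: smooth_superfun_on_def)
  show "smooth_superfun_on n U (\<lambda>z. f z + g z)"
    unfolding smooth_superfun_on_def * by (intro allI smooth_on_sum finite s)
  show "jet (\<lambda>z. f z + g z) x is = jet f x is + jet g x is" if "set is \<subseteq> {..<n}" "x \<in> U"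
    by (rule sfps_eqI)
      (simp only: jet_def coeff_Sfps * partials_sum[OF finite s that], simp add: UNIV_bool jet_def)
qed

lemma jet_swap:
  assumes "smooth_superfun_on n U f" "x \<in> U" "i < n" "j < n" "set is \<subseteq> {..<n}" "set js \<subseteq> {..<n}"
  shows "jet f x (js @ i # j # is) = jet f x (js @ j # i # is)"
  using assms by (intro sfps_eqI) (simp add: jet_def smooth_superfun_on_def partials_swap_append)

lemma jet_coord_deriv_Ev:
  assumes "smooth_superfun_on n U f" "x \<in> U" "i < n" "set is \<subseteq> {..<n}"
  shows "jet (coord_deriv (Ev i) f) x is = jet f x (i # is)"
proof (rule sfps_eqI)
  fix m
  have "coeff (jet (coord_deriv (Ev i) f) x is) m = partials (is @ [i]) (\<lambda>z. coeff (f z) m) x"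
    by (simp add: jet_def coord_deriv_def partials_append)
  also have "\<dots> = coeff (jet f x (i # is)) m"
    using assms by (subst partials_snoc) (simp_all add: jet_def smooth_superfun_on_def)
  finally show "coeff (jet (coord_deriv (Ev i) f) x is) m = coeff (jet f x (i # is)) m" .
qed

lemma jet_coord_deriv_Od:
  assumes "smooth_superfun_on n U f" "x \<in> U" "set is \<subseteq> {..<n}"
  shows "jet (coord_deriv (Od j) f) x is = odd_deriv (OCoord j) (jet f x is)"
proof (rule sfps_eqI)
  fix m :: mono
  obtain A J where m: "m = (A, J)" by (rule prod.exhaust)
  let ?c = "if OCoord j |\<in>| J then 0 else (- 1) ^ card {w. w |\<in>| J \<and> w < OCoord j} :: real"
  let ?h = "\<lambda>_ z. coeff (f z) (A, finsert (OCoord j) J)"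
  have *: "coeff (coord_deriv (Od j) f z) m = (\<Sum>_\<in>{()}. ?c * ?h () z)" for z
    by (simp add: coord_deriv_def odd_deriv_def m)
  have s: "smooth_on n U (?h u)" for u :: unit using assms by (simp add: smooth_superfun_on_def)
  have "partials is (\<lambda>z. \<Sum>_\<in>{()}. ?c * ?h () z) x = (\<Sum>_\<in>{()}. ?c * partials is (?h ()) x)"
    by (rule partials_sum[of "{()}" ?h "is" x "\<lambda>_. ?c"]) (use s assms in auto)
  then show "coeff (jet (coord_deriv (Od j) f) x is) m = coeff (odd_deriv (OCoord j) (jet f x is)) m"
    unfolding jet_def coeff_Sfps * by (simp add: odd_deriv_def m jet_def)
qed

lemma coeff_jet_eq_0:
  assumes "\<And>z. z \<in> U \<Longrightarrow> coeff (f z) m = 0" and "set is \<subseteq> {..<n}" and "x \<in> U"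
  shows "coeff (jet f x is) m = 0"
  using partials_cong[of "\<lambda>z. coeff (f z) m" "\<lambda>z. 0" "is" x] assms by (simp add: jet_def partials_zero)

lemma jet_parity:
  assumes "\<And>z. z \<in> U \<Longrightarrow> has_parity s (f z)" and "set is \<subseteq> {..<n}" and "x \<in> U"
  shows "has_parity s (jet f x is)"
  using assms by (auto simp: has_parity_iff intro!: coeff_jet_eq_0)

lemma jet_involves_only:
  assumes "\<And>z. z \<in> U \<Longrightarrow> involves_only V W (f z)" and "set is \<subseteq> {..<n}" and "x \<in> U"
  shows "involves_only V W (jet f x is)"
proof -
  have "coeff (jet f x is) (A, J) = 0" if "\<not> (set_mset A \<subseteq> V \<and> fset J \<subseteq> W)" for A J
    by (rule coeff_jet_eq_0[OF _ assms(2,3)]) (metis assms(1) that involves_only_def)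
  then show ?thesis by (auto simp: involves_only_def)
qed

end

lemma jet_filt:
  assumes "\<And>z. f z \<in> filt w N"
  shows "jet f x is \<in> filt w N"
proof -
  have "(\<lambda>z. coeff (f z) m) = (\<lambda>z. 0)" if "w m < N" for m
    using assms that by (auto simp: filt_def)
  then show ?thesis by (simp add: filt_def jet_def partials_zero)
qed

section \<open>The equation for \<open>y\<close> at a point\<close>

lemma coeff_odd_gen_mult:
  "coeff (odd_gen v * b) (A, J) =
     (if v |\<in>| J then (- 1) ^ card {w. w |\<in>| J \<and> w < v} * coeff b (A, J |-| {|v|}) else 0)"
proof -
  let ?S = "{(k, l). mono_join k l = (A, J)}"
  \<comment> \<open>The complementary factor may lack \<open>v\<close> or contain it; in the second
    case the Koszul sign is zero.\<close>
  have *: "k = ({#}, {|v|}) \<and> (l = (A, J |-| {|v|}) \<or> v |\<in>| snd l)" if "mono_join k l = (A, J)" "coeff (odd_gen v) k \<noteq> 0" for k l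
  proof -
    have k: "k = ({#}, {|v|})" using that(2) by (auto simp: odd_gen_def split: if_splits)
    have "fst l = A" "J = finsert v (snd l)" using that(1) by (auto simp: k mono_join_def)
    then show ?thesis using k by (cases l) auto
  qed
  show ?thesis
  proof (cases "v |\<in>| J")
    case True
    let ?p = "(({#}, {|v|}), (A, J |-| {|v|}))"
    have J: "finsert v (J |-| {|v|}) = J" using True by auto
    then have p: "?p \<in> ?S" by (simp add: mono_join_def)
    have "coeff (odd_gen v * b) (A, J) = (\<Sum>(k, l)\<in>{?p}. koszul k l * (coeff (odd_gen v) k * coeff b l))"
      unfolding coeff_mult
    proof (rule sum.mono_neutral_right[OF finite_splits])
      show "{?p} \<subseteq> ?S" using p by (simp only: insert_subset empty_subsetI)
      show "\<forall>p\<in>?S - {?p}. (case p of (k, l) \<Rightarrow> koszul k l * (coeff (odd_gen v) k * coeff b l)) = 0"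
      proof
        fix p assume p: "p \<in> ?S - {?p}"
        obtain k l where kl: "p = (k, l)" by (rule prod.exhaust)
        show "(case p of (k, l) \<Rightarrow> koszul k l * (coeff (odd_gen v) k * coeff b l)) = 0"
        proof (cases "coeff (odd_gen v) k = 0")
          case False
          have "k = ({#}, {|v|}) \<and> (l = (A, J |-| {|v|}) \<or> v |\<in>| snd l)"
            by (rule *) (use p kl False in auto)
          moreover have "(k, l) \<noteq> ?p" using p kl by auto
          ultimately have "k = ({#}, {|v|})" "v |\<in>| snd l" by auto
          then have "snd k |\<inter>| snd l \<noteq> {||}" by auto
          then show ?thesis by (simp add: kl koszul_def)
        qed (simp add: kl)
      qed
    qed
    also have "\<dots> = koszul ({#}, {|v|}) (A, J |-| {|v|}) * coeff b (A, J |-| {|v|})"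
      by (simp add: odd_gen_def)
    also have "koszul ({#}, {|v|}) (A, J |-| {|v|}) = (- 1) ^ card {w. w |\<in>| J \<and> w < v}"
    proof -
      have "inversions {|v|} (J |-| {|v|}) = Pair v ` {w. w |\<in>| J \<and> w < v}"
        by (auto simp: inversions_def)
      then have "card (inversions {|v|} (J |-| {|v|})) = card {w. w |\<in>| J \<and> w < v}"
        by (simp add: card_image inj_on_def)
      moreover have "{|v|} |\<inter>| (J |-| {|v|}) = {||}" by auto
      ultimately show ?thesis by (simp add: koszul_def)
    qed
    finally show ?thesis using True by simp
  next
    case False
    have "koszul k l * (coeff (odd_gen v) k * coeff b l) = 0" if "mono_join k l = (A, J)" for k l
      using *[OF that] that False by (cases "coeff (odd_gen v) k = 0") (auto simp: mono_join_def)
    then have "coeff (odd_gen v * b) (A, J) = 0"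
      unfolding coeff_mult by (intro sum.neutral) auto
    then show ?thesis using False by simp
  qed
qed

lemma odd_deriv_add: "odd_deriv v (a + b) = odd_deriv v a + odd_deriv v b"
  by (rule sfps_eqI) (simp add: odd_deriv_def case_prod_unfold distrib_left)

lemma odd_deriv_not_involved: "involves_only V W a \<Longrightarrow> v \<notin> W \<Longrightarrow> odd_deriv v a = 0"
  by (rule sfps_eqI) (auto simp: odd_deriv_def involves_only_def case_prod_unfold)

lemma odd_deriv_odd_gen_mult:
  assumes "involves_only V W b" "v \<notin> W"
  shows "odd_deriv v (odd_gen v * b) = b"
proof (rule sfps_eqI)
  fix m :: mono
  obtain A J where m: "m = (A, J)" by (rule prod.exhaust)
  show "coeff (odd_deriv v (odd_gen v * b)) m = coeff b m"
  proof (cases "v |\<in>| J")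
    case True
    then have "coeff b (A, J) = 0" using assms unfolding involves_only_def by blast
    then show ?thesis using True by (simp add: odd_deriv_def m)
  next
    case False
    have "{w. w |\<in>| finsert v J \<and> w < v} = {w. w |\<in>| J \<and> w < v}" by auto
    moreover have "finsert v J |-| {|v|} = J" using False by auto
    ultimately have "coeff (odd_gen v * b) (A, finsert v J) = (- 1) ^ card {w. w |\<in>| J \<and> w < v} * coeff b (A, J)"
      unfolding coeff_odd_gen_mult by (simp only: finsertI1 if_True)
    then show ?thesis using False by (simp add: odd_deriv_def m)
  qed
qed

text \<open>Division with remainder by an odd generator; it reduces the graded product rule to
  commuting one generator past a factor.\<close>

lemma odd_deriv_decompose:
  obtains c where "a = odd_gen v * odd_deriv v a + c" "involves_only UNIV (- {v}) c"
proof
  let ?c = "Sfps (\<lambda>m. if v |\<in>| snd m then 0 else coeff a m)"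
  show "involves_only UNIV (- {v}) ?c" by (auto simp: involves_only_def split: if_splits)
  show "a = odd_gen v * odd_deriv v a + ?c"
  proof (rule sfps_eqI)
    fix m :: mono
    obtain A J where m: "m = (A, J)" by (rule prod.exhaust)
    have "{w. w |\<in>| J |-| {|v|} \<and> w < v} = {w. w |\<in>| J \<and> w < v}" by auto
    moreover have "finsert v (J |-| {|v|}) = J" if "v |\<in>| J" using that by auto
    ultimately have "coeff (odd_deriv v a) (A, J |-| {|v|}) = (- 1) ^ card {w. w |\<in>| J \<and> w < v} * coeff a (A, J)"
      if "v |\<in>| J" using that unfolding odd_deriv_def coeff_Sfps prod.case by (simp only:) simp
    then show "coeff a m = coeff (odd_gen v * odd_deriv v a + ?c) m"
      by (simp add: m coeff_odd_gen_mult)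
  qed
qed

lemma has_parity_odd_gen [simp]: "has_parity True (odd_gen v)"
  and has_parity_even_gen [simp]: "has_parity False (even_gen u)"
  by (auto simp: has_parity_def odd_gen_def even_gen_def fcard.rep_eq)

text \<open>A factor free of \<open>v\<close> acts as a constant, except that the generator has to
  pass it on its way to the front.\<close>

lemma odd_deriv_mult_left:
  assumes "has_parity s a" and "involves_only V W a" and "v \<notin> W"
  shows "odd_deriv v (a * b) = (if s then - a else a) * odd_deriv v b"
proof -
  let ?b = "odd_deriv v b"
  obtain c where c: "b = odd_gen v * ?b + c" "involves_only UNIV (- {v}) c"
    by (rule odd_deriv_decompose)
  have a: "involves_only UNIV (- {v}) a"
    by (rule involves_only_mono[OF assms(2)]) (use assms(3) in auto)
  have b': "involves_only UNIV (- {v}) ?b"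
    by (auto simp: involves_only_def odd_deriv_def split: if_splits)
  have "a * odd_gen v = (if s then - (odd_gen v * a) else odd_gen v * a)"
    using supercommute[OF assms(1) has_parity_odd_gen, of v] by simp
  then have "a * (odd_gen v * ?b) = odd_gen v * ((if s then - a else a) * ?b)"
    by (simp add: mult.assoc[symmetric] split: if_splits)
  then have "a * b = odd_gen v * ((if s then - a else a) * ?b) + a * c"
    by (subst c(1)) (simp add: distrib_left)
  moreover have "odd_deriv v (odd_gen v * ((if s then - a else a) * ?b)) = (if s then - a else a) * ?b"
    using involves_only_mult[OF a b'] involves_only_scaleR[OF involves_only_mult[OF a b'], of "- 1"]
    by (intro odd_deriv_odd_gen_mult[of UNIV "- {v}"]) auto
  moreover have "odd_deriv v (a * c) = 0"
    by (rule odd_deriv_not_involved[OF involves_only_mult[OF a c(2)]]) simp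
  ultimately show ?thesis by (simp only: odd_deriv_add add_0_right)
qed

lemma filt_odd_gen [simp]: "odd_gen v \<in> filt total_degree 1"
  and filt_even_gen [simp]: "even_gen u \<in> filt total_degree 1"
  and filt_Scale [simp]: "even_gen Scale \<in> filt formal_degree 1"
  and filt_Param [simp]: "odd_gen (Param k) \<in> filt formal_degree 1"
  by (auto simp: filt_def odd_gen_def even_gen_def total_degree_def formal_degree_def fcard.rep_eq)

lemma filt_odd_deriv:
  assumes "a \<in> filt formal_degree N" and "v \<notin> range Param"
  shows "odd_deriv v a \<in> filt formal_degree N"
proof -
  have "formal_degree (A, finsert v J) = formal_degree (A, J)" for A J
  proof -
    have "fset (finsert v J) \<inter> range Param = fset J \<inter> range Param" using assms(2) by auto
    then show ?thesis by (simp add: formal_degree_def)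
  qed
  then show ?thesis using assms(1) by (auto simp: filt_def odd_deriv_def)
qed

lemma filt_coord_deriv:
  assumes "\<And>z. f z \<in> filt formal_degree N"
  shows "coord_deriv k f z \<in> filt formal_degree N"
proof (cases k)
  case (Ev i)
  have "jet f z [i] \<in> filt formal_degree N" by (rule jet_filt[OF assms])
  then show ?thesis using Ev by (simp add: coord_deriv_def jet_def)
next
  case (Od j)
  then show ?thesis using filt_odd_deriv[OF assms] by (auto simp: coord_deriv_def)
qed

lemma gen_hom_filt:
  assumes "a \<in> filt formal_degree 1" "e Scale \<in> filt formal_degree 1" "\<And>k. d (Param k) \<in> filt formal_degree 1"
  shows "gen_hom e d a \<in> filt formal_degree 1"
  unfolding gen_hom_def
proof (intro filt_formal_sum)
  fix m
  show "coeff a m *\<^sub>R gen_subst e d m \<in> filt formal_degree 1"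
  proof (cases "formal_degree m = 0")
    case True
    then have "coeff a m = 0" using assms(1) by (simp add: filt_def)
    then show ?thesis by simp
  next
    case False
    from formal_degree_nonzero[OF this] show ?thesis
      using gen_subst_filt_even[OF weight_formal_degree, of Scale m e d]
        gen_subst_filt_odd[OF weight_formal_degree, of _ m d e] assms(2,3)
      by (auto intro: filt_scaleR)
  qed
qed

text \<open>The bound holds term by term and for arbitrary \<open>y\<close>, before anything is
  known about convergence or about the body of \<open>y\<close>.\<close>

lemma substitute_filt:
  assumes "\<And>z. f z \<in> filt formal_degree 1"
  shows "substitute n f y q \<in> filt formal_degree 1"
  unfolding substitute_def
proof (intro filt_formal_sum, clarify)
  fix "is" and A :: "evar multiset" and J :: "ovar fset"
  let ?m = "(A, J)"
  have e: "even_subst q Scale = even_gen Scale" and d: "odd_subst y q (Param k) = odd_gen (Param k)" for k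
    by (simp_all add: even_subst_def odd_subst_def)
  have "partials is (\<lambda>z. coeff (f z) ?m) (body n y) = coeff (jet f (body n y) is) ?m"
    by (simp add: jet_def)
  moreover have "coeff (jet f (body n y) is) ?m *\<^sub>R gen_subst (even_subst q) (odd_subst y q) ?m \<in> filt formal_degree 1"
  proof (cases "formal_degree ?m = 0")
    case True
    then have "coeff (jet f (body n y) is) ?m = 0" using jet_filt[OF assms] by (simp add: filt_def)
    then show ?thesis by simp
  next
    case False
    \<comment> \<open>A substituted monomial is \<open>gen_hom\<close> of that monomial, which makes
      the bound for series applicable.\<close>
    have "monomial ?m \<in> filt formal_degree 1"
      using False by (auto simp: filt_def monomial_def)
    then have "gen_hom (even_subst q) (odd_subst y q) (monomial ?m) \<in> filt formal_degree 1"
      by (rule gen_hom_filt) (simp_all only: e d filt_Scale filt_Param)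
    moreover have "gen_hom (even_subst q) (odd_subst y q) (monomial ?m) = gen_subst (even_subst q) (odd_subst y q) ?m"
      unfolding gen_hom_def by (subst formal_sum_finite[of "{?m}"]) (auto simp: monomial_def)
    ultimately show ?thesis by (simp add: filt_scaleR)
  qed
  ultimately have "(partials is (\<lambda>z. coeff (f z) ?m) (body n y)) *\<^sub>R gen_subst (even_subst q) (odd_subst y q) ?m \<in> filt formal_degree 1"
    by (simp only:)
  then have "(1 / fact (length is)) *\<^sub>R (p * ((partials is (\<lambda>z. coeff (f z) ?m) (body n y)) *\<^sub>R gen_subst (even_subst q) (odd_subst y q) ?m)) \<in> filt formal_degree 1" for p
    by (rule filt_scaleR[OF filt_mult_left[OF weight_formal_degree]])
  then show "(if is \<in> lists {..<n}
        then (partials is (\<lambda>z. coeff (f z) ?m) (body n y) / fact (length is)) *\<^sub>R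
          (prod_list (map (\<lambda>i. y (Ev i) - of_real (body n y i)) is) * mono_subst y q ?m)
        else 0) \<in> filt formal_degree 1"
    by (simp add: mono_subst_eq)
qed

section \<open>The data of the equation at a point\<close>

definition momentum_partial :: "coord \<Rightarrow> sfps \<Rightarrow> sfps" where
  "momentum_partial k a = (case k of Ev i \<Rightarrow> even_deriv (EMom i) a | Od j \<Rightarrow> odd_deriv (OMom j) a)"

definition coord_jet :: "coord \<Rightarrow> (nat list \<Rightarrow> sfps) \<Rightarrow> nat list \<Rightarrow> sfps" where
  "coord_jet k T is = (case k of Ev i \<Rightarrow> T (i # is) | Od j \<Rightarrow> odd_deriv (OCoord j) (T is))"

lemma coord_sign_mult: "coord_sign k * a = (if coord_parity k then - a else a)"
  by (simp add: coord_sign_def)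

lemma sum_coords: "(\<Sum>k\<in>coords n m. F k) = (\<Sum>i<n. F (Ev i)) + (\<Sum>j<m. F (Od j))"
proof -
  have "inj_on Ev X" "inj_on Od Y" for X Y by (auto simp: inj_on_def)
  then show ?thesis
    unfolding coords_def by (subst sum.union_disjoint) (auto simp: sum.reindex)
qed

text \<open>The constant term of \<open>\<epsilon> * \<epsilon>\<close> is the square of a real
  number, so \<epsilon> has no constant term; every other monomial in the parameters has positive
  formal degree.\<close>

lemma params_nilpotent_filt:
  assumes "involves_only {} (range Param) \<epsilon>" and "\<epsilon> * \<epsilon> = 0"
  shows "\<epsilon> \<in> filt formal_degree 1"
proof -
  let ?o = "({#}, {||}) :: mono"
  have "{(k, l). mono_join k l = ?o} = {(?o, ?o)}"
    by (auto simp: mono_join_def)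
  then have "coeff (\<epsilon> * \<epsilon>) ?o = coeff \<epsilon> ?o * coeff \<epsilon> ?o"
    by (simp add: coeff_mult)
  then have 0: "coeff \<epsilon> ?o = 0" using assms(2) by simp
  have "coeff \<epsilon> (A, J) = 0" if "formal_degree (A, J) = 0" for A J
  proof (rule ccontr)
    assume nz: "coeff \<epsilon> (A, J) \<noteq> 0"
    then have "set_mset A \<subseteq> {}" "fset J \<subseteq> range Param" using assms(1) unfolding involves_only_def by blast+
    moreover have "fset J \<inter> range Param = {}" using that by (simp add: formal_degree_def)
    ultimately have "A = {#}" "fset J = {}" by auto
    then have "(A, J) = ?o" by (metis bot_fset.rep_eq fset_inject)
    then show False using 0 nz by simp
  qed
  then show ?thesis by (auto simp: filt_def)
qed

text \<open>All increments are zero, so only the empty multi-index survives.\<close>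

lemma substitute_at_point:
  assumes "x \<in> body_space n"
  shows "substitute n f (\<lambda>l. coord_fun l x) q = gen_hom (even_subst q) (odd_subst (\<lambda>l. coord_fun l x) q) (f x)"
proof -
  let ?y = "\<lambda>l. coord_fun l x"
  have body: "body n ?y = x"
  proof
    fix i show "body n ?y i = x i"
      using assms by (simp add: body_def coord_fun_def const_term_def of_real_def body_space_def)
  qed
  let ?F = "\<lambda>(is, m). if is \<in> lists {..<n}
     then (partials is (\<lambda>z. coeff (f z) m) x / fact (length is)) *\<^sub>R
          (prod_list (map (\<lambda>i. ?y (Ev i) - of_real (x i)) is) * mono_subst ?y q m) else 0"
  have bij: "bij_betw (Pair []) (UNIV :: mono set) ({[] :: nat list} \<times> UNIV)"
    by (rule bij_betw_byWitness[of _ snd]) auto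
  have "?F p = 0" if "p \<notin> {[]} \<times> UNIV" for p
  proof -
    obtain js m where p: "p = (js, m)" by (rule prod.exhaust)
    then obtain i "is" where "js = i # is" using \<open>p \<notin> {[]} \<times> UNIV\<close> by (cases js) auto
    then show ?thesis by (simp add: p coord_fun_def)
  qed
  then have "formal_sum ?F = formal_sum (\<lambda>m. ?F ([], m))"
    by (rule formal_sum_reindex_partial[where h = "Pair []", OF bij]) auto
  then show ?thesis
    unfolding substitute_def body gen_hom_def by (simp add: mono_subst_eq)
qed

text \<open>\<open>S\<close> stands for the value at \<open>x\<close> of the local generating
  function and \<open>U\<close> for the coordinate range of the target chart, with \<open>n\<close>
  and \<open>m\<close> the dimensions of the target; \<open>base\<close> says that the body of the
  image of \<open>x\<close> under the underlying map lies in that range.\<close>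

locale local_relation = body_open n U for n U +
  fixes m m\<^sub>1 :: nat and x :: point and S :: sfps
  assumes S_involves: "involves_only (EMom ` {..<n}) (OCoord ` {..<m\<^sub>1} \<union> OMom ` {..<m}) S"
    and S_parity: "has_parity False S"
    and base: "body n (\<lambda>k. coord_sign k * gen_hom (even_subst (\<lambda>_. 0))
      (odd_subst (\<lambda>l. coord_fun l x) (\<lambda>_. 0)) (momentum_partial k S)) \<in> U"
begin

abbreviation "K \<equiv> coords n m"

definition momenta_subst :: "(coord \<Rightarrow> sfps) \<Rightarrow> sfps \<Rightarrow> sfps" where
  "momenta_subst q = gen_hom (even_subst q) (odd_subst (\<lambda>l. coord_fun l x) q)"

text \<open>The right-hand side of the equation as a function of the momenta; a solution is a fixed
  point of \<open>step\<close> composed with \<open>mom G\<close>. The value 0 outside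
  \<open>K\<close> agrees with the normalisation in \<open>phi\<close>.\<close>

definition step :: "(coord \<Rightarrow> sfps) \<Rightarrow> coord \<Rightarrow> sfps" where
  "step q k = (if k \<in> K then coord_sign k * momenta_subst q (momentum_partial k S) else 0)"

definition mom :: "superfun \<Rightarrow> (coord \<Rightarrow> sfps) \<Rightarrow> coord \<Rightarrow> sfps" where
  "mom G y k = (if k \<in> K then substitute_coords n (coord_deriv k G) y else 0)"

definition value_at :: "superfun \<Rightarrow> (coord \<Rightarrow> sfps) \<Rightarrow> sfps" where
  "value_at G y = substitute_coords n G y + momenta_subst (mom G y) S - (\<Sum>k\<in>K. y k * mom G y k)"

abbreviation \<phi> :: "coord \<Rightarrow> sfps" where "\<phi> \<equiv> step (\<lambda>_. 0)"

text \<open>Such \<open>y\<close> all have the body \<open>x\<^sub>0\<close>, so every Taylor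
  expansion in the argument is taken at the same point.\<close>

definition near :: "(coord \<Rightarrow> sfps) \<Rightarrow> bool" where
  "near y \<longleftrightarrow> (\<forall>k. y k - \<phi> k \<in> filt formal_degree 1) \<and> (\<forall>k. k \<notin> K \<longrightarrow> y k = 0)"

definition par :: "(coord \<Rightarrow> sfps) \<Rightarrow> bool" where
  "par y \<longleftrightarrow> (\<forall>k. has_parity (coord_parity k) (y k))"

definition x\<^sub>0 :: point where "x\<^sub>0 = body n \<phi>"

abbreviation "incr y \<equiv> \<lambda>i. y (Ev i) - of_real (x\<^sub>0 i)"

abbreviation "coords_subst y \<equiv> gen_hom (even_subst (\<lambda>_. 0)) (odd_subst y (\<lambda>_. 0))"

definition regular :: "superfun \<Rightarrow> bool" where
  "regular f \<longleftrightarrow> smooth_superfun_on n U f \<and>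
     (\<forall>z\<in>U. involves_only {Scale} (OCoord ` {..<m} \<union> range Param) (f z))"

text \<open>Smallness is demanded at all points, not only on \<open>U\<close>: a solution is known
  to have its body in \<open>U\<close> only after its momenta are known to be small.\<close>

definition formal_fun :: "superfun \<Rightarrow> bool" where
  "formal_fun G \<longleftrightarrow> regular G \<and> (\<forall>z. G z \<in> filt formal_degree 1) \<and> (\<forall>z\<in>U. has_parity False (G z))"

lemma parity_coords: "coord_parity (Ev i) = False" "coord_parity (Od j) = True"
  by (simp_all add: coord_parity_def)

lemma K_iff: "Ev i \<in> K \<longleftrightarrow> i < n" "Od j \<in> K \<longleftrightarrow> j < m"
  by (auto simp: coords_def)

lemma x\<^sub>0_in_U: "x\<^sub>0 \<in> U"
proof -
  have "x\<^sub>0 = body n (\<lambda>k. coord_sign k * gen_hom (even_subst (\<lambda>_. 0))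
      (odd_subst (\<lambda>l. coord_fun l x) (\<lambda>_. 0)) (momentum_partial k S))"
    by (rule ext) (simp add: x\<^sub>0_def body_def step_def momenta_subst_def K_iff)
  then show ?thesis using base by simp
qed

lemma tame_S: "tame S"
proof -
  have "involves_only (EMom ` {..<n}) ((OCoord ` {..<m\<^sub>1} \<union> OMom ` {..<m}) \<union> range Param) S"
    by (rule involves_only_mono[OF S_involves]) auto
  then show ?thesis unfolding tame_def by (meson finite_UnI finite_imageI finite_lessThan)
qed

lemma S_partial:
  "involves_only (EMom ` {..<n}) (OCoord ` {..<m\<^sub>1} \<union> OMom ` {..<m}) (momentum_partial k S)"
  "tame (momentum_partial k S)" "has_parity (coord_parity k) (momentum_partial k S)"
  using involves_only_even_deriv[OF S_involves] involves_only_odd_deriv[OF S_involves]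
    tame_even_deriv[OF tame_S] tame_odd_deriv[OF tame_S]
    has_parity_even_deriv[OF S_parity] has_parity_odd_deriv[OF S_parity]
  by (simp_all add: momentum_partial_def parity_coords split: coord.split)

lemma admissible_momenta:
  "(\<And>k. q k \<in> filt total_degree 1) \<Longrightarrow> admissible (even_subst q) (odd_subst (\<lambda>l. coord_fun l x) q)"
  unfolding admissible_def
  by (auto simp del: One_nat_def simp: even_subst_def odd_subst_def coord_fun_def split: evar.split ovar.split)

lemma parity_subst_momenta: "par q \<Longrightarrow> parity_subst (even_subst q) (odd_subst (\<lambda>l. coord_fun l x) q)"
  unfolding parity_subst_def par_def
  by (auto simp: even_subst_def odd_subst_def coord_fun_def split: evar.split ovar.split)
    (metis parity_coords)+

lemma momenta_subst_cong:
  assumes "\<And>k. k \<in> K \<Longrightarrow> q k = q' k"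
  shows "momenta_subst q S = momenta_subst q' S"
    and "momenta_subst q (momentum_partial k S) = momenta_subst q' (momentum_partial k S)"
  unfolding momenta_subst_def
  by (rule gen_hom_cong[OF S_involves] gen_hom_cong[OF S_partial(1)];
      auto simp: even_subst_def odd_subst_def assms K_iff)+

lemma coord_sign_parity: "has_parity s a \<Longrightarrow> has_parity s (coord_sign k * a)"
  by (simp add: coord_sign_mult has_parity_uminus)

lemma par_step: "par q \<Longrightarrow> par (step q)"
  unfolding par_def step_def momenta_subst_def
  using gen_hom_parity[OF parity_subst_momenta S_partial(3)]
  by (auto simp: par_def intro: coord_sign_parity)

lemma par_0: "par (\<lambda>_. 0)"
  by (simp add: par_def)

text \<open>The series \<open>S\<close> has formal degree 0, so the order of a difference is kept
  but not raised; the contraction comes from \<open>mom_diff\<close>.\<close>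

lemma step_diff:
  assumes "ideal_chain P" and "\<And>k. q k \<in> filt total_degree 1" "\<And>k. q' k \<in> filt total_degree 1"
    and "\<And>k. q k - q' k \<in> P N"
  shows "step q k - step q' k \<in> P N"
proof -
  interpret ideal_chain P by (rule assms(1))
  have "momenta_subst q (momentum_partial k S) - momenta_subst q' (momentum_partial k S) \<in> P N"
    unfolding momenta_subst_def
    by (intro gen_hom_diff admissible_momenta assms(2,3) S_partial(2))
      (auto simp: even_subst_def odd_subst_def assms(4) split: evar.split ovar.split)
  then show ?thesis
    by (auto simp: step_def right_diff_distrib[symmetric] intro: mult_left)
qed

lemma near_step:
  assumes "\<And>k. q k \<in> filt formal_degree 1"
  shows "near (step q)"
  unfolding near_def
proof (intro conjI allI impI)
  fix k
  show "step q k - \<phi> k \<in> filt formal_degree 1"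
    by (rule step_diff[OF ideal_chain_filt]) (use assms in \<open>auto simp del: One_nat_def intro: filt_formal_degree_total_degree\<close>)
qed (simp add: step_def)

lemma const_term_near:
  assumes "near y"
  shows "const_term (y k) = const_term (\<phi> k)"
proof -
  have "y k - \<phi> k \<in> filt total_degree 1"
    using assms filt_formal_degree_total_degree by (simp add: near_def)
  then have "const_term (y k - \<phi> k) = 0" by (simp only: const_term_eq_0_iff)
  then show ?thesis by (simp add: const_term_def)
qed

lemma body_near: "near y \<Longrightarrow> body n y = x\<^sub>0"
  by (rule ext) (simp add: x\<^sub>0_def body_def const_term_near)

lemma incr_filt: "near y \<Longrightarrow> i < n \<Longrightarrow> incr y i \<in> filt total_degree 1"
  unfolding const_term_eq_0_iff[symmetric]
  using const_term_near[of y "Ev i"] by (simp add: x\<^sub>0_def body_def const_term_def of_real_def)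

lemma incr_parity: "par y \<Longrightarrow> has_parity False (incr y i)"
proof -
  assume "par y"
  then have "has_parity False (y (Ev i))" by (metis par_def parity_coords(1))
  then show ?thesis by (simp add: has_parity_diff of_real_def has_parity_scaleR)
qed

lemma admissible_coords:
  assumes "near y"
  shows "admissible (even_subst (\<lambda>_. 0)) (odd_subst y (\<lambda>_. 0))"
proof -
  have "y (Od j) \<in> filt total_degree 1" for j
  proof -
    have "has_parity True (\<phi> (Od j))" using par_step[OF par_0] by (metis par_def parity_coords(2))
    then have "const_term (\<phi> (Od j)) = 0" by (simp add: has_parity_iff const_term_def fcard.rep_eq)
    then show ?thesis using const_term_near[OF assms] by (simp only: const_term_eq_0_iff[symmetric])
  qed
  then show ?thesis
    unfolding admissible_def
    by (auto simp del: One_nat_def simp: even_subst_def odd_subst_def split: evar.split ovar.split)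
qed

lemma parity_subst_coords: "par y \<Longrightarrow> parity_subst (even_subst (\<lambda>_. 0)) (odd_subst y (\<lambda>_. 0))"
  unfolding parity_subst_def par_def
  by (auto simp: even_subst_def odd_subst_def split: evar.split ovar.split) (metis parity_coords)+

lemma jet_regular:
  assumes "regular f" "set is \<subseteq> {..<n}"
  shows "tame (jet f x\<^sub>0 is)" and "k \<in> K \<Longrightarrow> tame (coord_jet k (jet f x\<^sub>0) is)"
proof -
  have "involves_only {Scale} (OCoord ` {..<m} \<union> range Param) (jet f x\<^sub>0 js)" if "set js \<subseteq> {..<n}" for js
    by (rule jet_involves_only[OF _ that x\<^sub>0_in_U]) (use assms(1) in \<open>auto simp: regular_def\<close>)
  then have t: "tame (jet f x\<^sub>0 js)" if "set js \<subseteq> {..<n}" for js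
    unfolding tame_def using that by (intro exI[of _ "{Scale}"] exI[of _ "OCoord ` {..<m}"]) simp
  then show "tame (jet f x\<^sub>0 is)" using assms(2) by blast
  show "tame (coord_jet k (jet f x\<^sub>0) is)" if "k \<in> K"
    using t assms(2) that by (cases k) (auto simp: coord_jet_def K_iff tame_odd_deriv)
qed

lemma substitute_near:
  assumes "near y" "regular f"
  shows "substitute_coords n f y = taylor n (incr y) (coords_subst y) (jet f x\<^sub>0)"
  using substitute_eq_taylor[OF admissible_coords[OF assms(1)], of n f] jet_regular(1)[OF assms(2)]
  by (simp add: body_near[OF assms(1)])

lemma jet_coord_deriv:
  assumes "regular f" "set is \<subseteq> {..<n}" "k \<in> K"
  shows "jet (coord_deriv k f) x\<^sub>0 is = coord_jet k (jet f x\<^sub>0) is"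
  using assms jet_coord_deriv_Ev[OF _ x\<^sub>0_in_U] jet_coord_deriv_Od[OF _ x\<^sub>0_in_U]
  by (cases k) (auto simp: coord_jet_def regular_def K_iff)

lemma mom_near:
  assumes "near y" "regular f" "k \<in> K"
  shows "mom f y k = taylor n (incr y) (coords_subst y) (coord_jet k (jet f x\<^sub>0))"
proof -
  have "tame (jet (coord_deriv k f) x\<^sub>0 is)" if "set is \<subseteq> {..<n}" for "is"
    using jet_regular(2)[OF assms(2) that assms(3)] jet_coord_deriv[OF assms(2) that assms(3)] by simp
  then have "substitute_coords n (coord_deriv k f) y = taylor n (incr y) (coords_subst y) (jet (coord_deriv k f) x\<^sub>0)"
    using substitute_eq_taylor[OF admissible_coords[OF assms(1)], of n "coord_deriv k f"]
    by (simp add: body_near[OF assms(1)])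
  also have "\<dots> = taylor n (incr y) (coords_subst y) (coord_jet k (jet f x\<^sub>0))"
    by (rule taylor_cong) (simp_all add: jet_coord_deriv assms(2,3))
  finally show ?thesis using assms(3) by (simp add: mom_def)
qed

lemma mom_filt:
  assumes "\<And>z. G z \<in> filt formal_degree 1"
  shows "mom G y k \<in> filt formal_degree 1"
  unfolding mom_def by (auto simp del: One_nat_def intro: substitute_filt filt_coord_deriv assms)

lemma mom_filt': "formal_fun G \<Longrightarrow> mom G y k \<in> filt formal_degree 1"
  "formal_fun G \<Longrightarrow> mom G y k \<in> filt total_degree 1"
  using mom_filt filt_formal_degree_total_degree by (auto simp: formal_fun_def)

lemma coord_jet_parity:
  assumes "regular f" "\<And>z. z \<in> U \<Longrightarrow> has_parity s (f z)" "k \<in> K" "set is \<subseteq> {..<n}"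
  shows "has_parity (s \<noteq> coord_parity k) (coord_jet k (jet f x\<^sub>0) is)"
proof -
  have "has_parity s (jet f x\<^sub>0 js)" if "set js \<subseteq> {..<n}" for js
    by (rule jet_parity[OF assms(2) that x\<^sub>0_in_U])
  then show ?thesis
    using assms(3,4) has_parity_odd_deriv[of s]
    by (cases k) (auto simp: coord_jet_def K_iff parity_coords)
qed

lemma mom_par:
  assumes "near y" "par y" "formal_fun G"
  shows "par (mom G y)"
  unfolding par_def
proof
  fix k
  show "has_parity (coord_parity k) (mom G y k)"
  proof (cases "k \<in> K")
    case True
    have reg: "regular G" using assms(3) by (simp add: formal_fun_def)
    have "has_parity (coord_parity k) (coords_subst y (coord_jet k (jet G x\<^sub>0) is))" if "set is \<subseteq> {..<n}" for "is"
      by (rule gen_hom_parity[OF parity_subst_coords[OF assms(2)]])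
        (use coord_jet_parity[OF reg _ True that, of False] assms(3) in \<open>auto simp: formal_fun_def\<close>)
    then show ?thesis
      unfolding mom_near[OF assms(1) reg True]
      by (intro taylor_parity incr_parity assms(2))
  qed (simp add: mom_def)
qed

lemma coord_jet_filt:
  assumes "\<And>z. G z \<in> filt formal_degree 1"
  shows "coord_jet k (jet G x\<^sub>0) is \<in> filt formal_degree 1"
proof (cases k)
  case (Od j)
  have "OCoord j \<notin> range Param" by auto
  then show ?thesis using Od filt_odd_deriv[OF jet_filt[of G, OF assms]] by (simp add: coord_jet_def)
qed (use jet_filt[of G, OF assms] in \<open>simp add: coord_jet_def\<close>)

text \<open>Every monomial in the jet of \<open>G\<close> carries \<open>Scale\<close> or a
  parameter, which the substitution of \<open>y\<close> does not touch; this factor supplies the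
  additional degree.\<close>

lemma mom_diff:
  assumes "ideal_chain P" "near y" "near y'" "formal_fun G" "\<And>k. y k - y' k \<in> P N"
  shows "mom G y k - mom G y' k \<in> P (Suc N)"
proof (cases "k \<in> K")
  case True
  interpret ideal_chain P by (rule assms(1))
  have reg: "regular G" and filt: "G z \<in> filt formal_degree 1" for z
    using assms(4) by (simp_all add: formal_fun_def)
  note cj = coord_jet_filt[of G k, OF filt]
  have e: "even_subst (\<lambda>_. 0) Scale = even_gen Scale"
    and d: "odd_subst z (\<lambda>_. 0) (Param i) = odd_gen (Param i)" for z i
    by (simp_all add: even_subst_def odd_subst_def)
  show ?thesis
    unfolding mom_near[OF assms(2) reg True] mom_near[OF assms(3) reg True]
  proof (rule taylor_diff_Suc)
    fix i assume "i < n"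
    then show "incr y i \<in> filt total_degree 1" "incr y' i \<in> filt total_degree 1"
      using incr_filt assms(2,3) by blast+
    show "incr y i - incr y' i \<in> P N" using assms(5)[of "Ev i"] by simp
  next
    fix "is" assume "is": "set is \<subseteq> {..<n}"
    show "coords_subst y' (coord_jet k (jet G x\<^sub>0) is) \<in> filt formal_degree 1"
      by (intro gen_hom_filt cj) (simp_all only: e d filt_Scale filt_Param)
    show "coords_subst y (coord_jet k (jet G x\<^sub>0) is) - coords_subst y' (coord_jet k (jet G x\<^sub>0) is) \<in> P (Suc N)"
    proof (intro gen_hom_diff_Suc admissible_coords assms(2,3) jet_regular(2) reg "is" True cj)
      fix w show "odd_subst y (\<lambda>_. 0) w - odd_subst y' (\<lambda>_. 0) w \<in> P N"
        using assms(5) by (simp add: odd_subst_def split: ovar.split)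
    qed (simp_all only: e d filt_Scale filt_Param diff_self zero)
  qed
next
  case False
  interpret ideal_chain P by (rule assms(1))
  show ?thesis using False by (simp add: mom_def)
qed

section \<open>Existence and uniqueness of the solution\<close>

lemma solution_near:
  assumes "formal_fun G" "\<And>k. y k = step (mom G y) k"
  shows "near y"
proof -
  have "y = step (mom G y)" by (rule ext) (rule assms(2))
  then show ?thesis using near_step[of "mom G y", OF mom_filt'(1)[OF assms(1)]] by metis
qed

lemma solution_unique:
  assumes "formal_fun G" "\<And>k. y k = step (mom G y) k" "\<And>k. y' k = step (mom G y') k"
  shows "y = y'"
proof -
  have "\<forall>k. y k - y' k \<in> filt formal_degree N" for N
  proof (induction N)
    case (Suc N)
    have "mom G y k - mom G y' k \<in> filt formal_degree (Suc N)" for k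
      by (rule mom_diff[OF ideal_chain_filt]) (use solution_near assms Suc in auto)
    then have "step (mom G y) k - step (mom G y') k \<in> filt formal_degree (Suc N)" for k
      by (intro step_diff[OF ideal_chain_filt] mom_filt' assms(1))
    then show ?case using assms(2,3) by metis
  qed simp
  then have "y k - y' k = 0" for k by (intro filt_formal_degree_Inter) blast
  then show ?thesis by auto
qed

lemma solution_exists:
  assumes "formal_fun G"
  obtains y where "\<And>k. y k = step (mom G y) k" "par y"
proof -
  let ?T = "\<lambda>y. step (mom G y)"
  define it where "it N = (?T ^^ N) \<phi>" for N
  have it_Suc: "it (Suc N) = ?T (it N)" for N by (simp add: it_def)
  have it: "near (it N)" "par (it N)" for N
  proof -
    have "near (it N) \<and> par (it N)"
    proof (induction N)
      case 0
      show ?case using near_step[of "\<lambda>_. 0"] par_step[OF par_0] by (simp add: it_def)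
    next
      case (Suc N)
      then show ?case
        unfolding it_Suc by (intro conjI near_step par_step mom_par mom_filt' assms) auto
    qed
    then show "near (it N)" "par (it N)" by blast+
  qed
  have T_diff: "?T y k - ?T y' k \<in> filt formal_degree (Suc N)"
    if "near y" "near y'" "\<And>k. y k - y' k \<in> filt formal_degree N" for y y' N k
    by (intro step_diff[OF ideal_chain_filt] mom_filt' assms mom_diff[OF ideal_chain_filt that(1,2)] that(3))
  have succ: "it (Suc N) k - it N k \<in> filt formal_degree N" for N k
  proof (induction N arbitrary: k)
    case (Suc N)
    show ?case unfolding it_Suc[of "Suc N"] it_Suc[of N]
      using T_diff[OF it(1) it(1) Suc] by (simp only: it_Suc)
  qed simp
  have later: "it (N + d) k - it N k \<in> filt formal_degree N" for N d k
  proof (induction d)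
    case (Suc d)
    have "it (Suc (N + d)) k - it (N + d) k \<in> filt formal_degree N"
      by (rule filt_mono[OF succ]) simp
    from filt_add[OF this Suc] show ?case by simp
  qed simp
  \<comment> \<open>Iterates \<open>N\<close> and \<open>N + 1\<close> agree below degree
    \<open>N\<close>, so the coefficient at \<open>m\<close> is final from iterate
    \<open>Suc (formal_degree m)\<close> on.\<close>
  define y where "y k = Sfps (\<lambda>m. coeff (it (Suc (formal_degree m)) k) m)" for k
  have y_it: "y k - it N k \<in> filt formal_degree N" for k N
    unfolding filt_def mem_Collect_eq
  proof (intro allI impI)
    fix m assume "formal_degree m < N"
    then obtain d where N: "N = Suc (formal_degree m) + d" using less_eq_Suc_le nat_le_iff_add by blast
    have "it N k - it (Suc (formal_degree m)) k \<in> filt formal_degree (Suc (formal_degree m))"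
      unfolding N by (rule later)
    then have "coeff (it N k - it (Suc (formal_degree m)) k) m = 0" by (simp add: filt_def)
    then show "coeff (y k - it N k) m = 0" by (simp add: y_def)
  qed
  have near_y: "near y"
    unfolding near_def
  proof (intro conjI allI impI)
    fix k
    have "it 1 k - \<phi> k \<in> filt formal_degree 1" using it(1)[of 1] by (simp add: near_def)
    from filt_add[OF y_it[of k 1] this] show "y k - \<phi> k \<in> filt formal_degree 1" by simp
    assume "k \<notin> K"
    then have "it N k = 0" for N using it(1) by (simp add: near_def)
    then show "y k = 0" by (intro sfps_eqI) (simp add: y_def)
  qed
  have "y k - ?T y k \<in> filt formal_degree N" for k N
  proof -
    have "y k - it (Suc N) k \<in> filt formal_degree (Suc N)" by (rule y_it)
    moreover have "?T y k - it (Suc N) k \<in> filt formal_degree (Suc N)"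
      unfolding it_Suc by (rule T_diff[OF near_y it(1) y_it])
    ultimately have "(y k - it (Suc N) k) - (?T y k - it (Suc N) k) \<in> filt formal_degree (Suc N)"
      by (rule filt_diff)
    then show ?thesis by (simp add: filt_mono[of _ _ "Suc N" N])
  qed
  then have "y k - ?T y k = 0" for k by (rule filt_formal_degree_Inter)
  then have "y k = ?T y k" for k by simp
  moreover have "par y"
    unfolding par_def has_parity_iff
    using it(2) by (auto simp: y_def par_def has_parity_iff)
  ultimately show thesis by (rule that)
qed


section \<open>First variation of the pullback\<close>

lemma momenta_subst_expand:
  assumes "par q" "par q'" and "\<And>k. q k \<in> filt total_degree 1"
    and "\<And>k. k \<notin> K \<Longrightarrow> q k = 0" "\<And>k. k \<notin> K \<Longrightarrow> q' k = 0"
    and "\<And>k l. (q' k - q k) * (q' l - q l) = 0"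
  shows "momenta_subst q' S = momenta_subst q S + (\<Sum>k\<in>K. (q' k - q k) * momenta_subst q (momentum_partial k S))"
proof -
  let ?h = "\<lambda>v. case v of Scale \<Rightarrow> 0 | EMom i \<Rightarrow> q' (Ev i) - q (Ev i)"
  let ?k = "\<lambda>w. case w of OMom j \<Rightarrow> q' (Od j) - q (Od j) | _ \<Rightarrow> 0"
  have out: "q' (Ev i) = 0" "q (Ev i) = 0" if "\<not> i < n" for i
    using assms(4,5)[of "Ev i"] that by (simp_all add: K_iff)
  have out': "q' (Od j) = 0" "q (Od j) = 0" if "\<not> j < m" for j
    using assms(4,5)[of "Od j"] that by (simp_all add: K_iff)
  have "momenta_subst q' S = momenta_subst q S
      + (\<Sum>v\<in>EMom ` {..<n}. ?h v * momenta_subst q (even_deriv v S))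
      + (\<Sum>w\<in>OMom ` {..<m}. ?k w * momenta_subst q (odd_deriv w S))"
    unfolding momenta_subst_def
  proof (rule gen_hom_expand)
    show "?h v = 0" if "v \<notin> EMom ` {..<n}" for v
    proof (cases v)
      case (EMom i)
      then have "\<not> i < n" using that by blast
      then show ?thesis using EMom by (simp add: out)
    qed simp_all
    show "?k w = 0" if "w \<notin> OMom ` {..<m}" for w
    proof (cases w)
      case (OMom j)
      then have "\<not> j < m" using that by blast
      then show ?thesis using OMom by (simp add: out')
    qed simp_all
  qed (use assms in \<open>auto simp: parity_subst_momenta admissible_momenta tame_S even_subst_def odd_subst_def
        simp del: One_nat_def split: evar.split ovar.split\<close>)
  also have "\<dots> = momenta_subst q S + (\<Sum>k\<in>K. (q' k - q k) * momenta_subst q (momentum_partial k S))"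
    unfolding sum_coords by (simp add: sum.reindex inj_on_def momentum_partial_def add.assoc)
  finally show ?thesis .
qed

text \<open>Odd increments enter through the substituted jet values and even ones through the Taylor
  variable; symmetric jets let both take the common form of a coordinate derivative.\<close>

lemma substitute_expand:
  assumes "near y" "near y'" "par y" "par y'" and f: "regular f"
    and sq: "\<And>k l. (y' k - y k) * (y' l - y l) = 0"
  shows "substitute_coords n f y' = substitute_coords n f y
    + (\<Sum>k\<in>K. (y' k - y k) * taylor n (incr y) (coords_subst y) (coord_jet k (jet f x\<^sub>0)))"
proof -
  let ?k = "\<lambda>w. case w of OCoord j \<Rightarrow> y' (Od j) - y (Od j) | _ \<Rightarrow> 0"
  have out: "y' (Od j) = 0" "y (Od j) = 0" if "\<not> j < m" for j
    using assms(1,2) that by (simp_all add: near_def K_iff)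
  have hom: "coords_subst y' (jet f x\<^sub>0 is) = coords_subst y (jet f x\<^sub>0 is)
      + (\<Sum>j<m. (y' (Od j) - y (Od j)) * coords_subst y (coord_jet (Od j) (jet f x\<^sub>0) is))"
    if "set is \<subseteq> {..<n}" for "is"
  proof -
    have "coords_subst y' (jet f x\<^sub>0 is) = coords_subst y (jet f x\<^sub>0 is)
        + (\<Sum>v\<in>{}. 0 * coords_subst y (even_deriv v (jet f x\<^sub>0 is)))
        + (\<Sum>w\<in>OCoord ` {..<m}. ?k w * coords_subst y (odd_deriv w (jet f x\<^sub>0 is)))"
    proof (rule gen_hom_expand)
      show "?k w = 0" if "w \<notin> OCoord ` {..<m}" for w
      proof (cases w)
        case (OCoord j)
        then have "\<not> j < m" using that by blast
        then show ?thesis using OCoord by (simp add: out)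
      qed simp_all
    qed (use assms that in \<open>auto simp: parity_subst_coords admissible_coords jet_regular(1) even_subst_def
          odd_subst_def split: evar.split ovar.split\<close>)
    then show ?thesis by (simp add: sum.reindex inj_on_def coord_jet_def)
  qed
  have "taylor n (incr y') (coords_subst y') (jet f x\<^sub>0) = taylor n (incr y) (coords_subst y) (jet f x\<^sub>0)
    + (\<Sum>i<n. (y' (Ev i) - y (Ev i)) * taylor n (incr y) (coords_subst y) (\<lambda>is. jet f x\<^sub>0 (i # is)))
    + (\<Sum>j<m. (y' (Od j) - y (Od j)) * taylor n (incr y) (coords_subst y) (coord_jet (Od j) (jet f x\<^sub>0)))"
  proof (rule taylor_expand)
    show "jet f x\<^sub>0 (js @ k # l # is) = jet f x\<^sub>0 (js @ l # k # is)"
      if "k < n" "l < n" "set is \<subseteq> {..<n}" "set js \<subseteq> {..<n}" for k l "is" js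
      using f x\<^sub>0_in_U that by (intro jet_swap) (auto simp: regular_def)
  qed (use assms(1,3) hom sq in \<open>auto simp del: One_nat_def intro: incr_filt incr_parity\<close>)
  then show ?thesis
    unfolding substitute_near[OF assms(1) f] substitute_near[OF assms(2) f] sum_coords
    by (simp add: coord_jet_def[abs_def] add.assoc)
qed

text \<open>The sign in the equation for \<open>y\<close> is exactly the one produced by moving
  \<open>b\<close> past a derivative of the same parity.\<close>

lemma step_at_solution:
  assumes "par q" "has_parity (coord_parity k) b" "k \<in> K"
  shows "b * momenta_subst q (momentum_partial k S) = step q k * b"
proof -
  have "has_parity (coord_parity k) (momenta_subst q (momentum_partial k S))"
    unfolding momenta_subst_def by (intro gen_hom_parity parity_subst_momenta assms(1) S_partial(3))
  from supercommute[OF assms(2) this] show ?thesis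
    using assms(3) by (simp add: step_def coord_sign_mult)
qed

theorem value_at_expand:
  assumes G: "formal_fun G" and u: "regular u" "\<And>z. z \<in> U \<Longrightarrow> has_parity s (u z)"
    and \<epsilon>: "involves_only {} (range Param) \<epsilon>" "has_parity s \<epsilon>" "\<epsilon> * \<epsilon> = 0"
    and G'_def: "G' = (\<lambda>z. G z + \<epsilon> * u z)"
    and y: "\<And>k. y k = step (mom G y) k" "par y"
    and y': "\<And>k. y' k = step (mom G' y') k" "par y'"
    and G': "formal_fun G'"
  shows "value_at G' y' = value_at G y + \<epsilon> * substitute_coords n u y"
proof -
  define \<sigma> where "\<sigma> k = (if s \<and> coord_parity k then - \<epsilon> else \<epsilon>)" for k
  have near: "near y" "near y'" using solution_near[OF G y(1)] solution_near[OF G' y'(1)] by blast+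
  have regG: "regular G" and regG': "regular G'" using G G' by (simp_all add: formal_fun_def)
  have tame_\<epsilon>: "tame \<epsilon>" by (rule tame_params[OF \<epsilon>(1)])
  have smooth: "smooth_superfun_on n U G" "smooth_superfun_on n U u"
    using regG u(1) by (simp_all add: regular_def)
  have jetG': "jet G' x\<^sub>0 is = jet G x\<^sub>0 is + \<epsilon> * jet u x\<^sub>0 is" if "set is \<subseteq> {..<n}" for "is"
    unfolding G'_def using that x\<^sub>0_in_U smooth
    by (simp add: jet_add jet_mult_left smooth_superfun_on_mult_left)
  \<comment> \<open>The sign \<open>c\<close> is the one an odd derivative acquires in passing an
    odd \<epsilon>.\<close>
  have hom_\<epsilon>: "coords_subst z (a + c * \<epsilon> * b) = coords_subst z a + c * \<epsilon> * coords_subst z b"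
    if "near z" "par z" "tame a" "tame b" "c = 1 \<or> c = - 1" for z a b c
  proof -
    have "coords_subst z (\<epsilon> * b) = \<epsilon> * coords_subst z b"
      using gen_hom_mult[OF admissible_coords[OF that(1)] parity_subst_coords[OF that(2)] tame_\<epsilon> that(4)]
        gen_hom_params[OF admissible_coords[OF that(1)] \<epsilon>(1)] by simp
    moreover have "coords_subst z (- (\<epsilon> * b)) = - coords_subst z (\<epsilon> * b)"
      using gen_hom_scaleR[OF admissible_coords[OF that(1)] tame_mult[OF tame_\<epsilon> that(4)], of "- 1"] by simp
    moreover have "tame (c * \<epsilon> * b)"
      using that(4,5) tame_mult[OF tame_\<epsilon> that(4)] tame_scaleR[of "\<epsilon> * b" "- 1"] by auto
    ultimately show ?thesis
      using gen_hom_add[OF admissible_coords[OF that(1)] that(3), of "c * \<epsilon> * b"] that(5) by auto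
  qed
  have sub_split: "substitute_coords n G' y' = substitute_coords n G y' + \<epsilon> * substitute_coords n u y'"
  proof -
    have "taylor n (incr y') (coords_subst y') (jet G' x\<^sub>0) = 1 * taylor n (incr y') (coords_subst y') (jet G x\<^sub>0)
        + \<epsilon> * taylor n (incr y') (coords_subst y') (jet u x\<^sub>0)"
      by (rule taylor_lincomb)
        (use near(2) y'(2) hom_\<epsilon>[OF near(2) y'(2), of _ _ 1] jetG' jet_regular(1) regG u(1) in
          \<open>auto simp del: One_nat_def intro: incr_filt incr_parity\<close>)
    then show ?thesis
      by (simp add: substitute_near[OF near(2)] regG regG' u(1))
  qed
  \<comment> \<open>At the same \<open>y'\<close> the two momenta differ by \<epsilon> times a
    derivative of \<open>u\<close> up to sign, which lies in the chain at every level.\<close>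
  have mom_split: "mom G' y' k - mom G y' k \<in> eps_chain \<epsilon> N" for k N
  proof (cases "k \<in> K")
    case True
    have cj: "coord_jet k (jet G' x\<^sub>0) is = coord_jet k (jet G x\<^sub>0) is
        + (if s \<and> coord_parity k then - 1 else 1) * \<epsilon> * coord_jet k (jet u x\<^sub>0) is"
      if "set is \<subseteq> {..<n}" for "is"
    proof (cases k)
      case (Ev i)
      then show ?thesis using jetG'[of "i # is"] that True by (simp add: coord_jet_def parity_coords K_iff)
    next
      case (Od j)
      have "odd_deriv (OCoord j) (\<epsilon> * jet u x\<^sub>0 is) = (if s then - \<epsilon> else \<epsilon>) * odd_deriv (OCoord j) (jet u x\<^sub>0 is)"
        by (rule odd_deriv_mult_left[OF \<epsilon>(2,1)]) auto
      then show ?thesis using Od jetG'[OF that] by (simp add: coord_jet_def odd_deriv_add parity_coords)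
    qed
    have "taylor n (incr y') (coords_subst y') (coord_jet k (jet G' x\<^sub>0))
        = 1 * taylor n (incr y') (coords_subst y') (coord_jet k (jet G x\<^sub>0))
        + (if s \<and> coord_parity k then - 1 else 1) * \<epsilon> * taylor n (incr y') (coords_subst y') (coord_jet k (jet u x\<^sub>0))"
    proof (rule taylor_lincomb)
      fix "is" assume is_n: "set is \<subseteq> {..<n}"
      show "coords_subst y' (coord_jet k (jet G' x\<^sub>0) is) = 1 * coords_subst y' (coord_jet k (jet G x\<^sub>0) is)
        + (if s \<and> coord_parity k then - 1 else 1) * \<epsilon> * coords_subst y' (coord_jet k (jet u x\<^sub>0) is)"
        unfolding cj[OF is_n] mult_1_left
        by (intro hom_\<epsilon> near(2) y'(2) jet_regular(2) regG u(1) is_n True) auto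
    qed (use near(2) y'(2) in \<open>auto simp del: One_nat_def intro: incr_filt incr_parity\<close>)
    then have "mom G' y' k - mom G y' k = \<epsilon> * ((if s \<and> coord_parity k then - 1 else 1) *
        taylor n (incr y') (coords_subst y') (coord_jet k (jet u x\<^sub>0)))"
      by (simp add: mom_near[OF near(2)] regG regG' True)
    then show ?thesis by (simp add: eps_chain_mult_eps[OF \<epsilon>(2)])
  next
    case False
    then show ?thesis by (simp add: mom_def eps_chain_def)
  qed
  interpret eps: ideal_chain "eps_chain \<epsilon>" by (rule ideal_chain_eps[OF \<epsilon>(2)])
  have mom_eps: "mom G' y' k - mom G y k \<in> eps_chain \<epsilon> (Suc N)" if "\<And>k. y' k - y k \<in> eps_chain \<epsilon> N" for k N
  proof -
    have "mom G y' k - mom G y k \<in> eps_chain \<epsilon> (Suc N)"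
      by (rule mom_diff[OF ideal_chain_eps[OF \<epsilon>(2)] near(2,1) G that])
    from eps.add[OF mom_split[of k] this] show ?thesis by simp
  qed
  \<comment> \<open>Level 0 is everything, and each passage through the equation raises the level by
    one: the explicit multiple of \<epsilon> is in all levels and the change of \<open>y\<close>
    gains a degree.\<close>
  have y_eps: "\<forall>k. y' k - y k \<in> eps_chain \<epsilon> N" for N
  proof (induction N)
    case (Suc N)
    have "step (mom G' y') k - step (mom G y) k \<in> eps_chain \<epsilon> (Suc N)" for k
      using Suc by (intro step_diff[OF ideal_chain_eps[OF \<epsilon>(2)]] mom_filt' G G' mom_eps) blast
    then show ?case using y(1) y'(1) by metis
  qed simp
  have \<delta>: "y' k - y k \<in> eps_ideal \<epsilon>" for k
    using y_eps by (simp add: eps_ideal_def)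
  have \<eta>: "mom G' y' k - mom G y k \<in> eps_ideal \<epsilon>" for k
  proof -
    have "mom G' y' k - mom G y k \<in> eps_chain \<epsilon> N" for N
    proof (cases N)
      case (Suc M)
      then show ?thesis using mom_eps y_eps by blast
    qed simp
    then show ?thesis by (simp add: eps_ideal_def)
  qed
  have par_q: "par (mom G y)" "par (mom G' y')"
    using mom_par near y(2) y'(2) G G' by blast+
  have \<delta>_par: "has_parity (coord_parity k) (y' k - y k)" for k
    using y(2) y'(2) by (simp add: par_def has_parity_diff)
  have \<eta>_par: "has_parity (coord_parity k) (mom G' y' k - mom G y k)" for k
    using par_q by (simp add: par_def has_parity_diff)
  note zero = eps_ideal_mult[OF \<epsilon>(2,3)]
  have \<delta>\<delta>: "(y' k - y k) * (y' l - y l) = 0" for k l by (rule zero[OF \<delta> \<delta>_par \<delta>])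
  have \<eta>\<eta>: "(mom G' y' k - mom G y k) * (mom G' y' l - mom G y l) = 0" for k l by (rule zero[OF \<eta> \<eta>_par \<eta>])
  have \<delta>\<eta>: "(y' k - y k) * (mom G' y' l - mom G y l) = 0" for k l by (rule zero[OF \<eta> \<eta>_par \<delta>])
  \<comment> \<open>\<epsilon> annihilates the displacement, so \<open>u\<close> may be evaluated at
    the unperturbed solution.\<close>
  have "\<epsilon> * (y' k - y k) = 0" for k by (rule eps_mult_eps_ideal[OF \<epsilon>(2,3) \<delta> \<delta>_par])
  then have "\<epsilon> * ((y' k - y k) * a) = 0" for k a by (simp add: mult.assoc[symmetric])
  then have u_eq: "\<epsilon> * substitute_coords n u y' = \<epsilon> * substitute_coords n u y"
    unfolding substitute_expand[OF near y(2) y'(2) u(1) \<delta>\<delta>]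
    by (simp add: distrib_left sum_distrib_left)
  have G_eq: "substitute_coords n G y' = substitute_coords n G y + (\<Sum>k\<in>K. (y' k - y k) * mom G y k)"
    unfolding substitute_expand[OF near y(2) y'(2) regG \<delta>\<delta>]
    by (simp add: mom_near[OF near(1) regG])
  have S_eq: "momenta_subst (mom G' y') S = momenta_subst (mom G y) S + (\<Sum>k\<in>K. y k * (mom G' y' k - mom G y k))"
  proof -
    \<comment> \<open>Here the equation is used: the derivative of \<open>S\<close> along the change
      of the momenta becomes \<open>y\<close> times that change.\<close>
    have "(mom G' y' k - mom G y k) * momenta_subst (mom G y) (momentum_partial k S) = y k * (mom G' y' k - mom G y k)"
      if "k \<in> K" for k
      unfolding step_at_solution[OF par_q(1) \<eta>_par that] using y(1) by metis
    moreover have "momenta_subst (mom G' y') S = momenta_subst (mom G y) S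
        + (\<Sum>k\<in>K. (mom G' y' k - mom G y k) * momenta_subst (mom G y) (momentum_partial k S))"
      by (rule momenta_subst_expand[OF par_q mom_filt'(2)[OF G] _ _ \<eta>\<eta>]) (simp_all add: mom_def)
    ultimately show ?thesis by simp
  qed
  \<comment> \<open>The product of the two increments vanishes, and the two remaining corrections
    are those of \<open>G_eq\<close> and \<open>S_eq\<close>, so they cancel in the value.\<close>
  have "y' k * mom G' y' k = y k * mom G y k + (y' k - y k) * mom G y k + y k * (mom G' y' k - mom G y k)" for k
    using \<delta>\<eta>[of k k] by (simp add: algebra_simps)
  then have "(\<Sum>k\<in>K. y' k * mom G' y' k) = (\<Sum>k\<in>K. y k * mom G y k)
      + (\<Sum>k\<in>K. (y' k - y k) * mom G y k) + (\<Sum>k\<in>K. y k * (mom G' y' k - mom G y k))"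
    by (simp add: sum.distrib)
  then show ?thesis
    unfolding value_at_def sub_split G_eq S_eq u_eq by simp
qed

lemma substitute_lincomb:
  assumes "near y" "par y" "regular f" "regular h"
  shows "substitute_coords n (\<lambda>z. r *\<^sub>R f z + s *\<^sub>R h z) y
    = r *\<^sub>R substitute_coords n f y + s *\<^sub>R substitute_coords n h y"
proof -
  let ?F = "\<lambda>z. r *\<^sub>R f z + s *\<^sub>R h z"
  have F: "?F = (\<lambda>z. (r *\<^sub>R 1) * f z + (s *\<^sub>R 1) * h z)" by simp
  have smooth: "smooth_superfun_on n U f" "smooth_superfun_on n U h"
    using assms(3,4) by (simp_all add: regular_def)
  have jet: "jet ?F x\<^sub>0 is = r *\<^sub>R jet f x\<^sub>0 is + s *\<^sub>R jet h x\<^sub>0 is" if "set is \<subseteq> {..<n}" for "is"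
    unfolding F
    by (simp only: jet_add jet_mult_left smooth_superfun_on_mult_left smooth that x\<^sub>0_in_U) simp
  have "regular ?F"
    unfolding regular_def
  proof (intro conjI ballI)
    show "smooth_superfun_on n U ?F"
      unfolding F by (intro smooth_superfun_on_add smooth_superfun_on_mult_left smooth)
    fix z assume "z \<in> U"
    then show "involves_only {Scale} (OCoord ` {..<m} \<union> range Param) (?F z)"
      using assms(3,4) by (auto simp: regular_def intro!: involves_only_add involves_only_scaleR)
  qed
  moreover have "taylor n (incr y) (coords_subst y) (jet ?F x\<^sub>0)
      = (r *\<^sub>R 1) * taylor n (incr y) (coords_subst y) (jet f x\<^sub>0)
      + (s *\<^sub>R 1) * taylor n (incr y) (coords_subst y) (jet h x\<^sub>0)"
  proof (rule taylor_lincomb)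
    fix "is" assume "is": "set is \<subseteq> {..<n}"
    note adm = admissible_coords[OF assms(1)]
    note tame = jet_regular(1)[OF assms(3) "is"] jet_regular(1)[OF assms(4) "is"]
    show "coords_subst y (jet ?F x\<^sub>0 is) = (r *\<^sub>R 1) * coords_subst y (jet f x\<^sub>0 is)
        + (s *\<^sub>R 1) * coords_subst y (jet h x\<^sub>0 is)"
      by (simp add: jet "is" gen_hom_add gen_hom_scaleR adm tame tame_scaleR)
  qed (use assms(1,2) in \<open>auto simp del: One_nat_def intro: incr_filt incr_parity\<close>)
  ultimately show ?thesis
    by (simp add: substitute_near[OF assms(1)] assms(3,4))
qed

end

section \<open>Generalized pullbacks\<close>

theorem theorem2:
  fixes M1 :: "('p::{t2_space, second_countable_topology}, 'c) supermanifold_data"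
    and M2 :: "('q::{t2_space, second_countable_topology}, 'd) supermanifold_data"
    and \<Phi> :: "('p, 'c, 'q, 'd) relation_data"
    and g :: "'d \<Rightarrow> superfun"
  assumes "supermanifold M1" and "supermanifold M2"
    and "canonical_relation M1 M2 \<Phi>"
    and "g \<in> smooth_functions_of_parity False M2"
  shows "has_tangent_map M1 M2 \<Phi> (formal_point g)
           (usual_pullback M2 (phi M1 M2 \<Phi> (formal_point g)))"
  unfolding has_tangent_map_def
proof (intro ballI)
  fix a b x assume a: "a \<in> charts M1" and b: "b \<in> charts M2"
    and "x \<in> chart_map M1 a ` overlap M1 M2 \<Phi> a b"
  then obtain p where p: "p \<in> chart_dom M1 a" "base_map \<Phi> p \<in> chart_dom M2 b" and x: "x = chart_map M1 a p"
    by (auto simp: overlap_def)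
  let ?n = "even_dim M2" and ?m = "odd_dim M2" and ?U = "chart_map M2 b ` chart_dom M2 b"
  let ?S = "genfun \<Phi> a b x"
  have "openin (top_of_set (body_space (even_dim M1))) (chart_map M1 a ` chart_dom M1 a)"
    using assms(1) a by (simp add: supermanifold_def)
  then have x_body: "x \<in> body_space (even_dim M1)"
    using p(1) unfolding x by (meson imageI openin_imp_subset subsetD)
  note at_x = substitute_at_point[OF x_body]
  have deriv: "momentum_deriv k (genfun \<Phi> a b) x = momentum_partial k ?S" for k
    by (simp add: momentum_deriv_def momentum_partial_def)
  have y_eq: "y_equation M1 (genfun \<Phi> a b) (\<lambda>l. coord_fun l x) q k
      = coord_sign k * gen_hom (even_subst q) (odd_subst (\<lambda>l. coord_fun l x) q) (momentum_partial k ?S)" for q k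
    unfolding y_equation_def at_x deriv ..
  have "smooth_map M1 M2 (base_map \<Phi>) (underlying_map M1 \<Phi>)"
    using assms(3) by (simp add: canonical_relation_def)
  then have "body ?n (\<lambda>k. underlying_map M1 \<Phi> a b k x) = chart_map M2 b (base_map \<Phi> p)"
    using a b p by (simp add: smooth_map_def x)
  then have base: "body ?n (\<lambda>k. coord_sign k * gen_hom (even_subst (\<lambda>_. 0))
      (odd_subst (\<lambda>l. coord_fun l x) (\<lambda>_. 0)) (momentum_partial k ?S)) = chart_map M2 b (base_map \<Phi> p)"
    by (simp add: underlying_map_def y_eq)
  interpret local_relation ?n ?U ?m "odd_dim M1" x ?S
  proof
    show "openin (top_of_set (body_space ?n)) ?U"
      using assms(2) b by (simp add: supermanifold_def)
    have "p \<in> overlap M1 M2 \<Phi> a b" using p by (simp add: overlap_def)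
    then show "involves_only (EMom ` {..<?n}) (OCoord ` {..<odd_dim M1} \<union> OMom ` {..<?m}) ?S"
      and "has_parity False ?S"
      using assms(3) a b by (simp_all add: canonical_relation_def x)
    show "body ?n (\<lambda>k. coord_sign k * gen_hom (even_subst (\<lambda>_. 0))
      (odd_subst (\<lambda>l. coord_fun l x) (\<lambda>_. 0)) (momentum_partial k ?S)) \<in> ?U"
      using p(2) by (simp add: base)
  qed
  have K: "manifold_coords M2 = K" by (simp add: manifold_coords_def)

  have phi: "(\<forall>k. phi M1 M2 \<Phi> G a b x k = step (mom (G b) (phi M1 M2 \<Phi> G a b x)) k) \<and> par (phi M1 M2 \<Phi> G a b x)"
    if G: "formal_fun (G b)" for G
  proof -
    obtain y where y: "\<And>k. y k = step (mom (G b) y) k" "par y" using solution_exists[OF G] by blast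
    \<comment> \<open>\<open>momenta_at\<close> and \<open>mom\<close> differ only outside
      \<open>K\<close>, where \<open>S\<close> has no momentum variables; hence the description in
      \<open>phi\<close> is the fixed-point equation.\<close>
    have iff: "(\<forall>k\<in>manifold_coords M2.
        z k = y_equation M1 (genfun \<Phi> a b) (\<lambda>l. coord_fun l x) (momenta_at M2 G b z) k) \<and>
       (\<forall>k. k \<notin> manifold_coords M2 \<longrightarrow> z k = 0) \<longleftrightarrow> (\<forall>k. z k = step (mom (G b) z) k)" for z
    proof -
      have "momenta_subst (momenta_at M2 G b z) (momentum_partial k ?S) = momenta_subst (mom (G b) z) (momentum_partial k ?S)" for k
        by (rule momenta_subst_cong(2)) (simp add: mom_def momenta_at_def)
      then show ?thesis
        unfolding K y_eq momenta_subst_def[symmetric] by (auto simp: step_def)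
    qed
    have "phi M1 M2 \<Phi> G a b x = y"
      unfolding phi_def iff
    proof (rule the_equality)
      show "\<forall>k. y k = step (mom (G b) y) k" using y(1) by blast
      show "z = y" if "\<forall>k. z k = step (mom (G b) z) k" for z
        by (rule solution_unique[OF G _ y(1)]) (use that in blast)
    qed
    then show ?thesis using y by metis
  qed
  have pullback: "generalized_pullback M1 M2 \<Phi> G a b x = value_at (G b) (phi M1 M2 \<Phi> G a b x)" for G
  proof -
    let ?y = "phi M1 M2 \<Phi> G a b x"
    have mom: "momenta_at M2 G b ?y k = mom (G b) ?y k" if "k \<in> K" for k
      using that by (simp add: mom_def momenta_at_def)
    have "momenta_subst (momenta_at M2 G b ?y) ?S = momenta_subst (mom (G b) ?y) ?S"
      by (rule momenta_subst_cong(1)[OF mom])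
    moreover have "(\<Sum>k\<in>K. ?y k * momenta_at M2 G b ?y k) = (\<Sum>k\<in>K. ?y k * mom (G b) ?y k)"
      by (intro sum.cong refl) (simp add: mom)
    ultimately show ?thesis
      unfolding generalized_pullback_def Let_def at_x K momenta_subst_def[symmetric] value_at_def by simp
  qed

  have smooth: "smooth_superfun_on ?n ?U (f b)"
    and inv: "z \<in> ?U \<Longrightarrow> involves_only {} (OCoord ` {..<?m} \<union> range Param) (f b z)"
    if "f \<in> smooth_functions M2" for f z
    using that b by (auto simp: smooth_functions_def)
  have reg: "regular (f b)" if "f \<in> smooth_functions M2" for f
    unfolding regular_def
    by (intro conjI ballI smooth[OF that] involves_only_mono[OF inv[OF that]]) auto
  have parity: "f \<in> smooth_functions M2" "z \<in> ?U \<Longrightarrow> has_parity s (f b z)"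
    if "f \<in> smooth_functions_of_parity s M2" for f s z
    using that b by (auto simp: smooth_functions_of_parity_def)
  note g = parity[OF assms(4)]
  have fpt: "formal_point g b = (\<lambda>z. even_gen Scale * g b z)" by (rule ext) (simp add: formal_point_def)
  have Scale_inv: "involves_only {Scale} W (even_gen Scale)" for W
    by (auto simp: involves_only_def even_gen_def split: if_splits)
  have formal_g: "formal_fun (formal_point g b)"
    unfolding formal_fun_def regular_def fpt
  proof (intro conjI ballI allI)
    show "smooth_superfun_on ?n ?U (\<lambda>z. even_gen Scale * g b z)"
      by (intro smooth_superfun_on_mult_left smooth g(1))
    show "even_gen Scale * g b z \<in> filt formal_degree 1" for z
      by (intro filt_mult_right weight_formal_degree filt_Scale)
    fix z assume z: "z \<in> ?U"
    show "involves_only {Scale} (OCoord ` {..<?m} \<union> range Param) (even_gen Scale * g b z)"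
      by (intro involves_only_mult Scale_inv involves_only_mono[OF inv[OF g(1) z]]) auto
    show "has_parity False (even_gen Scale * g b z)"
      using has_parity_mult[OF has_parity_even_gen g(2)[OF z], of Scale] by simp
  qed
  have fg: "smooth_superfun_on ?n ?U (formal_point g b)"
      "\<And>z. z \<in> ?U \<Longrightarrow> involves_only {Scale} (OCoord ` {..<?m} \<union> range Param) (formal_point g b z)"
      "\<And>z. formal_point g b z \<in> filt formal_degree 1"
      "\<And>z. z \<in> ?U \<Longrightarrow> has_parity False (formal_point g b z)"
    using formal_g unfolding formal_fun_def regular_def by blast+
  let ?y = "phi M1 M2 \<Phi> (formal_point g) a b x"
  note y = phi[of "formal_point g", OF formal_g]
  have near: "near ?y" using solution_near[OF formal_g] y by blast

  show "(\<forall>u\<in>smooth_functions M2. \<forall>v\<in>smooth_functions M2. \<forall>r s.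
       usual_pullback M2 (phi M1 M2 \<Phi> (formal_point g)) (\<lambda>c z. r *\<^sub>R u c z + s *\<^sub>R v c z) a b x =
         r *\<^sub>R usual_pullback M2 (phi M1 M2 \<Phi> (formal_point g)) u a b x +
         s *\<^sub>R usual_pullback M2 (phi M1 M2 \<Phi> (formal_point g)) v a b x) \<and>
    (\<forall>s. \<forall>u \<in> smooth_functions_of_parity s M2. \<forall>\<epsilon>.
       involves_only {} (range Param) \<epsilon> \<and> has_parity s \<epsilon> \<and> \<epsilon> * \<epsilon> = 0 \<longrightarrow>
       generalized_pullback M1 M2 \<Phi> (\<lambda>c z. formal_point g c z + \<epsilon> * u c z) a b x =
         generalized_pullback M1 M2 \<Phi> (formal_point g) a b x +
         \<epsilon> * usual_pullback M2 (phi M1 M2 \<Phi> (formal_point g)) u a b x)"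
  proof (intro conjI ballI allI impI)
    fix u v r s assume "u \<in> smooth_functions M2" "v \<in> smooth_functions M2"
    then show "usual_pullback M2 (phi M1 M2 \<Phi> (formal_point g)) (\<lambda>c z. r *\<^sub>R u c z + s *\<^sub>R v c z) a b x =
         r *\<^sub>R usual_pullback M2 (phi M1 M2 \<Phi> (formal_point g)) u a b x +
         s *\<^sub>R usual_pullback M2 (phi M1 M2 \<Phi> (formal_point g)) v a b x"
      unfolding usual_pullback_def by (intro substitute_lincomb near y[THEN conjunct2] reg)
  next
    fix s u \<epsilon> assume u: "u \<in> smooth_functions_of_parity s M2"
      and "involves_only {} (range Param) \<epsilon> \<and> has_parity s \<epsilon> \<and> \<epsilon> * \<epsilon> = 0"
    then have \<epsilon>: "involves_only {} (range Param) \<epsilon>" "has_parity s \<epsilon>" "\<epsilon> * \<epsilon> = 0" by blast+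
    let ?G = "\<lambda>c z. formal_point g c z + \<epsilon> * u c z"
    note u' = parity[OF u]
    \<comment> \<open>\<epsilon> has positive formal degree, and its product with \<open>u\<close>
      is even because both have parity \<open>s\<close>; so the perturbed point falls under the same
      solution theory.\<close>
    have formal: "formal_fun (?G b)"
      unfolding formal_fun_def regular_def
    proof (intro conjI ballI allI)
      show "smooth_superfun_on ?n ?U (?G b)"
        by (intro smooth_superfun_on_add smooth_superfun_on_mult_left smooth u'(1) fg(1))
      show "?G b z \<in> filt formal_degree 1" for z
        by (intro filt_add fg(3) filt_mult_right weight_formal_degree params_nilpotent_filt \<epsilon>(1,3))
      fix z assume z: "z \<in> ?U"
      have "involves_only {Scale} (OCoord ` {..<?m} \<union> range Param) (u b z)"
        "involves_only {Scale} (OCoord ` {..<?m} \<union> range Param) \<epsilon>"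
        by (rule involves_only_mono[OF inv[OF u'(1) z]] involves_only_mono[OF \<epsilon>(1)]; blast)+
      then show "involves_only {Scale} (OCoord ` {..<?m} \<union> range Param) (?G b z)"
        by (intro involves_only_add involves_only_mult fg(2)[OF z])
      have "has_parity False (\<epsilon> * u b z)"
        using has_parity_mult[OF \<epsilon>(2) u'(2)[OF z]] by simp
      then show "has_parity False (?G b z)"
        by (intro has_parity_add fg(4)[OF z])
    qed
    note y' = phi[of ?G, OF formal]
    show "generalized_pullback M1 M2 \<Phi> ?G a b x = generalized_pullback M1 M2 \<Phi> (formal_point g) a b x
         + \<epsilon> * usual_pullback M2 (phi M1 M2 \<Phi> (formal_point g)) u a b x"
      unfolding pullback usual_pullback_def
      by (rule value_at_expand[OF formal_g reg[OF u'(1)] u'(2) \<epsilon>]) (use y y' formal in blast)+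
  qed
qed

end
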